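(* Let $\mathbb{E}\mathrm{la}$ be the space of 2D elasticity tensors and write $(\mathbf{C}_1,\mathbf{C}_2)=(\lambda_1,\lambda_2,\mu_1,\mu_2,z_{2a},z_{2b},z_{4a},z_{4b})=(\lambda_1,\lambda_2,\mu_1,\mu_2,\mathbf{h}_1,\mathbf{h}_2,\mathbf{H}_1,\mathbf{H}_2)$ in a fixed explicit harmonic decomposition $\mathbb{E}\mathrm{la}\oplus\mathbb{E}\mathrm{la}\simeq4\mathbb{H}^0(\mathbb{R}^2)\oplus2\mathbb{H}^2(\mathbb{R}^2)\oplus2\mathbb{H}^4(\mathbb{R}^2)$. Let $\mathcal{L}$ be the following list of $16$ monomials: order 0: $z_{2a}\overline{z}_{2b}$, $z_{4a}\overline{z}_{4b}$, $z_{2a}^2\overline{z}_{4a}$, $z_{2b}^2\overline{z}_{4a}$, $z_{2a}^2\overline{z}_{4b}$, $z_{2b}^2\overline{z}_{4b}$, $z_{2a}z_{2b}\overline{z}_{4a}$, $z_{2a}z_{2b}\overline{z}_{4b}$; order 2: $\overline{z}_{2a}z^2$, $\overline{z}_{2b}z^2$, $z_{2a}\overline{z}_{4a}z^2$, $z_{2a}\overline{z}_{4b}z^2$, $z_{2b}\overline{z}_{4a}z^2$, $z_{2b}\overline{z}_{4b}z^2$; order 4: $\overline{z}_{4a}z^4$, $\overline{z}_{4b}z^4$. Then: (1) a minimal integrity basis for $\mathrm{Cov}(\mathbb{E}\mathrm{la}\oplus\mathbb{E}\mathrm{la},\mathrm{SO}(2))$ consists of the $41$ covariants ($24$ of them invariants):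 $\lambda_1,\mu_1,\lambda_2,\mu_2$, $z_{2a}\overline{z}_{2a}$, $z_{2b}\overline{z}_{2b}$, $z_{4a}\overline{z}_{4a}$, $z_{4b}\overline{z}_{4b}$, $z\overline{z}$, and $\mathrm{Re}(\mathbf{m})$, $\mathrm{Im}(\mathbf{m})$ for $\mathbf{m}\in\mathcal{L}$; (2) a minimal integrity basis for $\mathrm{Cov}(\mathbb{E}\mathrm{la}\oplus\mathbb{E}\mathrm{la},\mathrm{O}(2))$ consists of the $28$ covariants ($17$ of them invariants): $\lambda_1,\mu_1,\lambda_2,\mu_2$, $z_{2a}\overline{z}_{2a}$, $z_{2b}\overline{z}_{2b}$, $z_{4a}\overline{z}_{4a}$, $z_{4b}\overline{z}_{4b}$, $z\overline{z}$, $\mathrm{Re}(\mathbf{m})$ for $\mathbf{m}\in\mathcal{L}$, and the three products $$\mathrm{Im}(z_{2a}\overline{z}_{2b})\,\mathrm{Im}(z_{4a}\overline{z}_{4b}),\quad \mathrm{Im}(z_{4a}\overline{z}_{4b})\,\mathrm{Im}(\overline{z}_{2a}z^2),\quad \mathrm{Im}(z_{4a}\overline{z}_{4b})\,\mathrm{Im}(\overline{z}_{2b}z^2).$$ In tensorial form, up to non-zero constant factors, the elements of these bases are, in the order of the lists above: - $z_{2a}\overline{z}_{2a},z_{2b}\overline{z}_{2b},z_{4a}\overline{z}_{4a},z_{4b}\overline{z}_{4b},z\overline{z}$ correspond to $\mathbf{h}_1:\mathbf{h}_1$, $\mathbf{h}_2:\mathbf{h}_2$, $\mathbf{H}_1::\mathbf{H}_1$,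 $\mathbf{H}_2::\mathbf{H}_2$, $\mathbf{1}$; - $\mathrm{Re}(\mathbf{m})$, $\mathbf{m}\in\mathcal{L}$: $\mathbf{h}_1:\mathbf{h}_2$, $\mathbf{H}_1::\mathbf{H}_2$, $\mathbf{h}_1:\mathbf{H}_1:\mathbf{h}_1$, $\mathbf{h}_2:\mathbf{H}_1:\mathbf{h}_2$, $\mathbf{h}_1:\mathbf{H}_2:\mathbf{h}_1$, $\mathbf{h}_2:\mathbf{H}_2:\mathbf{h}_2$, $\mathbf{h}_1:\mathbf{H}_1:\mathbf{h}_2$, $\mathbf{h}_1:\mathbf{H}_2:\mathbf{h}_2$; $\mathbf{h}_1$, $\mathbf{h}_2$, $\mathbf{H}_1:\mathbf{h}_1$, $\mathbf{H}_2:\mathbf{h}_1$, $\mathbf{H}_1:\mathbf{h}_2$, $\mathbf{H}_2:\mathbf{h}_2$; $\mathbf{H}_1$, $\mathbf{H}_2$; - $\mathrm{Im}(\mathbf{m})$, $\mathbf{m}\in\mathcal{L}$: $\mathbf{h}_1:(\mathbf{1}\times\mathbf{h}_2)$, $\mathbf{H}_1::(\mathbf{1}\times\mathbf{H}_2)$, $\mathbf{h}_1:\mathbf{H}_1:(\mathbf{1}\times\mathbf{h}_1)$, $\mathbf{h}_2:\mathbf{H}_1:(\mathbf{1}\times\mathbf{h}_2)$, $\mathbf{h}_1:\mathbf{H}_2:(\mathbf{1}\times\mathbf{h}_1)$, $\mathbf{h}_2:\mathbf{H}_2:(\mathbf{1}\times\mathbf{h}_2)$, $\mathbf{h}_1:\mathbf{H}_1:(\mathbf{1}\times\mathbf{h}_2)$,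 $\mathbf{h}_1:\mathbf{H}_2:(\mathbf{1}\times\mathbf{h}_2)$; $\mathbf{1}\times\mathbf{h}_1$, $\mathbf{1}\times\mathbf{h}_2$, $\mathbf{H}_1:(\mathbf{1}\times\mathbf{h}_1)$, $\mathbf{H}_2:(\mathbf{1}\times\mathbf{h}_1)$, $\mathbf{H}_1:(\mathbf{1}\times\mathbf{h}_2)$, $\mathbf{H}_2:(\mathbf{1}\times\mathbf{h}_2)$; $\mathbf{1}\times\mathbf{H}_1$, $\mathbf{1}\times\mathbf{H}_2$; - the three products: $(\mathbf{h}_1:(\mathbf{1}\times\mathbf{h}_2))(\mathbf{H}_1::(\mathbf{1}\times\mathbf{H}_2))$, $(\mathbf{H}_1::(\mathbf{1}\times\mathbf{H}_2))(\mathbf{1}\times\mathbf{h}_1)$, $(\mathbf{H}_1::(\mathbf{1}\times\mathbf{H}_2))(\mathbf{1}\times\mathbf{h}_2)$.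
   Context: $\mathbb{E}\mathrm{la}$ is the space of fourth-order tensors on $\mathbb{R}^2$ with $C_{ijkl}=C_{jikl}=C_{ijlk}=C_{klij}$, with the standard tensorial action of $\mathrm{O}(2)$, generated by rotations $r_\theta$ and $\sigma=\mathrm{diag}(1,-1)$. $\mathbb{H}^0=\mathbb{R}$ is the trivial representation; for $n\ge1$, $\mathbb{H}^n(\mathbb{R}^2)$ is the two-dimensional space of totally symmetric traceless tensors of order $n$. An explicit harmonic decomposition is a choice of $\mathrm{O}(2)$-equivariant linear isomorphism with the indicated direct sum; $\lambda_k,\mu_k$ are the coordinates on the $\mathbb{H}^0$ factors, $\mathbf{h}_1,\mathbf{h}_2\in\mathbb{H}^2$, $\mathbf{H}_1,\mathbf{H}_2\in\mathbb{H}^4$. The complex coordinates $z_{2a},z_{2b},z_{4a},z_{4b}$ are defined by $\mathbf{h}_1(\mathbf{x},\mathbf{x})=\mathrm{Re}(\overline{z}_{2a}z^2)$, $\mathbf{h}_2(\mathbf{x},\mathbf{x})=\mathrm{Re}(\overline{z}_{2b}z^2)$, $\mathbf{H}_1(\mathbf{x},\dots,\mathbf{x})=\mathrm{Re}(\overline{z}_{4a}z^4)$, $\mathbf{H}_2(\mathbf{x},\dots,\mathbf{x})=\mathrm{Re}(\overline{z}_{4b}z^4)$, with $\mathbf{x}=(x,y)$, $z=x+iy$; $r_\theta$ acts by $z_{n\ast}\mapsto e^{in\theta}z_{n\ast}$ and $\sigma$ by conjugation. $\mathrm{Inv}(\mathbb{V},G)$ is the algebra of $G$-invariant real polynomials on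 $\mathbb{V}$; $\mathrm{Cov}(\mathbb{V},G):=\mathrm{Inv}(\mathbb{V}\oplus\mathbb{R}^2,G)$ with standard action on $\mathbf{x}\in\mathbb{R}^2$. A tensor-valued covariant $\mathbf{c}$ of order $o$ is identified with the polynomial $\mathbf{c}(\mathbf{x},\dots,\mathbf{x})$; the order is the degree in $\mathbf{x}$; invariants are covariants of order $0$. An integrity basis is a finite set of homogeneous generators; it is minimal if no proper subset generates. $:$ and $::$ are the contractions over two and four indices; $\mathbf{1}$ is the identity second-order tensor (as a covariant, $x^2+y^2$); $\mathbf{S}_1\times\mathbf{S}_2=-(\mathbf{S}_1\cdot\boldsymbol{\varepsilon}\cdot\mathbf{S}_2)^s$, with $\boldsymbol{\varepsilon}$ the Levi-Civita tensor ($\varepsilon_{12}=1$) and $(\cdot)^s$ total symmetrization. *)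

theory Defs
  imports "HOL-Analysis.Analysis"
begin

section \<open>Tensors on the plane\<close>

type_synonym tensor2 = "real^2^2"
type_synonym tensor4 = "real^2^2^2^2"

definition O2 :: "(real^2^2) set" where
  "O2 = {g. orthogonal_matrix g}"

definition SO2 :: "(real^2^2) set" where
  "SO2 = {g \<in> O2. det g = 1}"

definition act2 :: "real^2^2 \<Rightarrow> tensor2 \<Rightarrow> tensor2" where
  "act2 g T = (\<chi> i j. \<Sum>p\<in>UNIV. \<Sum>q\<in>UNIV. g$i$p * g$j$q * T$p$q)"

definition act4 :: "real^2^2 \<Rightarrow> tensor4 \<Rightarrow> tensor4" where
  "act4 g T = (\<chi> i j k l. \<Sum>p\<in>UNIV. \<Sum>q\<in>UNIV. \<Sum>r\<in>UNIV. \<Sum>s\<in>UNIV.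
     g$i$p * g$j$q * g$k$r * g$l$s * T$p$q$r$s)"

definition Ela :: "tensor4 set" where
  "Ela = {C. \<forall>i j k l. C$i$j$k$l = C$j$i$k$l \<and> C$i$j$k$l = C$i$j$l$k \<and> C$i$j$k$l = C$k$l$i$j}"

definition Harm2 :: "tensor2 set" where
  "Harm2 = {h. (\<forall>i j. h$i$j = h$j$i) \<and> trace h = 0}"

text \<open>Total symmetry is invariance under the three adjacent transpositions, which generate all
  permutations of the four indices; for a symmetric tensor all traces coincide.\<close>

definition Harm4 :: "tensor4 set" where
  "Harm4 = {H. (\<forall>i j k l. H$i$j$k$l = H$j$i$k$l \<and> H$i$j$k$l = H$i$k$j$l \<and> H$i$j$k$l = H$i$j$l$k)
             \<and> (\<forall>k l. (\<Sum>i\<in>UNIV. H$i$i$k$l) = 0)}"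

text \<open>The polynomials \<open>T(x,\<dots>,x)\<close>.\<close>

definition form2 :: "tensor2 \<Rightarrow> real^2 \<Rightarrow> real" where
  "form2 T x = (\<Sum>i\<in>UNIV. \<Sum>j\<in>UNIV. T$i$j * x$i * x$j)"

definition form4 :: "tensor4 \<Rightarrow> real^2 \<Rightarrow> real" where
  "form4 T x = (\<Sum>i\<in>UNIV. \<Sum>j\<in>UNIV. \<Sum>k\<in>UNIV. \<Sum>l\<in>UNIV. T$i$j$k$l * x$i * x$j * x$k * x$l)"

definition contr22 :: "tensor2 \<Rightarrow> tensor2 \<Rightarrow> real" where
  "contr22 S T = (\<Sum>i\<in>UNIV. \<Sum>j\<in>UNIV. S$i$j * T$i$j)"

definition contr42 :: "tensor4 \<Rightarrow> tensor2 \<Rightarrow> tensor2" where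
  "contr42 S T = (\<chi> i j. \<Sum>k\<in>UNIV. \<Sum>l\<in>UNIV. S$i$j$k$l * T$k$l)"

definition contr44 :: "tensor4 \<Rightarrow> tensor4 \<Rightarrow> real" where
  "contr44 S T = (\<Sum>i\<in>UNIV. \<Sum>j\<in>UNIV. \<Sum>k\<in>UNIV. \<Sum>l\<in>UNIV. S$i$j$k$l * T$i$j$k$l)"

definition contr242 :: "tensor2 \<Rightarrow> tensor4 \<Rightarrow> tensor2 \<Rightarrow> real" where
  "contr242 R S T = contr22 R (contr42 S T)"

definition levi_civita :: tensor2 where
  "levi_civita = vector [vector [0, 1], vector [-1, 0]]"

definition sym2 :: "tensor2 \<Rightarrow> tensor2" where
  "sym2 T = (\<chi> i j. (T$i$j + T$j$i) / 2)"

definition sym4 :: "tensor4 \<Rightarrow> tensor4" where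
  "sym4 T = (\<chi> i j k l. (\<Sum>\<pi> | \<pi> permutes {..<4}.
     T $ ([i,j,k,l] ! \<pi> 0) $ ([i,j,k,l] ! \<pi> 1) $ ([i,j,k,l] ! \<pi> 2) $ ([i,j,k,l] ! \<pi> 3)) / fact 4)"

text \<open>The product \<open>S \<times> T = - (S \<cdot> \<epsilon> \<cdot> T)\<^sup>s\<close>, for \<open>S\<close> of order 2 and \<open>T\<close> of order 2 or 4.\<close>

definition cross22 :: "tensor2 \<Rightarrow> tensor2 \<Rightarrow> tensor2" where
  "cross22 S T = - sym2 (S ** levi_civita ** T)"

definition cross24 :: "tensor2 \<Rightarrow> tensor4 \<Rightarrow> tensor4" where
  "cross24 S T = - sym4 (\<chi> i j k l. \<Sum>a\<in>UNIV. \<Sum>b\<in>UNIV. S$i$a * levi_civita$a$b * T$b$j$k$l)"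

section \<open>Invariants, covariants and integrity bases\<close>

text \<open>Representation spaces are subspaces \<open>V\<close> of an ambient normed space. A function on \<open>V\<close> is
  represented by its extensional version (\<open>undefined\<close> outside \<open>V\<close>), so that equality of
  functions is equality on \<open>V\<close>.\<close>

definition polynomials_on :: "'v::real_normed_vector set \<Rightarrow> ('v \<Rightarrow> real) set" where
  "polynomials_on V = {restrict f V | f. real_polynomial_function f}"

definition Inv_algebra ::
  "'v::real_normed_vector set \<Rightarrow> 'g set \<Rightarrow> ('g \<Rightarrow> 'v \<Rightarrow> 'v) \<Rightarrow> ('v \<Rightarrow> real) set" where
  "Inv_algebra V G act = {f \<in> polynomials_on V. \<forall>g\<in>G. \<forall>v\<in>V. f (act g v) = f v}"

definition Cov_algebra ::
  "'v::real_normed_vector set \<Rightarrow> (real^2^2) set \<Rightarrow> (real^2^2 \<Rightarrow> 'v \<Rightarrow> 'v) \<Rightarrow> ('v \<times> (real^2) \<Rightarrow> real) set" where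
  "Cov_algebra V G act = Inv_algebra (V \<times> UNIV) G (\<lambda>g (v, x). (act g v, g *v x))"

inductive_set generated_algebra :: "'v set \<Rightarrow> ('v \<Rightarrow> real) set \<Rightarrow> ('v \<Rightarrow> real) set"
  for V :: "'v set" and B :: "('v \<Rightarrow> real) set" where
  const: "(\<lambda>v\<in>V. c) \<in> generated_algebra V B"
| base: "f \<in> B \<Longrightarrow> f \<in> generated_algebra V B"
| add: "f \<in> generated_algebra V B \<Longrightarrow> g \<in> generated_algebra V B \<Longrightarrow>
    (\<lambda>v\<in>V. f v + g v) \<in> generated_algebra V B"
| mult: "f \<in> generated_algebra V B \<Longrightarrow> g \<in> generated_algebra V B \<Longrightarrow>
    (\<lambda>v\<in>V. f v * g v) \<in> generated_algebra V B"

definition homogeneous_on :: "'v::real_vector set \<Rightarrow> ('v \<Rightarrow> real) \<Rightarrow> bool" where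
  "homogeneous_on V f \<longleftrightarrow> (\<exists>d::nat. \<forall>v\<in>V. \<forall>t. f (t *\<^sub>R v) = t ^ d * f v)"

definition integrity_basis ::
  "'v::real_vector set \<Rightarrow> ('v \<Rightarrow> real) set \<Rightarrow> ('v \<Rightarrow> real) set \<Rightarrow> bool" where
  "integrity_basis V A B \<longleftrightarrow>
     finite B \<and> (\<forall>f\<in>B. homogeneous_on V f) \<and> generated_algebra V B = A"

definition minimal_integrity_basis ::
  "'v::real_vector set \<Rightarrow> ('v \<Rightarrow> real) set \<Rightarrow> ('v \<Rightarrow> real) set \<Rightarrow> bool" where
  "minimal_integrity_basis V A B \<longleftrightarrow>
     integrity_basis V A B \<and> (\<forall>B'. B' \<subset> B \<longrightarrow> generated_algebra V B' \<noteq> A)"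

text \<open>Order of a covariant on \<open>V\<close>: its degree in the vector \<open>x\<close>.\<close>

definition has_order :: "'v set \<Rightarrow> nat \<Rightarrow> ('v \<times> (real^2) \<Rightarrow> real) \<Rightarrow> bool" where
  "has_order V n f \<longleftrightarrow> (\<forall>v\<in>V. \<forall>x t. f (v, t *\<^sub>R x) = t ^ n * f (v, x))"

section \<open>Harmonic decompositions\<close>

definition equivariant_linear_iso ::
  "'g set \<Rightarrow> 'v::real_vector set \<Rightarrow> ('g \<Rightarrow> 'v \<Rightarrow> 'v) \<Rightarrow> 'w::real_vector set \<Rightarrow> ('g \<Rightarrow> 'w \<Rightarrow> 'w) \<Rightarrow>
   ('v \<Rightarrow> 'w) \<Rightarrow> bool" where
  "equivariant_linear_iso G V actV W actW \<Phi> \<longleftrightarrow>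
     bij_betw \<Phi> V W \<and>
     (\<forall>u\<in>V. \<forall>v\<in>V. \<Phi> (u + v) = \<Phi> u + \<Phi> v) \<and>
     (\<forall>c. \<forall>v\<in>V. \<Phi> (c *\<^sub>R v) = c *\<^sub>R \<Phi> v) \<and>
     (\<forall>g\<in>G. \<forall>v\<in>V. \<Phi> (actV g v) = actW g (\<Phi> v))"

type_synonym pair4 = "tensor4 \<times> tensor4"

definition Ela2 :: "pair4 set" where
  "Ela2 = Ela \<times> Ela"

definition act_Ela2 :: "real^2^2 \<Rightarrow> pair4 \<Rightarrow> pair4" where
  "act_Ela2 g = (\<lambda>(C1, C2). (act4 g C1, act4 g C2))"

type_synonym harm_sum =
  "real \<times> real \<times> real \<times> real \<times> tensor2 \<times> tensor2 \<times> tensor4 \<times> tensor4"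

text \<open>\<open>4 H\<^sup>0 \<oplus> 2 H\<^sup>2 \<oplus> 2 H\<^sup>4\<close>\<close>

definition Harm_sum :: "harm_sum set" where
  "Harm_sum = UNIV \<times> UNIV \<times> UNIV \<times> UNIV \<times> Harm2 \<times> Harm2 \<times> Harm4 \<times> Harm4"

definition act_Harm_sum :: "real^2^2 \<Rightarrow> harm_sum \<Rightarrow> harm_sum" where
  "act_Harm_sum g = (\<lambda>(l1, l2, m1, m2, h1, h2, H1, H2).
     (l1, l2, m1, m2, act2 g h1, act2 g h2, act4 g H1, act4 g H2))"

section \<open>The covariants\<close>

definition zc :: "real^2 \<Rightarrow> complex" where
  "zc x = Complex (x$1) (x$2)"

text \<open>In all lists below the arguments are the coordinate functions on pairs \<open>C = (C1, C2)\<close>, and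
  the members are functions of \<open>(C, x)\<close>.\<close>

definition monomials0 where
  "monomials0 z2a z2b z4a z4b =
    [\<lambda>(C::pair4, x::real^2). z2a C * cnj (z2b C) :: complex,
     \<lambda>(C, x). z4a C * cnj (z4b C),
     \<lambda>(C, x). (z2a C)\<^sup>2 * cnj (z4a C),
     \<lambda>(C, x). (z2b C)\<^sup>2 * cnj (z4a C),
     \<lambda>(C, x). (z2a C)\<^sup>2 * cnj (z4b C),
     \<lambda>(C, x). (z2b C)\<^sup>2 * cnj (z4b C),
     \<lambda>(C, x). z2a C * z2b C * cnj (z4a C),
     \<lambda>(C, x). z2a C * z2b C * cnj (z4b C)]"

definition monomials2 where
  "monomials2 z2a z2b z4a z4b =
    [\<lambda>(C::pair4, x). cnj (z2a C) * (zc x)\<^sup>2,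
     \<lambda>(C, x). cnj (z2b C) * (zc x)\<^sup>2,
     \<lambda>(C, x). z2a C * cnj (z4a C) * (zc x)\<^sup>2,
     \<lambda>(C, x). z2a C * cnj (z4b C) * (zc x)\<^sup>2,
     \<lambda>(C, x). z2b C * cnj (z4a C) * (zc x)\<^sup>2,
     \<lambda>(C, x). z2b C * cnj (z4b C) * (zc x)\<^sup>2]"

definition monomials4 where
  "monomials4 z4a z4b =
    [\<lambda>(C::pair4, x). cnj (z4a C) * (zc x)^4,
     \<lambda>(C, x). cnj (z4b C) * (zc x)^4]"

definition monomials where
  "monomials z2a z2b z4a z4b =
     monomials0 z2a z2b z4a z4b @ monomials2 z2a z2b z4a z4b @ monomials4 z4a z4b"

definition scalars where
  "scalars lam1 lam2 mu1 mu2 =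
    [\<lambda>(C::pair4, x::real^2). lam1 C :: real, \<lambda>(C, x). mu1 C, \<lambda>(C, x). lam2 C, \<lambda>(C, x). mu2 C]"

text \<open>The squared moduli are real-valued; \<open>Re\<close> only changes the type.\<close>

definition moduli where
  "moduli z2a z2b z4a z4b =
    [\<lambda>(C::pair4, x). Re (z2a C * cnj (z2a C)),
     \<lambda>(C, x). Re (z2b C * cnj (z2b C)),
     \<lambda>(C, x). Re (z4a C * cnj (z4a C)),
     \<lambda>(C, x). Re (z4b C * cnj (z4b C)),
     \<lambda>(C, x). Re (zc x * cnj (zc x))]"

definition im_products where
  "im_products z2a z2b z4a z4b =
    [\<lambda>(C::pair4, x). Im (z2a C * cnj (z2b C)) * Im (z4a C * cnj (z4b C)),
     \<lambda>(C, x). Im (z4a C * cnj (z4b C)) * Im (cnj (z2a C) * (zc x)\<^sup>2),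
     \<lambda>(C, x). Im (z4a C * cnj (z4b C)) * Im (cnj (z2b C) * (zc x)\<^sup>2)]"

definition re_parts :: "('v \<Rightarrow> complex) list \<Rightarrow> ('v \<Rightarrow> real) list" where
  "re_parts = map (\<lambda>m v. Re (m v))"

definition im_parts :: "('v \<Rightarrow> complex) list \<Rightarrow> ('v \<Rightarrow> real) list" where
  "im_parts = map (\<lambda>m v. Im (m v))"

definition moduli_tensorial where
  "moduli_tensorial h1 h2 H1 H2 =
    [\<lambda>(C::pair4, x::real^2). contr22 (h1 C) (h1 C),
     \<lambda>(C, x). contr22 (h2 C) (h2 C),
     \<lambda>(C, x). contr44 (H1 C) (H1 C),
     \<lambda>(C, x). contr44 (H2 C) (H2 C),
     \<lambda>(C, x). form2 (mat 1) x]"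

definition re_tensorial where
  "re_tensorial h1 h2 H1 H2 =
    [\<lambda>(C::pair4, x::real^2). contr22 (h1 C) (h2 C),
     \<lambda>(C, x). contr44 (H1 C) (H2 C),
     \<lambda>(C, x). contr242 (h1 C) (H1 C) (h1 C),
     \<lambda>(C, x). contr242 (h2 C) (H1 C) (h2 C),
     \<lambda>(C, x). contr242 (h1 C) (H2 C) (h1 C),
     \<lambda>(C, x). contr242 (h2 C) (H2 C) (h2 C),
     \<lambda>(C, x). contr242 (h1 C) (H1 C) (h2 C),
     \<lambda>(C, x). contr242 (h1 C) (H2 C) (h2 C),
     \<lambda>(C, x). form2 (h1 C) x,
     \<lambda>(C, x). form2 (h2 C) x,
     \<lambda>(C, x). form2 (contr42 (H1 C) (h1 C)) x,
     \<lambda>(C, x). form2 (contr42 (H2 C) (h1 C)) x,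
     \<lambda>(C, x). form2 (contr42 (H1 C) (h2 C)) x,
     \<lambda>(C, x). form2 (contr42 (H2 C) (h2 C)) x,
     \<lambda>(C, x). form4 (H1 C) x,
     \<lambda>(C, x). form4 (H2 C) x]"

definition im_tensorial where
  "im_tensorial h1 h2 H1 H2 =
    [\<lambda>(C::pair4, x::real^2). contr22 (h1 C) (cross22 (mat 1) (h2 C)),
     \<lambda>(C, x). contr44 (H1 C) (cross24 (mat 1) (H2 C)),
     \<lambda>(C, x). contr242 (h1 C) (H1 C) (cross22 (mat 1) (h1 C)),
     \<lambda>(C, x). contr242 (h2 C) (H1 C) (cross22 (mat 1) (h2 C)),
     \<lambda>(C, x). contr242 (h1 C) (H2 C) (cross22 (mat 1) (h1 C)),
     \<lambda>(C, x). contr242 (h2 C) (H2 C) (cross22 (mat 1) (h2 C)),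
     \<lambda>(C, x). contr242 (h1 C) (H1 C) (cross22 (mat 1) (h2 C)),
     \<lambda>(C, x). contr242 (h1 C) (H2 C) (cross22 (mat 1) (h2 C)),
     \<lambda>(C, x). form2 (cross22 (mat 1) (h1 C)) x,
     \<lambda>(C, x). form2 (cross22 (mat 1) (h2 C)) x,
     \<lambda>(C, x). form2 (contr42 (H1 C) (cross22 (mat 1) (h1 C))) x,
     \<lambda>(C, x). form2 (contr42 (H2 C) (cross22 (mat 1) (h1 C))) x,
     \<lambda>(C, x). form2 (contr42 (H1 C) (cross22 (mat 1) (h2 C))) x,
     \<lambda>(C, x). form2 (contr42 (H2 C) (cross22 (mat 1) (h2 C))) x,
     \<lambda>(C, x). form4 (cross24 (mat 1) (H1 C)) x,
     \<lambda>(C, x). form4 (cross24 (mat 1) (H2 C)) x]"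

definition im_products_tensorial where
  "im_products_tensorial h1 h2 H1 H2 =
    [\<lambda>(C::pair4, x::real^2).
       contr22 (h1 C) (cross22 (mat 1) (h2 C)) * contr44 (H1 C) (cross24 (mat 1) (H2 C)),
     \<lambda>(C, x). contr44 (H1 C) (cross24 (mat 1) (H2 C)) * form2 (cross22 (mat 1) (h1 C)) x,
     \<lambda>(C, x). contr44 (H1 C) (cross24 (mat 1) (H2 C)) * form2 (cross22 (mat 1) (h2 C)) x]"

definition proportional_on :: "'v set \<Rightarrow> ('v \<Rightarrow> real) \<Rightarrow> ('v \<Rightarrow> real) \<Rightarrow> bool" where
  "proportional_on V f t \<longleftrightarrow> (\<exists>c. c \<noteq> 0 \<and> (\<forall>v\<in>V. t v = c * f v))"

definition restrict_all :: "'v set \<Rightarrow> ('v \<Rightarrow> real) list \<Rightarrow> ('v \<Rightarrow> real) set" where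
  "restrict_all V fs = (\<lambda>f. restrict f V) ` set fs"

end

theory Submission
  imports Defs
begin

text \<open>In the complex coordinates of the harmonic decomposition a rotation multiplies each coordinate
  by a power of a unit complex number \<open>e\<close>, and the reflection \<open>\<sigma>\<close> conjugates all of them. Every
  polynomial is a combination of monomials in the coordinates and their conjugates. Averaging a
  rotation invariant polynomial over sufficiently many rotations by roots of unity keeps it and
  deletes all monomials of nonzero weight, so the task is to factor the monomials of weight zero.

  Only \<open>z\<close> has odd weight. In weight zero its powers can be collected into powers of \<open>|z|\<^sup>2\<close> and
  of \<open>z\<^sup>2\<close>, so that, with weights halved, there are three letters \<open>u\<close> of weight one, namely
  \<open>z\<^sub>2\<^sub>a, z\<^sub>2\<^sub>b, z\<^sup>2\<close>, and two letters \<open>U\<close> of weight two, namely \<open>z\<^sub>4\<^sub>a, z\<^sub>4\<^sub>b\<close>. A greedy cancellation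
  (\<open>word_of_weight_zero_in\<close>) factors every word of weight zero into the short words \<open>u \<cdot> cnj v\<close>,
  \<open>U \<cdot> cnj V\<close>, \<open>u \<cdot> v \<cdot> cnj U\<close> and conjugates of the latter. Apart from squared moduli these are
  exactly the sixteen monomials of the list, and this settles the generation for \<open>SO(2)\<close>.

  An \<open>O(2)\<close>-invariant polynomial only involves real parts of words. Expanding the real part of a
  product of short words produces real parts of short words and products of two imaginary parts.
  The identity \<open>Im_mult_Im\<close>, the multiplicativity of determinants of plane vectors, rewrites each
  such product by real parts of short words, except for the products
  \<open>Im (u \<cdot> cnj v) \<cdot> Im (U \<cdot> cnj V)\<close>. Up to sign only three of these are nonzero: the three
  products that enlarge the basis.

  For minimality, values at a few points separate each generator from the algebra that the others
  generate. Two points suffice when a generator changes while all others agree. For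
  \<open>Re\<close> and \<open>Im\<close> of \<open>u \<cdot> v \<cdot> cnj U\<close> with different \<open>u, v\<close>, and for the three products, this is
  impossible, since such a generator is a rational function of others. There a mixed difference
  over four points, distinguished by two signs, annihilates all other generators exactly and their
  products up to higher order under a dilation towards the origin
  (\<open>not_generated_by_four_points\<close>).

  All this takes place on the coordinate space. An equivariant linear isomorphism transports it to
  pairs of elasticity tensors. The tensorial forms are read off from the fact that harmonic tensors
  of order \<open>n\<close> are the real parts of complex multiples of the \<open>n\<close>-th tensor power of
  \<open>(1, - \<i>)\<close>.\<close>

section \<open>Algebras of real functions\<close>

abbreviation alg :: "('v \<Rightarrow> real) set \<Rightarrow> ('v \<Rightarrow> real) set" where
  "alg F \<equiv> generated_algebra UNIV F"

lemma alg_const: "(\<lambda>k. c) \<in> alg F"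
  using generated_algebra.const[of c UNIV F] by (simp add: restrict_UNIV)

lemma alg_base: "f \<in> F \<Longrightarrow> f \<in> alg F"
  by (rule generated_algebra.base)

lemma alg_add: "f \<in> alg F \<Longrightarrow> g \<in> alg F \<Longrightarrow> (\<lambda>k. f k + g k) \<in> alg F"
  using generated_algebra.add[of f UNIV F g] by (simp add: restrict_UNIV)

lemma alg_mult: "f \<in> alg F \<Longrightarrow> g \<in> alg F \<Longrightarrow> (\<lambda>k. f k * g k) \<in> alg F"
  using generated_algebra.mult[of f UNIV F g] by (simp add: restrict_UNIV)

lemma alg_diff: "f \<in> alg F \<Longrightarrow> g \<in> alg F \<Longrightarrow> (\<lambda>k. f k - g k) \<in> alg F"
  using alg_add[OF _ alg_mult[OF alg_const[of "-1"]], of f F g] by simp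

lemma alg_minus: "f \<in> alg F \<Longrightarrow> (\<lambda>k. - f k) \<in> alg F"
  using alg_diff[OF alg_const[of 0]] by simp

lemma alg_power: "f \<in> alg F \<Longrightarrow> (\<lambda>k. f k ^ n) \<in> alg F"
  by (induction n) (auto intro: alg_const alg_mult)

lemma generated_algebra_mono: "f \<in> generated_algebra V F \<Longrightarrow> F \<subseteq> F' \<Longrightarrow> f \<in> generated_algebra V F'"
  by (induction rule: generated_algebra.induct) (auto intro: generated_algebra.intros)

lemma alg_induct [consumes 1, case_names const base add mult]:
  assumes "f \<in> alg F" "\<And>c. P (\<lambda>k. c)" "\<And>f. f \<in> F \<Longrightarrow> P f"
    "\<And>f g. P f \<Longrightarrow> P g \<Longrightarrow> P (\<lambda>k. f k + g k)" "\<And>f g. P f \<Longrightarrow> P g \<Longrightarrow> P (\<lambda>k. f k * g k)"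
  shows "P f"
  using assms(1) by (induction rule: generated_algebra.induct) (auto simp: restrict_UNIV assms)

section \<open>Words of weight zero in letters of weight one and two\<close>

text \<open>The letters of \<open>L1\<close> and \<open>L2\<close> carry weights one and two, and conjugation changes the sign
  of the weight. A word is short if its weight vanishes but that of no proper nonempty subword
  does.\<close>

inductive_set short_words :: "('v \<Rightarrow> complex) set \<Rightarrow> ('v \<Rightarrow> complex) set \<Rightarrow> ('v \<Rightarrow> complex) set"
  for L1 L2 where
  L1_L1: "u \<in> L1 \<Longrightarrow> v \<in> L1 \<Longrightarrow> (\<lambda>k. u k * cnj (v k)) \<in> short_words L1 L2"
| L2_L2: "U \<in> L2 \<Longrightarrow> V \<in> L2 \<Longrightarrow> (\<lambda>k. U k * cnj (V k)) \<in> short_words L1 L2"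
| L1_L1_L2: "u \<in> L1 \<Longrightarrow> v \<in> L1 \<Longrightarrow> U \<in> L2 \<Longrightarrow> (\<lambda>k. u k * v k * cnj (U k)) \<in> short_words L1 L2"
| L2_L1_L1: "u \<in> L1 \<Longrightarrow> v \<in> L1 \<Longrightarrow> U \<in> L2 \<Longrightarrow> (\<lambda>k. cnj (u k * v k * cnj (U k))) \<in> short_words L1 L2"

text \<open>Short words can be cancelled greedily: if no letters of equal weight face each other, then
  one side has letters of weight two only and the other side has letters of weight one only, twice
  as many.\<close>

lemma word_of_weight_zero_in:
  fixes M :: "('v \<Rightarrow> complex) set"
  assumes one: "(\<lambda>k. 1) \<in> M"
    and step: "\<And>g f. g \<in> short_words L1 L2 \<Longrightarrow> f \<in> M \<Longrightarrow> (\<lambda>k. g k * f k) \<in> M"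
  shows "set us \<subseteq> L1 \<Longrightarrow> set vs \<subseteq> L1 \<Longrightarrow> set Us \<subseteq> L2 \<Longrightarrow> set Vs \<subseteq> L2 \<Longrightarrow>
    length us + 2 * length Us = length vs + 2 * length Vs \<Longrightarrow>
    (\<lambda>k. (\<Prod>u\<leftarrow>us. u k) * cnj (\<Prod>v\<leftarrow>vs. v k) * (\<Prod>U\<leftarrow>Us. U k) * cnj (\<Prod>V\<leftarrow>Vs. V k)) \<in> M"
proof (induction "length us + length vs + length Us + length Vs" arbitrary: us vs Us Vs
    rule: less_induct)
  case less
  let ?f = "\<lambda>us vs Us Vs k. (\<Prod>u\<leftarrow>us. u k) * cnj (\<Prod>v\<leftarrow>vs. v k) * (\<Prod>U\<leftarrow>Us. U k) *
    cnj (\<Prod>V\<leftarrow>Vs. V k) :: complex"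
  consider (empty) "us = []" "vs = []" "Us = []" "Vs = []"
    | (L1_L1) u us' v vs' where "us = u # us'" "vs = v # vs'"
    | (L2_L2) U Us' V Vs' where "Us = U # Us'" "Vs = V # Vs'"
    | (L1_L1_L2) u v us' V Vs' where "us = u # v # us'" "Vs = V # Vs'"
    | (L2_L1_L1) u v vs' U Us' where "vs = u # v # vs'" "Us = U # Us'"
    using less.prems(5)
    by (cases us; cases vs; cases Us; cases Vs; cases "tl us"; cases "tl vs") auto
  then show ?case
  proof cases
    case empty
    then show ?thesis using one by simp
  next
    case L1_L1
    have "?f us' vs' Us Vs \<in> M" by (rule less.hyps) (use less.prems L1_L1 in auto)
    from step[OF short_words.L1_L1 this, of u v] show ?thesis
      using less.prems by (simp add: L1_L1 mult_ac)
  next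
    case L2_L2
    have "?f us vs Us' Vs' \<in> M" by (rule less.hyps) (use less.prems L2_L2 in auto)
    from step[OF short_words.L2_L2 this, of U V] show ?thesis
      using less.prems by (simp add: L2_L2 mult_ac)
  next
    case L1_L1_L2
    have "?f us' vs Us Vs' \<in> M" by (rule less.hyps) (use less.prems L1_L1_L2 in auto)
    from step[OF short_words.L1_L1_L2 this, of u v V] show ?thesis
      using less.prems by (simp add: L1_L1_L2 mult_ac)
  next
    case L2_L1_L1
    have "?f us vs' Us' Vs \<in> M" by (rule less.hyps) (use less.prems L2_L1_L1 in auto)
    from step[OF short_words.L2_L1_L1 this, of u v U] show ?thesis
      using less.prems by (simp add: L2_L1_L1 mult_ac)
  qed
qed

text \<open>The identity behind all reductions of products of imaginary parts: as
  \<open>Im (u \<cdot> cnj v)\<close> is, up to sign, the determinant of two plane vectors, this is the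
  multiplicativity of determinants.\<close>

lemma Im_mult_Im:
  "Im (u * cnj v) * Im (p * cnj q) =
     Re (u * cnj p) * Re (v * cnj q) - Re (u * cnj q) * Re (v * cnj p)"
  by (simp add: algebra_simps)

text \<open>The factors are grouped such that all products on the right-hand side of \<open>Im_mult_Im\<close> have
  weight zero. For \<open>u \<cdot> cnj v\<close> and \<open>U \<cdot> cnj V\<close> there is no such grouping, whence the
  assumption \<open>mixed\<close>.\<close>

lemma Im_mult_Im_short_words:
  assumes L1_L1: "\<And>u v. u \<in> L1 \<Longrightarrow> v \<in> L1 \<Longrightarrow> (\<lambda>k. Re (u k * cnj (v k))) \<in> alg F"
    and L2_L2: "\<And>U V. U \<in> L2 \<Longrightarrow> V \<in> L2 \<Longrightarrow> (\<lambda>k. Re (U k * cnj (V k))) \<in> alg F"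
    and L1_L1_L2: "\<And>u v U. u \<in> L1 \<Longrightarrow> v \<in> L1 \<Longrightarrow> U \<in> L2 \<Longrightarrow> (\<lambda>k. Re (u k * v k * cnj (U k))) \<in> alg F"
    and mixed: "\<And>u v U V. u \<in> L1 \<Longrightarrow> v \<in> L1 \<Longrightarrow> U \<in> L2 \<Longrightarrow> V \<in> L2 \<Longrightarrow>
      (\<lambda>k. Im (u k * cnj (v k)) * Im (U k * cnj (V k))) \<in> alg F"
    and "g \<in> short_words L1 L2" "h \<in> short_words L1 L2"
  shows "(\<lambda>k. Im (g k) * Im (h k)) \<in> alg F"
proof -
  have L1_L1': "(\<lambda>k. Im (u k * cnj (v k)) * Im (p k * cnj (q k))) \<in> alg F"
    if "u \<in> L1" "v \<in> L1" "p \<in> L1" "q \<in> L1" for u v p q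
    unfolding Im_mult_Im by (intro alg_diff alg_mult L1_L1 that)
  have L2_L2': "(\<lambda>k. Im (u k * cnj (v k)) * Im (p k * cnj (q k))) \<in> alg F"
    if "u \<in> L2" "v \<in> L2" "p \<in> L2" "q \<in> L2" for u v p q
    unfolding Im_mult_Im by (intro alg_diff alg_mult L2_L2 that)
  have Re_four: "(\<lambda>k. Re ((u k * v k) * cnj (p k * q k))) \<in> alg F"
    if "u \<in> L1" "v \<in> L1" "p \<in> L1" "q \<in> L1" for u v p q
  proof -
    have "(\<lambda>k. Re ((u k * v k) * cnj (p k * q k))) =
      (\<lambda>k. Re (u k * cnj (p k)) * Re (v k * cnj (q k)) - Im (u k * cnj (p k)) * Im (v k * cnj (q k)))"
      by (auto simp: algebra_simps)
    moreover have "\<dots> \<in> alg F" by (intro alg_diff alg_mult L1_L1 L1_L1' that)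
    ultimately show ?thesis by simp
  qed
  have L2_L1_L1: "(\<lambda>k. Re (U k * cnj (u k * v k))) \<in> alg F" if "u \<in> L1" "v \<in> L1" "U \<in> L2" for u v U
    using L1_L1_L2[OF that] by (simp add: algebra_simps)
  have triple_triple: "(\<lambda>k. Im (u k * v k * cnj (U k)) * Im (p k * q k * cnj (V k))) \<in> alg F"
    if "u \<in> L1" "v \<in> L1" "p \<in> L1" "q \<in> L1" "U \<in> L2" "V \<in> L2" for u v p q U V
    unfolding Im_mult_Im by (intro alg_diff alg_mult Re_four L1_L1_L2 L2_L1_L1 L2_L2 that)
  have L2_triple: "(\<lambda>k. Im (U k * cnj (V k)) * Im (u k * v k * cnj (W k))) \<in> alg F"
    if "u \<in> L1" "v \<in> L1" "U \<in> L2" "V \<in> L2" "W \<in> L2" for u v U V W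
    unfolding Im_mult_Im by (intro alg_diff alg_mult L2_L1_L1 L2_L2 that)
  \<comment> \<open>Grouping the second factor as \<open>p \<cdot> cnj (U \<cdot> cnj q)\<close> balances the weights in the identity.\<close>
  have L1_triple: "(\<lambda>k. Im (u k * cnj (v k)) * Im (p k * q k * cnj (U k))) \<in> alg F"
    if "u \<in> L1" "v \<in> L1" "p \<in> L1" "q \<in> L1" "U \<in> L2" for u v p q U
  proof -
    have "(\<lambda>k. Im (u k * cnj (v k)) * Im (p k * q k * cnj (U k))) =
      (\<lambda>k. Re (u k * cnj (p k)) * Re (v k * q k * cnj (U k)) -
           Re (u k * q k * cnj (U k)) * Re (v k * cnj (p k)))"
      using Im_mult_Im[of "u _" "v _" "p _" "U _ * cnj (q _)"] by (simp add: mult_ac)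
    moreover have "\<dots> \<in> alg F" by (intro alg_diff alg_mult L1_L1 L1_L1_L2 that)
    ultimately show ?thesis by simp
  qed
  have sym: "(\<lambda>k. x k * y k) \<in> alg F \<Longrightarrow> (\<lambda>k. y k * x k) \<in> alg F"
    and neg: "(\<lambda>k. x k * y k) \<in> alg F \<Longrightarrow> (\<lambda>k. - x k * y k) \<in> alg F"
      "(\<lambda>k. x k * y k) \<in> alg F \<Longrightarrow> (\<lambda>k. x k * - y k) \<in> alg F"
      "(\<lambda>k. x k * y k) \<in> alg F \<Longrightarrow> (\<lambda>k. - x k * - y k) \<in> alg F" for x y
    using alg_minus[of "\<lambda>k. x k * y k" F] by (simp_all add: mult.commute)
  show ?thesis
    using assms(5,6)
    by (elim short_words.cases; hypsubst; (simp only: cnj.simps(2))?)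
      ((rule neg)?, (rule L1_L1' L2_L2' mixed triple_triple L1_triple L2_triple
        sym[OF mixed] sym[OF L1_triple] sym[OF L2_triple]; assumption))+
qed

text \<open>Imaginary parts of short words need not lie in the algebra. What multiplication by a short
  word preserves is that the real part lies in it, and that the imaginary part does so after
  multiplication by the imaginary part of any short word.\<close>

lemma Re_word_of_weight_zero:
  assumes Re: "\<And>g. g \<in> short_words L1 L2 \<Longrightarrow> (\<lambda>k. Re (g k)) \<in> alg F"
    and Im: "\<And>g h. g \<in> short_words L1 L2 \<Longrightarrow> h \<in> short_words L1 L2 \<Longrightarrow>
      (\<lambda>k. Im (g k) * Im (h k)) \<in> alg F"
    and "set us \<subseteq> L1" "set vs \<subseteq> L1" "set Us \<subseteq> L2" "set Vs \<subseteq> L2"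
      "length us + 2 * length Us = length vs + 2 * length Vs"
  shows "(\<lambda>k. Re ((\<Prod>u\<leftarrow>us. u k) * cnj (\<Prod>v\<leftarrow>vs. v k) * (\<Prod>U\<leftarrow>Us. U k) * cnj (\<Prod>V\<leftarrow>Vs. V k))) \<in> alg F"
proof -
  define M where "M = {f. (\<lambda>k. Re (f k)) \<in> alg F \<and>
    (\<forall>h\<in>short_words L1 L2. (\<lambda>k. Im (f k) * Im (h k)) \<in> alg F)}"
  have "(\<lambda>k. g k * f k) \<in> M" if g: "g \<in> short_words L1 L2" and f: "f \<in> M" for g f
  proof -
    have "(\<lambda>k. Im (g k) * Im (f k)) \<in> alg F"
      using f g by (auto simp: M_def mult.commute)
    then have "(\<lambda>k. Re (g k * f k)) \<in> alg F"
      using f Re[OF g] by (auto simp: M_def intro!: alg_diff alg_mult)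
    moreover have "(\<lambda>k. Im (g k * f k) * Im (h k)) \<in> alg F" if h: "h \<in> short_words L1 L2" for h
    proof -
      have "(\<lambda>k. Re (g k) * (Im (f k) * Im (h k)) + Re (f k) * (Im (g k) * Im (h k))) \<in> alg F"
        using f g h Re Im by (auto simp: M_def intro!: alg_add alg_mult[of "\<lambda>k. Re (_ k)"])
      then show ?thesis by (simp add: algebra_simps)
    qed
    ultimately show ?thesis by (simp add: M_def)
  qed
  from word_of_weight_zero_in[OF _ this assms(3-7)]
  show ?thesis by (auto simp: M_def alg_const)
qed

lemma Re_Im_word_of_weight_zero:
  assumes Re: "\<And>g. g \<in> short_words L1 L2 \<Longrightarrow> (\<lambda>k. Re (g k)) \<in> alg F \<and> (\<lambda>k. Im (g k)) \<in> alg F"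
    and "set us \<subseteq> L1" "set vs \<subseteq> L1" "set Us \<subseteq> L2" "set Vs \<subseteq> L2"
      "length us + 2 * length Us = length vs + 2 * length Vs"
  shows "(\<lambda>k. (\<Prod>u\<leftarrow>us. u k) * cnj (\<Prod>v\<leftarrow>vs. v k) * (\<Prod>U\<leftarrow>Us. U k) * cnj (\<Prod>V\<leftarrow>Vs. V k)) \<in>
    {f. (\<lambda>k. Re (f k)) \<in> alg F \<and> (\<lambda>k. Im (f k)) \<in> alg F}"
  by (rule word_of_weight_zero_in[OF _ _ assms(2-6)])
    (auto simp: alg_const intro!: alg_diff alg_add alg_mult dest: Re)

section \<open>The representation in complex coordinates\<close>

text \<open>The coordinates are \<open>\<lambda>\<^sub>1, \<lambda>\<^sub>2, \<mu>\<^sub>1, \<mu>\<^sub>2, z\<^sub>2\<^sub>a, z\<^sub>2\<^sub>b, z\<^sub>4\<^sub>a, z\<^sub>4\<^sub>b, z\<close>, in this order.\<close>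

type_synonym coords =
  "real \<times> real \<times> real \<times> real \<times> complex \<times> complex \<times> complex \<times> complex \<times> complex"

definition cl1 :: "coords \<Rightarrow> real" where "cl1 k = fst k"
definition cl2 :: "coords \<Rightarrow> real" where "cl2 k = fst (snd k)"
definition cm1 :: "coords \<Rightarrow> real" where "cm1 k = fst (snd (snd k))"
definition cm2 :: "coords \<Rightarrow> real" where "cm2 k = fst (snd (snd (snd k)))"
definition ca :: "coords \<Rightarrow> complex" where "ca k = fst (snd (snd (snd (snd k))))"
definition cb :: "coords \<Rightarrow> complex" where "cb k = fst (snd (snd (snd (snd (snd k)))))"
definition cA :: "coords \<Rightarrow> complex" where "cA k = fst (snd (snd (snd (snd (snd (snd k))))))"
definition cB :: "coords \<Rightarrow> complex" where "cB k = fst (snd (snd (snd (snd (snd (snd (snd k)))))))"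
definition cz :: "coords \<Rightarrow> complex" where "cz k = snd (snd (snd (snd (snd (snd (snd (snd k)))))))"

lemmas coord_defs = cl1_def cl2_def cm1_def cm2_def ca_def cb_def cA_def cB_def cz_def

lemma coord_tuple [simp]:
  "cl1 (l1, l2, m1, m2, a, b, A, B, z) = l1"
  "cl2 (l1, l2, m1, m2, a, b, A, B, z) = l2"
  "cm1 (l1, l2, m1, m2, a, b, A, B, z) = m1"
  "cm2 (l1, l2, m1, m2, a, b, A, B, z) = m2"
  "ca (l1, l2, m1, m2, a, b, A, B, z) = a"
  "cb (l1, l2, m1, m2, a, b, A, B, z) = b"
  "cA (l1, l2, m1, m2, a, b, A, B, z) = A"
  "cB (l1, l2, m1, m2, a, b, A, B, z) = B"
  "cz (l1, l2, m1, m2, a, b, A, B, z) = z"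
  by (simp_all add: coord_defs)

lemma coords_eta: "k = (cl1 k, cl2 k, cm1 k, cm2 k, ca k, cb k, cA k, cB k, cz k)"
  by (simp add: coord_defs)

definition first_column :: "real^2^2 \<Rightarrow> complex" where
  "first_column g = Complex (g$1$1) (g$2$1)"

text \<open>The action of \<open>O(2)\<close> on the line of weight \<open>n\<close>: an orthogonal matrix is determined by its
  first column \<open>e\<close> and its determinant; it acts on the plane by \<open>z \<mapsto> e z\<close> or
  \<open>z \<mapsto> e \<cdot> cnj z\<close>.\<close>

definition weight_act :: "nat \<Rightarrow> real^2^2 \<Rightarrow> complex \<Rightarrow> complex" where
  "weight_act n g u = first_column g ^ n * (if det g = 1 then u else cnj u)"

definition act_coords :: "real^2^2 \<Rightarrow> coords \<Rightarrow> coords" where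
  "act_coords g k = (cl1 k, cl2 k, cm1 k, cm2 k, weight_act 2 g (ca k), weight_act 2 g (cb k),
     weight_act 4 g (cA k), weight_act 4 g (cB k), weight_act 1 g (cz k))"

definition rotation :: "complex \<Rightarrow> real^2^2" where
  "rotation e = vector [vector [Re e, - Im e], vector [Im e, Re e]]"

definition reflection :: "real^2^2" where
  "reflection = vector [vector [1, 0], vector [0, -1]]"

lemma O2_iff:
  "g \<in> O2 \<longleftrightarrow> (g$1$1)\<^sup>2 + (g$2$1)\<^sup>2 = 1 \<and> (g$1$2)\<^sup>2 + (g$2$2)\<^sup>2 = 1 \<and> g$1$1 * g$1$2 + g$2$1 * g$2$2 = 0"
  by (auto simp: O2_def orthogonal_matrix vec_eq_iff matrix_matrix_mult_def transpose_def mat_def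
      forall_2 sum_2 power2_eq_square mult_ac)

lemma O2_cases:
  assumes "g \<in> O2"
  obtains (rotation) "det g = 1" "g$2$2 = g$1$1" "g$1$2 = - g$2$1"
  | (reflection) "det g \<noteq> 1" "g$2$2 = - g$1$1" "g$1$2 = g$2$1"
proof -
  have eqs: "(g$1$1)\<^sup>2 + (g$2$1)\<^sup>2 = 1" "(g$1$2)\<^sup>2 + (g$2$2)\<^sup>2 = 1"
    "g$1$1 * g$1$2 + g$2$1 * g$2$2 = 0"
    using assms by (auto simp: O2_iff)
  define d where "d = det g"
  have d: "g$1$1 * g$2$2 - g$1$2 * g$2$1 = d" by (simp add: d_def det_2)
  have "d\<^sup>2 = 1" using eqs unfolding d[symmetric] by algebra
  moreover have "g$2$2 = d * g$1$1" "g$1$2 = - d * g$2$1"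
    using eqs unfolding d[symmetric] by algebra+
  ultimately show thesis
    using that by (cases "d = 1") (auto simp: power2_eq_1_iff d_def)
qed

lemma norm_first_column: "g \<in> O2 \<Longrightarrow> cmod (first_column g) = 1"
  by (simp add: O2_iff first_column_def cmod_def)

lemma rotation_SO2: "cmod e = 1 \<Longrightarrow> rotation e \<in> SO2"
  by (simp add: SO2_def O2_iff rotation_def det_2 cmod_def power2_eq_square)

lemma reflection_O2: "reflection \<in> O2"
  by (simp add: O2_iff reflection_def)

lemma first_column_rotation: "first_column (rotation e) = e"
  by (simp add: first_column_def rotation_def)

text \<open>Monomials together with their weight: the rotation with first column \<open>e\<close> multiplies them by
  \<open>e\<close> to the power of the weight.\<close>

inductive weighted :: "int \<Rightarrow> (coords \<Rightarrow> complex) \<Rightarrow> bool" where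
  one: "weighted 0 (\<lambda>k. 1)"
| scalar: "r \<in> {cl1, cl2, cm1, cm2} \<Longrightarrow> weighted 0 (\<lambda>k. of_real (r k))"
| cz: "weighted 1 cz"
| order2: "u \<in> {ca, cb} \<Longrightarrow> weighted 2 u"
| order4: "U \<in> {cA, cB} \<Longrightarrow> weighted 4 U"
| cnj: "weighted w f \<Longrightarrow> weighted (- w) (\<lambda>k. cnj (f k))"
| mult: "weighted w f \<Longrightarrow> weighted w' g \<Longrightarrow> weighted (w + w') (\<lambda>k. f k * g k)"

lemma coord_act [simp]:
  "cl1 (act_coords g k) = cl1 k" "cl2 (act_coords g k) = cl2 k"
  "cm1 (act_coords g k) = cm1 k" "cm2 (act_coords g k) = cm2 k"
  "ca (act_coords g k) = weight_act 2 g (ca k)" "cb (act_coords g k) = weight_act 2 g (cb k)"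
  "cA (act_coords g k) = weight_act 4 g (cA k)" "cB (act_coords g k) = weight_act 4 g (cB k)"
  "cz (act_coords g k) = weight_act 1 g (cz k)"
  by (simp_all add: act_coords_def)

lemma weighted_rotation:
  assumes "weighted w f" "g \<in> SO2"
  shows "f (act_coords g k) = first_column g powi w * f k"
proof -
  have g: "det g = 1" "cmod (first_column g) = 1"
    using assms(2) by (auto simp: SO2_def norm_first_column)
  then have nz: "first_column g \<noteq> 0" by auto
  have inv: "cnj (first_column g) = inverse (first_column g)"
    by (rule inverse_unique[symmetric]) (simp add: g(2) flip: complex_norm_square)
  show ?thesis
    using assms(1)
  proof induction
    case (cnj w f)
    have "cnj (first_column g powi w) = first_column g powi (- w)"
      by (simp add: power_int_def inv power_inverse)
    then show ?case by (simp add: cnj)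
  next
    case (mult w f w' g)
    then show ?case using nz by (simp add: power_int_add)
  qed (auto simp: weight_act_def g)
qed

lemma weight_act_reflection: "weight_act n reflection u = cnj u"
  by (simp add: weight_act_def first_column_def reflection_def det_2 flip: one_complex.code)

lemma weighted_reflection: "weighted w f \<Longrightarrow> f (act_coords reflection k) = cnj (f k)"
  by (induction rule: weighted.induct) (auto simp: weight_act_reflection)

section \<open>Invariant polynomials as combinations of weight zero monomials\<close>

inductive_set combinations :: "('v \<Rightarrow> complex) set \<Rightarrow> ('v \<Rightarrow> complex) set" for S where
  zero: "(\<lambda>k. 0) \<in> combinations S"
| add_term: "f \<in> S \<Longrightarrow> g \<in> combinations S \<Longrightarrow> (\<lambda>k. c * f k + g k) \<in> combinations S"

lemma combinations_add:
  assumes "f \<in> combinations S" "g \<in> combinations S"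
  shows "(\<lambda>k. f k + g k) \<in> combinations S"
  using assms(1)
proof induction
  case (add_term f g' c)
  from combinations.add_term[OF add_term(1,3), of c] show ?case by (simp add: add.assoc)
qed (use assms(2) in simp)

lemma combinations_scale: "f \<in> combinations S \<Longrightarrow> (\<lambda>k. c * f k) \<in> combinations S"
proof (induction rule: combinations.induct)
  case (add_term f g d)
  from combinations.add_term[OF add_term(1,3), of "c * d"] show ?case by (simp add: algebra_simps)
qed (simp add: combinations.zero)

lemma combinations_base: "f \<in> S \<Longrightarrow> f \<in> combinations S"
  using combinations.add_term[OF _ combinations.zero, of f S 1] by simp

lemma combinations_mult:
  assumes S: "\<And>f g. f \<in> S \<Longrightarrow> g \<in> S \<Longrightarrow> (\<lambda>k. f k * g k) \<in> S"
    and "f \<in> combinations S" "g \<in> combinations S"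
  shows "(\<lambda>k. f k * g k) \<in> combinations S"
proof -
  have *: "(\<lambda>k. h k * g k) \<in> combinations S" if "h \<in> S" for h
    using assms(3)
  proof induction
    case (add_term f g c)
    from combinations.add_term[OF S[OF that add_term(1)] add_term(3), of c]
    show ?case by (simp add: algebra_simps)
  qed (simp add: combinations.zero)
  show ?thesis
    using assms(2)
  proof induction
    case (add_term f g' c)
    from combinations_add[OF combinations_scale[OF *[OF add_term(1)], of c] add_term(3)]
    show ?case by (simp add: algebra_simps)
  qed (simp add: combinations.zero)
qed

text \<open>A real linear form on the complex numbers is a complex combination of the identity and the
  conjugation.\<close>

lemma combinations_linear_coord:
  fixes h :: "complex \<Rightarrow> real"
  assumes "u \<in> S" "(\<lambda>k. cnj (u k)) \<in> S" "linear h"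
  shows "(\<lambda>k. of_real (h (u k))) \<in> combinations S"
proof -
  have h: "h x = Re x * h 1 + Im x * h \<i>" for x
  proof -
    have "x = Re x *\<^sub>R 1 + Im x *\<^sub>R \<i>" by (simp add: complex_eq_iff)
    from arg_cong[OF this, of h] show ?thesis
      by (simp only: linear_add[OF assms(3)] linear_scale[OF assms(3)] real_scaleR_def)
  qed
  define c where "c = (Complex (h 1) (- h \<i>)) / 2"
  have "of_real (h x) = c * x + cnj c * cnj x" for x
    by (subst h) (simp add: c_def complex_eq_iff field_simps)
  then show ?thesis
    using combinations_add[OF combinations_scale[OF combinations_base[OF assms(1)], of c]
        combinations_scale[OF combinations_base[OF assms(2)], of "cnj c"]] by simp
qed

lemma polynomial_in_combinations:
  fixes f :: "coords \<Rightarrow> real"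
  assumes "real_polynomial_function f"
  shows "(\<lambda>k. of_real (f k)) \<in> combinations {h. \<exists>w. weighted w h}"
  using assms
proof induction
  case (linear f)
  let ?S = "{h. \<exists>w. weighted w h}"
  have lin: "linear f" using linear by (simp add: bounded_linear.linear)
  have split: "f = (\<lambda>k. cl1 k * f (1,0,0,0,0,0,0,0,0) + cl2 k * f (0,1,0,0,0,0,0,0,0)
      + cm1 k * f (0,0,1,0,0,0,0,0,0) + cm2 k * f (0,0,0,1,0,0,0,0,0)
      + f (0,0,0,0,ca k,0,0,0,0) + f (0,0,0,0,0,cb k,0,0,0) + f (0,0,0,0,0,0,cA k,0,0)
      + f (0,0,0,0,0,0,0,cB k,0) + f (0,0,0,0,0,0,0,0,cz k))" (is "_ = ?rhs")
  proof
    fix k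
    have "f k = f (cl1 k *\<^sub>R (1,0,0,0,0,0,0,0,0) + cl2 k *\<^sub>R (0,1,0,0,0,0,0,0,0)
      + cm1 k *\<^sub>R (0,0,1,0,0,0,0,0,0) + cm2 k *\<^sub>R (0,0,0,1,0,0,0,0,0)
      + (0,0,0,0,ca k,0,0,0,0) + (0,0,0,0,0,cb k,0,0,0) + (0,0,0,0,0,0,cA k,0,0)
      + (0,0,0,0,0,0,0,cB k,0) + (0,0,0,0,0,0,0,0,cz k))"
      by (rule arg_cong[of _ _ f]) (simp add: coord_defs)
    also have "\<dots> = ?rhs k" by (simp only: linear_add[OF lin] linear_scale[OF lin] real_scaleR_def)
    finally show "f k = ?rhs k" .
  qed
  have scal: "(\<lambda>k. of_real (r k * c)) \<in> combinations ?S" if "r \<in> {cl1, cl2, cm1, cm2}" for r c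
    using combinations_scale[OF combinations_base[of _ ?S], of "\<lambda>k. of_real (r k)" "of_real c"]
      weighted.scalar[OF that] by (auto simp: mult.commute)
  have coord: "(\<lambda>k. of_real (h (u k))) \<in> combinations ?S"
    if "u \<in> {ca, cb, cA, cB, cz}" "linear h" for u h
  proof -
    have "\<exists>w. weighted w u"
      using that(1) weighted.cz weighted.order2[of u] weighted.order4[of u] by auto
    then show ?thesis
      using that(2) by (intro combinations_linear_coord) (auto intro: weighted.cnj)
  qed
  have lin': "linear (\<lambda>x. f (0,0,0,0,x,0,0,0,0))" "linear (\<lambda>x. f (0,0,0,0,0,x,0,0,0))"
    "linear (\<lambda>x. f (0,0,0,0,0,0,x,0,0))" "linear (\<lambda>x. f (0,0,0,0,0,0,0,x,0))"
    "linear (\<lambda>x. f (0,0,0,0,0,0,0,0,x))"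
    by (rule linearI; simp only: linear_add[OF lin, symmetric] linear_scale[OF lin, symmetric]
        add_Pair scaleR_Pair add_0 scaleR_zero_right)+
  show ?case
    by (subst split, unfold of_real_add)
      (intro combinations_add scal coord[OF _ lin'(1)] coord[OF _ lin'(2)]
        coord[OF _ lin'(3)] coord[OF _ lin'(4)] coord[OF _ lin'(5)]; simp)
next
  case (const c)
  have "(\<lambda>k. 1) \<in> {h. \<exists>w. weighted w h}" using weighted.one by blast
  from combinations_scale[OF combinations_base[OF this], of "of_real c"] show ?case by simp
next
  case (add f g)
  then show ?case by (simp add: combinations_add)
next
  case (mult f g)
  have "(\<lambda>k. h k * h' k) \<in> {h. \<exists>w. weighted w h}"
    if "h \<in> {h. \<exists>w. weighted w h}" "h' \<in> {h. \<exists>w. weighted w h}" for h h'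
    using that weighted.mult by blast
  from combinations_mult[OF this mult.IH] show ?case by simp
qed

definition rotation_average :: "nat \<Rightarrow> (coords \<Rightarrow> complex) \<Rightarrow> coords \<Rightarrow> complex" where
  "rotation_average n f k =
     (\<Sum>j<n. f (act_coords (rotation (cis (2 * pi / real n) ^ j)) k)) / of_nat n"

text \<open>The average of a monomial of weight \<open>w\<close> contains the geometric sum of the powers of an
  \<open>n\<close>-th root of unity, which differs from one unless \<open>n\<close> divides \<open>w\<close>.\<close>

lemma rotation_average_weighted:
  assumes f: "weighted w f" and n: "\<bar>w\<bar> < int n"
  shows "rotation_average n f = (\<lambda>k. if w = 0 then f k else 0)"
proof
  fix k
  define e where "e = cis (2 * pi / real n)"
  have n0: "n > 0" using n by simp
  have "f (act_coords (rotation (e ^ j)) k) = (e powi w) ^ j * f k" for j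
  proof -
    have "cmod (e ^ j) = 1" by (simp only: norm_power e_def norm_cis power_one)
    from weighted_rotation[OF f rotation_SO2[OF this], of k]
    have "f (act_coords (rotation (e ^ j)) k) = (e ^ j) powi w * f k"
      by (simp only: first_column_rotation)
    also have "(e ^ j) powi w = (e powi w) ^ j"
      by (simp only: power_int_power power_int_power' mult.commute)
    finally show ?thesis .
  qed
  then have avg: "rotation_average n f k = (\<Sum>j<n. (e powi w) ^ j) * f k / of_nat n"
    unfolding rotation_average_def e_def[symmetric] by (simp only: sum_distrib_right)
  show "rotation_average n f k = (if w = 0 then f k else 0)"
  proof (cases "w = 0")
    case False
    have ew: "e powi w = cis (of_int w * (2 * pi / real n))"
      by (simp add: e_def cis_power_int)
    have "e powi w \<noteq> 1"
    proof
      assume "e powi w = 1"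
      then have "cos (of_int w * (2 * pi / real n)) = 1"
        unfolding ew by (metis cis.sel(1) one_complex.sel(1))
      then obtain m :: int where "of_int w * (2 * pi / real n) = of_int m * 2 * pi"
        unfolding cos_one_2pi_int by blast
      then have "of_int w * (2 * pi) = of_int m * 2 * pi * real n"
        using n0 by (simp only: times_divide_eq_right divide_eq_eq of_nat_0_eq_iff split: if_splits)
      then have "real_of_int w = real_of_int (m * int n)" by simp
      then have "w = m * int n" by (simp only: of_int_eq_iff)
      with False n show False
        by (auto simp: abs_mult mult_less_cancel_right2)
    qed
    moreover have "(e powi w) ^ n = 1"
    proof -
      have "(e powi w) ^ n = cis (2 * pi * of_int w)"
        unfolding ew Complex.DeMoivre using n0 by (simp add: mult_ac)
      then show ?thesis by (simp add: cis_multiple_2pi)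
    qed
    ultimately have "(\<Sum>j<n. (e powi w) ^ j) = 0"
      by (simp add: geometric_sum)
    then show ?thesis using False avg by simp
  qed (use avg n0 in simp)
qed

text \<open>By induction on the number of terms, averages over all sufficiently large \<open>n\<close> retain the
  terms of weight zero only, while an invariant polynomial equals its averages.\<close>

lemma invariant_polynomial_in_combinations:
  assumes f: "real_polynomial_function f" and inv: "\<And>g k. g \<in> SO2 \<Longrightarrow> f (act_coords g k) = f k"
  shows "(\<lambda>k. of_real (f k)) \<in> combinations {h. weighted 0 h}"
proof -
  have "\<exists>N. \<forall>n\<ge>N. rotation_average n h \<in> combinations {h. weighted 0 h}"
    if "h \<in> combinations {h. \<exists>w. weighted w h}" for h
    using that
  proof induction
    case zero
    then show ?case by (simp add: rotation_average_def[abs_def] combinations.zero)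
  next
    case (add_term f g c)
    then obtain w N where w: "weighted w f"
      and N: "\<And>n. n \<ge> N \<Longrightarrow> rotation_average n g \<in> combinations {h. weighted 0 h}" by auto
    have "rotation_average n (\<lambda>k. c * f k + g k) \<in> combinations {h. weighted 0 h}"
      if "n \<ge> max N (Suc (nat \<bar>w\<bar>))" for n
    proof -
      have "rotation_average n (\<lambda>k. c * f k + g k) =
          (\<lambda>k. c * rotation_average n f k + rotation_average n g k)"
        by (simp add: rotation_average_def sum.distrib sum_distrib_left fun_eq_iff add_divide_distrib)
      moreover have "rotation_average n f = (\<lambda>k. if w = 0 then f k else 0)"
        by (rule rotation_average_weighted[OF w]) (use that in linarith)
      ultimately show ?thesis
        using w N[of n] that by (cases "w = 0") (auto intro: combinations.add_term)
    qed
    then show ?case by blast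
  qed
  from this[OF polynomial_in_combinations[OF f]] obtain N where
    N: "\<And>n. n \<ge> N \<Longrightarrow> rotation_average n (\<lambda>k. of_real (f k)) \<in> combinations {h. weighted 0 h}"
    by auto
  have "rotation_average (Suc N) (\<lambda>k. of_real (f k)) = (\<lambda>k. of_real (f k))"
    by (simp add: rotation_average_def inv rotation_SO2 norm_power fun_eq_iff del: of_nat_Suc)
  then show ?thesis using N[of "Suc N"] by simp
qed

text \<open>Since \<open>z\<close> is the only coordinate of odd weight, in weight zero it occurs an even number of
  times, and \<open>z\<^sup>2\<close> can be treated as a third letter of order two. Below, weights are halved.\<close>

definition letters1 :: "(coords \<Rightarrow> complex) set" where
  "letters1 = {ca, cb, \<lambda>k. (cz k)\<^sup>2}"

definition letters2 :: "(coords \<Rightarrow> complex) set" where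
  "letters2 = {cA, cB}"

lemma weighted_normal_form:
  assumes "weighted w f"
  shows "\<exists>r i j us vs Us Vs. r \<in> alg {cl1, cl2, cm1, cm2} \<and> set us \<subseteq> {ca, cb} \<and> set vs \<subseteq> {ca, cb} \<and>
    set Us \<subseteq> {cA, cB} \<and> set Vs \<subseteq> {cA, cB} \<and>
    w = int i - int j + 2 * (int (length us) - int (length vs)) + 4 * (int (length Us) - int (length Vs)) \<and>
    f = (\<lambda>k. of_real (r k) * cz k ^ i * cnj (cz k) ^ j *
      ((\<Prod>u\<leftarrow>us. u k) * cnj (\<Prod>v\<leftarrow>vs. v k) * (\<Prod>U\<leftarrow>Us. U k) * cnj (\<Prod>V\<leftarrow>Vs. V k)))"
    (is "\<exists>r i j us vs Us Vs. ?P w f r i j us vs Us Vs")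
  using assms
proof induction
  case one
  have "?P 0 (\<lambda>k. 1) (\<lambda>k. 1) 0 0 [] [] [] []" by (simp add: alg_const)
  then show ?case by blast
next
  case (scalar r)
  then have "?P 0 (\<lambda>k. of_real (r k)) r 0 0 [] [] [] []" by (simp add: alg_base)
  then show ?case by blast
next
  case cz
  have "?P 1 cz (\<lambda>k. 1) 1 0 [] [] [] []" by (simp add: alg_const)
  then show ?case by blast
next
  case (order2 u)
  then have "?P 2 u (\<lambda>k. 1) 0 0 [u] [] [] []" by (simp add: alg_const)
  then show ?case by blast
next
  case (order4 U)
  then have "?P 4 U (\<lambda>k. 1) 0 0 [] [] [U] []" by (simp add: alg_const)
  then show ?case by blast
next
  case (cnj w f)
  then obtain r i j us vs Us Vs where "?P w f r i j us vs Us Vs" by blast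
  then have "?P (- w) (\<lambda>k. cnj (f k)) r j i vs us Vs Us" by (simp add: mult_ac)
  then show ?case by blast
next
  case (mult w f w' g)
  from mult.IH obtain r i j us vs Us Vs where 1: "?P w f r i j us vs Us Vs" by blast
  from mult.IH obtain r' i' j' us' vs' Us' Vs' where 2: "?P w' g r' i' j' us' vs' Us' Vs'" by blast
  have "?P (w + w') (\<lambda>k. f k * g k) (\<lambda>k. r k * r' k) (i + i') (j + j') (us @ us') (vs @ vs')
      (Us @ Us') (Vs @ Vs')"
    using 1 2 by (simp add: alg_mult power_add mult_ac)
  then show ?case by blast
qed

lemma weight_zero_normal_form:
  assumes "weighted 0 f"
  shows "\<exists>r us vs Us Vs. r \<in> alg ({cl1, cl2, cm1, cm2} \<union> {\<lambda>k. Re (cz k * cnj (cz k))}) \<and>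
    set us \<subseteq> letters1 \<and> set vs \<subseteq> letters1 \<and> set Us \<subseteq> letters2 \<and> set Vs \<subseteq> letters2 \<and>
    length us + 2 * length Us = length vs + 2 * length Vs \<and>
    f = (\<lambda>k. of_real (r k) *
      ((\<Prod>u\<leftarrow>us. u k) * cnj (\<Prod>v\<leftarrow>vs. v k) * (\<Prod>U\<leftarrow>Us. U k) * cnj (\<Prod>V\<leftarrow>Vs. V k)))"
proof -
  obtain r i j us vs Us Vs where r: "r \<in> alg {cl1, cl2, cm1, cm2}"
    and sub: "set us \<subseteq> {ca, cb}" "set vs \<subseteq> {ca, cb}" "set Us \<subseteq> {cA, cB}" "set Vs \<subseteq> {cA, cB}"
    and w: "0 = int i - int j + 2 * (int (length us) - int (length vs)) +
      4 * (int (length Us) - int (length Vs))"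
    and f: "f = (\<lambda>k. of_real (r k) * cz k ^ i * cnj (cz k) ^ j *
      ((\<Prod>u\<leftarrow>us. u k) * cnj (\<Prod>v\<leftarrow>vs. v k) * (\<Prod>U\<leftarrow>Us. U k) * cnj (\<Prod>V\<leftarrow>Vs. V k)))"
    using weighted_normal_form[OF assms] by blast
  define e p q where "e = i mod 2" and "p = i div 2" and "q = j div 2"
  have "i mod 2 = j mod 2" using w by presburger
  then have ij: "i = e + 2 * p" "j = e + 2 * q" unfolding e_def p_def q_def by presburger+
  let ?sq = "\<lambda>k. (cz k)\<^sup>2" and ?n = "\<lambda>k. Re (cz k * cnj (cz k))"
  have pow: "cz k ^ i * cnj (cz k) ^ j =
      of_real (?n k ^ e) * ((\<Prod>u\<leftarrow>replicate p ?sq. u k) * cnj (\<Prod>v\<leftarrow>replicate q ?sq. v k))" for k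
  proof -
    have n: "of_real (?n k) = cz k * cnj (cz k)" by (simp add: complex_eq_iff)
    show ?thesis
      unfolding of_real_power n
      by (simp add: ij power_add power_mult_distrib mult_ac map_replicate_const
          prod_list_replicate flip: power_mult)
  qed
  have "(\<lambda>k. r k * ?n k ^ e) \<in> alg ({cl1, cl2, cm1, cm2} \<union> {?n})"
    by (intro alg_mult alg_power alg_base generated_algebra_mono[OF r]) auto
  moreover have "f = (\<lambda>k. of_real (r k * ?n k ^ e) *
      ((\<Prod>u\<leftarrow>replicate p ?sq @ us. u k) * cnj (\<Prod>v\<leftarrow>replicate q ?sq @ vs. v k) *
       (\<Prod>U\<leftarrow>Us. U k) * cnj (\<Prod>V\<leftarrow>Vs. V k)))"
  proof
    fix k
    have "f k = of_real (r k) * (cz k ^ i * cnj (cz k) ^ j) *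
        ((\<Prod>u\<leftarrow>us. u k) * cnj (\<Prod>v\<leftarrow>vs. v k) * (\<Prod>U\<leftarrow>Us. U k) * cnj (\<Prod>V\<leftarrow>Vs. V k))"
      by (simp add: f mult_ac)
    also have "\<dots> = of_real (r k * ?n k ^ e) *
      ((\<Prod>u\<leftarrow>replicate p ?sq @ us. u k) * cnj (\<Prod>v\<leftarrow>replicate q ?sq @ vs. v k) *
       (\<Prod>U\<leftarrow>Us. U k) * cnj (\<Prod>V\<leftarrow>Vs. V k))"
      unfolding pow map_append prod_list.append of_real_mult complex_cnj_mult by (simp only: mult_ac)
    finally show "f k = of_real (r k * ?n k ^ e) *
      ((\<Prod>u\<leftarrow>replicate p ?sq @ us. u k) * cnj (\<Prod>v\<leftarrow>replicate q ?sq @ vs. v k) *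
       (\<Prod>U\<leftarrow>Us. U k) * cnj (\<Prod>V\<leftarrow>Vs. V k))" .
  qed
  moreover have "set (replicate p ?sq @ us) \<subseteq> letters1" "set (replicate q ?sq @ vs) \<subseteq> letters1"
    "set Us \<subseteq> letters2" "set Vs \<subseteq> letters2"
    using sub by (auto simp: letters1_def letters2_def)
  moreover have "length (replicate p ?sq @ us) + 2 * length Us = length (replicate q ?sq @ vs) + 2 * length Vs"
    using w ij by simp
  ultimately show ?thesis by blast
qed

lemma Re_complex_of_real_mult: "Re (of_real r * w) = r * Re w"
  and Im_complex_of_real_mult: "Im (of_real r * w) = r * Im w"
  by simp_all

lemma rotation_invariants_generated:
  assumes poly: "real_polynomial_function f" and inv: "\<And>g k. g \<in> SO2 \<Longrightarrow> f (act_coords g k) = f k"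
    and scalars: "{cl1, cl2, cm1, cm2} \<union> {\<lambda>k. Re (cz k * cnj (cz k))} \<subseteq> alg F"
    and words: "\<And>g. g \<in> short_words letters1 letters2 \<Longrightarrow>
      (\<lambda>k. Re (g k)) \<in> alg F \<and> (\<lambda>k. Im (g k)) \<in> alg F"
  shows "f \<in> alg F"
proof -
  have r: "r \<in> alg F" if "r \<in> alg ({cl1, cl2, cm1, cm2} \<union> {\<lambda>k. Re (cz k * cnj (cz k))})" for r
    using that by (induction rule: alg_induct) (use scalars in \<open>auto intro: alg_const alg_add alg_mult\<close>)
  have zero: "(\<lambda>k. Re (h k)) \<in> alg F \<and> (\<lambda>k. Im (h k)) \<in> alg F" if "weighted 0 h" for h
  proof -
    obtain r us vs Us Vs where *: "r \<in> alg ({cl1, cl2, cm1, cm2} \<union> {\<lambda>k. Re (cz k * cnj (cz k))})"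
      "set us \<subseteq> letters1" "set vs \<subseteq> letters1" "set Us \<subseteq> letters2" "set Vs \<subseteq> letters2"
      "length us + 2 * length Us = length vs + 2 * length Vs" and
      h: "h = (\<lambda>k. of_real (r k) *
        ((\<Prod>u\<leftarrow>us. u k) * cnj (\<Prod>v\<leftarrow>vs. v k) * (\<Prod>U\<leftarrow>Us. U k) * cnj (\<Prod>V\<leftarrow>Vs. V k)))"
      using weight_zero_normal_form[OF \<open>weighted 0 h\<close>] by blast
    let ?p = "\<lambda>k. (\<Prod>u\<leftarrow>us. u k) * cnj (\<Prod>v\<leftarrow>vs. v k) * (\<Prod>U\<leftarrow>Us. U k) * cnj (\<Prod>V\<leftarrow>Vs. V k)"
    have "(\<lambda>k. Re (?p k)) \<in> alg F" "(\<lambda>k. Im (?p k)) \<in> alg F"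
      using Re_Im_word_of_weight_zero[OF words *(2-6)] by auto
    from alg_mult[OF r[OF *(1)] this(1)] alg_mult[OF r[OF *(1)] this(2)]
    show ?thesis unfolding h Re_complex_of_real_mult Im_complex_of_real_mult by blast
  qed
  have "(\<lambda>k. Re (h k)) \<in> alg F \<and> (\<lambda>k. Im (h k)) \<in> alg F" if "h \<in> combinations {h. weighted 0 h}" for h
    using that
  proof induction
    case (add_term f g c)
    then have "(\<lambda>k. Re (f k)) \<in> alg F" "(\<lambda>k. Im (f k)) \<in> alg F" using zero[of f] by auto
    with add_term.IH have
      "(\<lambda>k. (Re c * Re (f k) - Im c * Im (f k)) + Re (g k)) \<in> alg F"
      "(\<lambda>k. (Re c * Im (f k) + Im c * Re (f k)) + Im (g k)) \<in> alg F"
      by (auto intro!: alg_add alg_diff alg_mult[OF alg_const])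
    then show ?case by simp
  qed (simp add: alg_const)
  from this[OF invariant_polynomial_in_combinations[OF poly inv]] show ?thesis by simp
qed

text \<open>An \<open>O(2)\<close>-invariant polynomial is the average of itself and of its reflection. As the
  reflection conjugates the monomials, this leaves only their real parts.\<close>

lemma orthogonal_invariants_generated:
  assumes poly: "real_polynomial_function f" and inv: "\<And>g k. g \<in> O2 \<Longrightarrow> f (act_coords g k) = f k"
    and scalars: "{cl1, cl2, cm1, cm2} \<union> {\<lambda>k. Re (cz k * cnj (cz k))} \<subseteq> alg F"
    and words: "\<And>g. g \<in> short_words letters1 letters2 \<Longrightarrow> (\<lambda>k. Re (g k)) \<in> alg F"
    and pairs: "\<And>g h. g \<in> short_words letters1 letters2 \<Longrightarrow> h \<in> short_words letters1 letters2 \<Longrightarrow>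
      (\<lambda>k. Im (g k) * Im (h k)) \<in> alg F"
  shows "f \<in> alg F"
proof -
  have r: "r \<in> alg F" if "r \<in> alg ({cl1, cl2, cm1, cm2} \<union> {\<lambda>k. Re (cz k * cnj (cz k))})" for r
    using that by (induction rule: alg_induct) (use scalars in \<open>auto intro: alg_const alg_add alg_mult\<close>)
  have zero: "(\<lambda>k. Re (h k)) \<in> alg F" if "weighted 0 h" for h
  proof -
    obtain r us vs Us Vs where *: "r \<in> alg ({cl1, cl2, cm1, cm2} \<union> {\<lambda>k. Re (cz k * cnj (cz k))})"
      "set us \<subseteq> letters1" "set vs \<subseteq> letters1" "set Us \<subseteq> letters2" "set Vs \<subseteq> letters2"
      "length us + 2 * length Us = length vs + 2 * length Vs" and
      h: "h = (\<lambda>k. of_real (r k) *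
        ((\<Prod>u\<leftarrow>us. u k) * cnj (\<Prod>v\<leftarrow>vs. v k) * (\<Prod>U\<leftarrow>Us. U k) * cnj (\<Prod>V\<leftarrow>Vs. V k)))"
      using weight_zero_normal_form[OF \<open>weighted 0 h\<close>] by blast
    show ?thesis
      using alg_mult[OF r[OF *(1)] Re_word_of_weight_zero[OF words pairs *(2-6)]]
      unfolding h Re_complex_of_real_mult .
  qed
  have "(\<lambda>k. Re (h k) + Re (h (act_coords reflection k))) \<in> alg F"
    if "h \<in> combinations {h. weighted 0 h}" for h
    using that
  proof induction
    case (add_term f g c)
    then have f: "weighted 0 f" by simp
    have "(\<lambda>k. (2 * Re c) * Re (f k) + (Re (g k) + Re (g (act_coords reflection k)))) \<in> alg F"
      by (rule alg_add[OF alg_mult[OF alg_const zero[OF f]] add_term.IH])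
    then show ?case by (simp add: weighted_reflection[OF f] algebra_simps)
  qed (simp add: alg_const)
  moreover have "(\<lambda>k. of_real (f k)) \<in> combinations {h. weighted 0 h}"
    using inv by (intro invariant_polynomial_in_combinations[OF poly]) (auto simp: SO2_def)
  ultimately have "(\<lambda>k. Re (of_real (f k)) + Re (of_real (f (act_coords reflection k)))) \<in> alg F"
    by fast
  from alg_mult[OF alg_const[of "1/2"] this] show ?thesis
    by (simp add: inv reflection_O2)
qed

section \<open>The generators\<close>

definition complex_gens :: "(coords \<Rightarrow> complex) list" where
  "complex_gens =
    [\<lambda>k. ca k * cnj (cb k), \<lambda>k. cA k * cnj (cB k),
     \<lambda>k. (ca k)\<^sup>2 * cnj (cA k), \<lambda>k. (cb k)\<^sup>2 * cnj (cA k),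
     \<lambda>k. (ca k)\<^sup>2 * cnj (cB k), \<lambda>k. (cb k)\<^sup>2 * cnj (cB k),
     \<lambda>k. ca k * cb k * cnj (cA k), \<lambda>k. ca k * cb k * cnj (cB k),
     \<lambda>k. cnj (ca k) * (cz k)\<^sup>2, \<lambda>k. cnj (cb k) * (cz k)\<^sup>2,
     \<lambda>k. ca k * cnj (cA k) * (cz k)\<^sup>2, \<lambda>k. ca k * cnj (cB k) * (cz k)\<^sup>2,
     \<lambda>k. cb k * cnj (cA k) * (cz k)\<^sup>2, \<lambda>k. cb k * cnj (cB k) * (cz k)\<^sup>2,
     \<lambda>k. cnj (cA k) * cz k ^ 4, \<lambda>k. cnj (cB k) * cz k ^ 4]"

definition real_gens :: "(coords \<Rightarrow> real) list" where
  "real_gens =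
    [cl1, cm1, cl2, cm2,
     \<lambda>k. Re (ca k * cnj (ca k)), \<lambda>k. Re (cb k * cnj (cb k)),
     \<lambda>k. Re (cA k * cnj (cA k)), \<lambda>k. Re (cB k * cnj (cB k)), \<lambda>k. Re (cz k * cnj (cz k))]"

definition product_gens :: "(coords \<Rightarrow> real) list" where
  "product_gens =
    [\<lambda>k. Im (ca k * cnj (cb k)) * Im (cA k * cnj (cB k)),
     \<lambda>k. Im (cA k * cnj (cB k)) * Im (cnj (ca k) * (cz k)\<^sup>2),
     \<lambda>k. Im (cA k * cnj (cB k)) * Im (cnj (cb k) * (cz k)\<^sup>2)]"

definition SO2_gens :: "(coords \<Rightarrow> real) list" where
  "SO2_gens = real_gens @ re_parts complex_gens @ im_parts complex_gens"

definition O2_gens :: "(coords \<Rightarrow> real) list" where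
  "O2_gens = real_gens @ re_parts complex_gens @ product_gens"

lemma gens_alg:
  "set real_gens \<subseteq> alg (set SO2_gens)" "set real_gens \<subseteq> alg (set O2_gens)"
  "m \<in> set complex_gens \<Longrightarrow> (\<lambda>k. Re (m k)) \<in> alg (set SO2_gens)"
  "m \<in> set complex_gens \<Longrightarrow> (\<lambda>k. Re (m k)) \<in> alg (set O2_gens)"
  "m \<in> set complex_gens \<Longrightarrow> (\<lambda>k. Im (m k)) \<in> alg (set SO2_gens)"
  "set product_gens \<subseteq> alg (set O2_gens)"
  by (auto simp: SO2_gens_def O2_gens_def re_parts_def im_parts_def intro: alg_base)

text \<open>Up to conjugation and up to \<open>|z\<^sup>2|\<^sup>2 = (|z|\<^sup>2)\<^sup>2\<close>, every short word occurs in the lists.\<close>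

lemma short_word_cases:
  assumes "g \<in> short_words letters1 letters2"
  shows "g \<in> set complex_gens \<or> (\<lambda>k. cnj (g k)) \<in> set complex_gens \<or>
    (\<exists>r\<in>set real_gens. \<exists>n. g = (\<lambda>k. of_real (r k ^ n)))"
proof -
  have modulus: "\<exists>r\<in>set real_gens. \<exists>n. (\<lambda>k. u k * cnj (u k)) = (\<lambda>k. of_real (r k ^ n))"
    if "u \<in> letters1 \<union> letters2" for u
  proof (cases "u = (\<lambda>k. (cz k)\<^sup>2)")
    case True
    have "(\<lambda>k. u k * cnj (u k)) = (\<lambda>k. of_real (Re (cz k * cnj (cz k)) ^ 2))"
      by (auto simp: True complex_eq_iff power2_eq_square algebra_simps)
    then show ?thesis by (intro bexI[of _ "\<lambda>k. Re (cz k * cnj (cz k))"]) (auto simp: real_gens_def)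
  next
    case False
    have "(\<lambda>k. u k * cnj (u k)) = (\<lambda>k. of_real (Re (u k * cnj (u k)) ^ 1))"
      by (auto simp: complex_eq_iff)
    moreover have "(\<lambda>k. Re (u k * cnj (u k))) \<in> set real_gens"
      using that False by (auto simp: real_gens_def letters1_def letters2_def)
    ultimately show ?thesis
      by (intro bexI[of _ "\<lambda>k. Re (u k * cnj (u k))"] exI[of _ "1::nat"])
  qed
  show ?thesis
    using assms
  proof cases
    case (L1_L1 u v)
    show ?thesis
    proof (cases "u = v")
      case True
      then show ?thesis using modulus[of u] L1_L1 by simp
    next
      case False
      with L1_L1 have "g \<in> set complex_gens \<or> (\<lambda>k. cnj (g k)) \<in> set complex_gens"
        unfolding letters1_def complex_gens_def
        by (elim insertE emptyE; hypsubst;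
            simp only: list.set insert_iff mult_ac complex_cnj_mult complex_cnj_cnj complex_cnj_power simp_thms)
      then show ?thesis by blast
    qed
  next
    case (L2_L2 U V)
    show ?thesis
    proof (cases "U = V")
      case True
      then show ?thesis using modulus[of U] L2_L2 by simp
    next
      case False
      with L2_L2 have "g \<in> set complex_gens \<or> (\<lambda>k. cnj (g k)) \<in> set complex_gens"
        unfolding letters2_def complex_gens_def
        by (elim insertE emptyE; hypsubst;
            simp only: list.set insert_iff mult_ac complex_cnj_mult complex_cnj_cnj simp_thms)
      then show ?thesis by blast
    qed
  next
    case (L1_L1_L2 u v U)
    then have "g \<in> set complex_gens"
      unfolding letters1_def letters2_def complex_gens_def
      by (elim insertE emptyE; hypsubst;
          simp only: list.set insert_iff mult_ac power2_eq_square power4_eq_xxxx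
            complex_cnj_mult complex_cnj_cnj simp_thms)
    then show ?thesis by blast
  next
    case (L2_L1_L1 u v U)
    then have "(\<lambda>k. cnj (g k)) \<in> set complex_gens"
      unfolding letters1_def letters2_def complex_gens_def
      by (elim insertE emptyE; hypsubst;
          simp only: list.set insert_iff mult_ac power2_eq_square power4_eq_xxxx
            complex_cnj_mult complex_cnj_cnj simp_thms)
    then show ?thesis by blast
  qed
qed

lemma short_word_parts:
  assumes "g \<in> short_words letters1 letters2" "set real_gens \<subseteq> alg F"
    and re: "\<And>m. m \<in> set complex_gens \<Longrightarrow> (\<lambda>k. Re (m k)) \<in> alg F"
  shows "(\<lambda>k. Re (g k)) \<in> alg F"
    and "(\<And>m. m \<in> set complex_gens \<Longrightarrow> (\<lambda>k. Im (m k)) \<in> alg F) \<Longrightarrow> (\<lambda>k. Im (g k)) \<in> alg F"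
proof -
  from short_word_cases[OF assms(1)] consider (listed) "g \<in> set complex_gens"
    | (conjugate) "(\<lambda>k. cnj (g k)) \<in> set complex_gens"
    | (real) r n where "r \<in> set real_gens" "g = (\<lambda>k. of_real (r k ^ n))"
    by blast
  note cases = this
  show "(\<lambda>k. Re (g k)) \<in> alg F"
  proof (cases rule: cases)
    case listed
    then show ?thesis by (rule re)
  next
    case conjugate
    from re[OF this] show ?thesis by simp
  next
    case (real r n)
    then have "(\<lambda>k. r k ^ n) \<in> alg F" using assms(2) by (intro alg_power) blast
    then show ?thesis by (simp only: real(2) Re_complex_of_real)
  qed
  assume im: "\<And>m. m \<in> set complex_gens \<Longrightarrow> (\<lambda>k. Im (m k)) \<in> alg F"
  show "(\<lambda>k. Im (g k)) \<in> alg F"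
  proof (cases rule: cases)
    case listed
    then show ?thesis by (rule im)
  next
    case conjugate
    from alg_minus[OF im[OF this]] show ?thesis by simp
  next
    case (real r n)
    then show ?thesis by (simp only: real(2) Im_complex_of_real alg_const)
  qed
qed

lemma SO2_gens_generate:
  assumes "real_polynomial_function f" "\<And>g k. g \<in> SO2 \<Longrightarrow> f (act_coords g k) = f k"
  shows "f \<in> alg (set SO2_gens)"
proof (rule rotation_invariants_generated[OF assms])
  show "{cl1, cl2, cm1, cm2} \<union> {\<lambda>k. Re (cz k * cnj (cz k))} \<subseteq> alg (set SO2_gens)"
    by (auto simp: SO2_gens_def real_gens_def intro: alg_base)
  show "(\<lambda>k. Re (g k)) \<in> alg (set SO2_gens) \<and> (\<lambda>k. Im (g k)) \<in> alg (set SO2_gens)"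
    if "g \<in> short_words letters1 letters2" for g
    using short_word_parts[OF that gens_alg(1,3)] gens_alg(5) by blast
qed

text \<open>The mixed products \<open>Im (u \<cdot> cnj v) \<cdot> Im (U \<cdot> cnj V)\<close> are the only ones that the
  determinant identity does not reduce; up to sign they are zero or one of the three in the list.\<close>

lemma O2_gens_generate:
  assumes "real_polynomial_function f" "\<And>g k. g \<in> O2 \<Longrightarrow> f (act_coords g k) = f k"
  shows "f \<in> alg (set O2_gens)"
proof -
  let ?F = "set O2_gens"
  have re: "(\<lambda>k. Re (g k)) \<in> alg ?F" if "g \<in> short_words letters1 letters2" for g
    using short_word_parts(1)[OF that gens_alg(2,4)] .
  have mixed: "(\<lambda>k. Im (u k * cnj (v k)) * Im (U k * cnj (V k))) \<in> alg ?F"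
    if uv: "u \<in> letters1" "v \<in> letters1" and UV: "U \<in> letters2" "V \<in> letters2" for u v U V
  proof -
    let ?I = "\<lambda>p q r s k. Im (p k * cnj (q k)) * Im (r k * cnj (s k))"
    have swap1: "?I q p r s \<in> alg ?F" if "?I p q r s \<in> alg ?F" for p q r s :: "coords \<Rightarrow> complex"
      using alg_minus[OF that] by (simp add: algebra_simps)
    have swap2: "?I p q s r \<in> alg ?F" if "?I p q r s \<in> alg ?F" for p q r s :: "coords \<Rightarrow> complex"
      using alg_minus[OF that] by (simp add: algebra_simps)
    have zero: "?I p p r s \<in> alg ?F" "?I p q r r \<in> alg ?F" for p q r s :: "coords \<Rightarrow> complex"
      by (simp_all add: alg_const)
    have "?I ca cb cA cB \<in> set product_gens" "?I (\<lambda>k. (cz k)\<^sup>2) ca cA cB \<in> set product_gens"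
      "?I (\<lambda>k. (cz k)\<^sup>2) cb cA cB \<in> set product_gens"
      unfolding product_gens_def by (simp_all only: list.set insert_iff mult_ac simp_thms)
    then have base: "?I ca cb cA cB \<in> alg ?F" "?I (\<lambda>k. (cz k)\<^sup>2) ca cA cB \<in> alg ?F"
      "?I (\<lambda>k. (cz k)\<^sup>2) cb cA cB \<in> alg ?F"
      using gens_alg(6) by blast+
    show ?thesis
      using uv UV unfolding letters1_def letters2_def
      by (elim insertE emptyE; hypsubst)
        (rule zero base base[THEN swap1] base[THEN swap2] base[THEN swap1, THEN swap2])+
  qed
  have pairs: "(\<lambda>k. Im (g k) * Im (h k)) \<in> alg ?F"
    if "g \<in> short_words letters1 letters2" "h \<in> short_words letters1 letters2" for g h
    by (rule Im_mult_Im_short_words[of letters1 ?F letters2, OF re[OF short_words.L1_L1]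
        re[OF short_words.L2_L2] re[OF short_words.L1_L1_L2] mixed that])
  have "{cl1, cl2, cm1, cm2} \<union> {\<lambda>k. Re (cz k * cnj (cz k))} \<subseteq> set real_gens"
    by (simp add: real_gens_def)
  with gens_alg(2) have "{cl1, cl2, cm1, cm2} \<union> {\<lambda>k. Re (cz k * cnj (cz k))} \<subseteq> alg ?F"
    by (rule subset_trans[rotated])
  from orthogonal_invariants_generated[OF assms this re pairs] show ?thesis .
qed

section \<open>Invariance and homogeneity of the generators\<close>

lemma weighted_power: "weighted w f \<Longrightarrow> weighted (int n * w) (\<lambda>k. f k ^ n)"
proof (induction n)
  case (Suc n)
  from weighted.mult[OF Suc.prems Suc.IH[OF Suc.prems]] show ?case by (simp add: algebra_simps)
qed (simp add: weighted.one)

lemma weighted_cong: "weighted w f \<Longrightarrow> w = w' \<Longrightarrow> weighted w' f"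
  by simp

lemma weighted_complex_gens:
  assumes "m \<in> set complex_gens"
  shows "weighted 0 m"
proof -
  have "weighted 2 ca" "weighted 2 cb" "weighted 4 cA" "weighted 4 cB"
    by (simp_all add: weighted.order2 weighted.order4)
  note letters = this weighted.cz
  show ?thesis
    using assms unfolding complex_gens_def list.set
    by (elim insertE emptyE)
      (hypsubst, rule weighted_cong, (rule weighted.mult weighted.cnj weighted_power letters)+, simp)+
qed

lemma weighted_modulus: "u \<in> {ca, cb, cA, cB, cz} \<Longrightarrow> weighted 0 (\<lambda>k. u k * cnj (u k))"
  using weighted.mult[OF weighted.cz weighted.cnj[OF weighted.cz]]
    weighted.mult[OF weighted.order2 weighted.cnj[OF weighted.order2], of u u]
    weighted.mult[OF weighted.order4 weighted.cnj[OF weighted.order4], of u u]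
  by auto

lemma real_gens_weighted:
  assumes "r \<in> set real_gens"
  obtains h where "weighted 0 h" "r = (\<lambda>k. Re (h k))"
proof -
  have "r \<in> {cl1, cl2, cm1, cm2} \<or> (\<exists>u\<in>{ca, cb, cA, cB, cz}. r = (\<lambda>k. Re (u k * cnj (u k))))"
    using assms unfolding real_gens_def by auto
  then show thesis
  proof
    assume "r \<in> {cl1, cl2, cm1, cm2}"
    from weighted.scalar[OF this] show thesis by (rule that) simp
  next
    assume "\<exists>u\<in>{ca, cb, cA, cB, cz}. r = (\<lambda>k. Re (u k * cnj (u k)))"
    then obtain u where "u \<in> {ca, cb, cA, cB, cz}" and r: "r = (\<lambda>k. Re (u k * cnj (u k)))" by blast
    from weighted_modulus[OF this(1)] r show thesis by (rule that)
  qed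
qed

lemma product_gens_cases:
  assumes "f \<in> set product_gens"
  obtains m m' where "m \<in> set complex_gens" "m' \<in> set complex_gens" "f = (\<lambda>k. Im (m k) * Im (m' k))"
proof -
  have "\<exists>m\<in>set complex_gens. \<exists>m'\<in>set complex_gens. f = (\<lambda>k. Im (m k) * Im (m' k))"
    using assms unfolding product_gens_def list.set
  proof (elim insertE emptyE)
    assume "f = (\<lambda>k. Im (ca k * cnj (cb k)) * Im (cA k * cnj (cB k)))"
    then show ?thesis
      by (intro bexI[of _ "\<lambda>k. ca k * cnj (cb k)"] bexI[of _ "\<lambda>k. cA k * cnj (cB k)"])
        (simp_all only: complex_gens_def list.set insert_iff simp_thms)
  next
    assume "f = (\<lambda>k. Im (cA k * cnj (cB k)) * Im (cnj (ca k) * (cz k)\<^sup>2))"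
    then show ?thesis
      by (intro bexI[of _ "\<lambda>k. cA k * cnj (cB k)"] bexI[of _ "\<lambda>k. cnj (ca k) * (cz k)\<^sup>2"])
        (simp_all only: complex_gens_def list.set insert_iff simp_thms)
  next
    assume "f = (\<lambda>k. Im (cA k * cnj (cB k)) * Im (cnj (cb k) * (cz k)\<^sup>2))"
    then show ?thesis
      by (intro bexI[of _ "\<lambda>k. cA k * cnj (cB k)"] bexI[of _ "\<lambda>k. cnj (cb k) * (cz k)\<^sup>2"])
        (simp_all only: complex_gens_def list.set insert_iff simp_thms)
  qed
  then show thesis using that by blast
qed

lemma weighted_polynomial:
  "weighted w f \<Longrightarrow> real_polynomial_function (\<lambda>k. Re (f k)) \<and> real_polynomial_function (\<lambda>k. Im (f k))"
proof (induction rule: weighted.induct)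
  case (scalar r)
  then have "bounded_linear r"
    by (auto intro!: linear_conv_bounded_linear[THEN iffD1] linearI simp: coord_defs)
  then show ?case by auto
next
  case cz
  have "linear cz" by (intro linearI) (simp_all add: coord_defs)
  then show ?case
    by (auto intro!: real_polynomial_function.intros(1) bounded_linear_compose[OF bounded_linear_Re]
        bounded_linear_compose[OF bounded_linear_Im] simp: linear_conv_bounded_linear)
next
  case (order2 u)
  then have "linear u" by (intro linearI) (auto simp: coord_defs)
  then show ?case
    by (auto intro!: real_polynomial_function.intros(1) bounded_linear_compose[OF bounded_linear_Re]
        bounded_linear_compose[OF bounded_linear_Im] simp: linear_conv_bounded_linear)
next
  case (order4 u)
  then have "linear u" by (intro linearI) (auto simp: coord_defs)
  then show ?case
    by (auto intro!: real_polynomial_function.intros(1) bounded_linear_compose[OF bounded_linear_Re]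
        bounded_linear_compose[OF bounded_linear_Im] simp: linear_conv_bounded_linear)
qed auto

lemma weighted_homogeneous:
  "weighted w f \<Longrightarrow> \<exists>d. \<forall>t k. f (t *\<^sub>R k) = of_real (t ^ d) * f k"
proof (induction rule: weighted.induct)
  case one
  show ?case by (intro exI[of _ 0]) simp
next
  case (scalar r)
  then show ?case by (intro exI[of _ 1]) (auto simp: coord_defs)
next
  case cz
  show ?case by (intro exI[of _ 1]) (auto simp: coord_defs scaleR_conv_of_real)
next
  case (order2 u)
  then show ?case by (intro exI[of _ 1]) (auto simp: coord_defs scaleR_conv_of_real)
next
  case (order4 u)
  then show ?case by (intro exI[of _ 1]) (auto simp: coord_defs scaleR_conv_of_real)
next
  case (cnj w f)
  then obtain d where "\<And>t k. f (t *\<^sub>R k) = of_real (t ^ d) * f k" by blast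
  then show ?case by (intro exI[of _ d]) simp
next
  case (mult w f w' g)
  then obtain d d' where "\<And>t k. f (t *\<^sub>R k) = of_real (t ^ d) * f k"
    "\<And>t k. g (t *\<^sub>R k) = of_real (t ^ d') * g k" by blast
  then show ?case by (intro exI[of _ "d + d'"]) (simp add: power_add mult_ac)
qed

lemma part_cases:
  assumes "f \<in> set SO2_gens \<union> set O2_gens"
  obtains (Re) h where "weighted 0 h" "f = (\<lambda>k. Re (h k))"
  | (Im) h where "weighted 0 h" "f = (\<lambda>k. Im (h k))" "f \<in> set SO2_gens"
  | (Im_Im) h h' where "weighted 0 h" "weighted 0 h'" "f = (\<lambda>k. Im (h k) * Im (h' k))"
proof -
  consider "f \<in> set real_gens" | m where "m \<in> set complex_gens" "f = (\<lambda>k. Re (m k))"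
    | m where "m \<in> set complex_gens" "f = (\<lambda>k. Im (m k))" "f \<in> set SO2_gens" | "f \<in> set product_gens"
    using assms by (auto simp: SO2_gens_def O2_gens_def re_parts_def im_parts_def)
  then show thesis
  proof cases
    case 1
    then show thesis using Re by (elim real_gens_weighted)
  next
    case (2 m)
    then show thesis using Re weighted_complex_gens by blast
  next
    case (3 m)
    then show thesis using Im weighted_complex_gens by blast
  next
    case 4
    then show thesis using Im_Im weighted_complex_gens by (elim product_gens_cases) blast
  qed
qed

lemma gens_polynomial:
  assumes "f \<in> set SO2_gens \<union> set O2_gens"
  shows "real_polynomial_function f"
  using assms
proof (cases rule: part_cases)
  case (Re h)
  show ?thesis unfolding Re(2) using weighted_polynomial[OF Re(1)] by blast
next
  case (Im h)
  show ?thesis unfolding Im(2) using weighted_polynomial[OF Im(1)] by blast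
next
  case (Im_Im h h')
  show ?thesis
    unfolding Im_Im(3)
    using weighted_polynomial[OF Im_Im(1)] weighted_polynomial[OF Im_Im(2)]
    by (intro real_polynomial_function.intros(4)) blast+
qed

lemma gens_homogeneous:
  assumes "f \<in> set SO2_gens \<union> set O2_gens"
  shows "\<exists>d. \<forall>t k. f (t *\<^sub>R k) = t ^ d * f k"
  using assms
proof (cases rule: part_cases)
  case (Re h)
  obtain d where d: "\<And>t k. h (t *\<^sub>R k) = of_real (t ^ d) * h k"
    using weighted_homogeneous[OF Re(1)] by blast
  show ?thesis by (intro exI[of _ d] allI) (simp only: Re(2) d Re_complex_of_real_mult)
next
  case (Im h)
  obtain d where d: "\<And>t k. h (t *\<^sub>R k) = of_real (t ^ d) * h k"
    using weighted_homogeneous[OF Im(1)] by blast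
  show ?thesis by (intro exI[of _ d] allI) (simp only: Im(2) d Im_complex_of_real_mult)
next
  case (Im_Im h h')
  obtain d where d: "\<And>t k. h (t *\<^sub>R k) = of_real (t ^ d) * h k"
    using weighted_homogeneous[OF Im_Im(1)] by blast
  obtain d' where d': "\<And>t k. h' (t *\<^sub>R k) = of_real (t ^ d') * h' k"
    using weighted_homogeneous[OF Im_Im(2)] by blast
  show ?thesis
    by (intro exI[of _ "d + d'"] allI)
      (simp only: Im_Im(3) d d' Im_complex_of_real_mult, simp only: power_add mult_ac)
qed

lemma act_coords_decompose:
  assumes "g \<in> O2"
  obtains (rotation) "g \<in> SO2"
  | (reflection) "rotation (first_column g) \<in> SO2"
      "\<And>k. act_coords g k = act_coords (rotation (first_column g)) (act_coords reflection k)"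
proof (cases "det g = 1")
  case True
  then show thesis using assms rotation by (simp add: SO2_def)
next
  case False
  have SO2: "rotation (first_column g) \<in> SO2"
    using norm_first_column[OF assms] by (rule rotation_SO2)
  moreover have "weight_act n g u = weight_act n (rotation (first_column g)) (weight_act n reflection u)" for n u
    using SO2 False by (simp add: weight_act_reflection) (simp add: weight_act_def SO2_def first_column_rotation)
  ultimately show thesis by (intro reflection) (simp_all add: act_coords_def)
qed

lemma SO2_gens_invariant:
  assumes "f \<in> set SO2_gens \<union> set O2_gens" "g \<in> SO2"
  shows "f (act_coords g k) = f k"
proof -
  have "h (act_coords g k) = h k" if "weighted 0 h" for h
    by (simp add: weighted_rotation[OF that assms(2)])
  note inv = this
  from assms(1) show ?thesis
  proof (cases rule: part_cases)
    case (Re h)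
    show ?thesis by (simp only: Re(2) inv[OF Re(1)])
  next
    case (Im h)
    show ?thesis by (simp only: Im(2) inv[OF Im(1)])
  next
    case (Im_Im h h')
    show ?thesis by (simp only: Im_Im(3) inv[OF Im_Im(1)] inv[OF Im_Im(2)])
  qed
qed

lemma O2_gens_invariant:
  assumes "f \<in> set O2_gens" "g \<in> O2"
  shows "f (act_coords g k) = f k"
proof -
  have conj: "m (act_coords reflection k) = cnj (m k)" if "weighted 0 m" for m k
    by (rule weighted_reflection[OF that])
  have refl: "f (act_coords reflection k) = f k" for k
  proof -
    consider "f \<in> set real_gens" | m where "m \<in> set complex_gens" "f = (\<lambda>k. Re (m k))"
      | "f \<in> set product_gens"
      using assms(1) by (auto simp: O2_gens_def re_parts_def)
    then show ?thesis
    proof cases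
      case 1
      then obtain h where h: "weighted 0 h" "f = (\<lambda>k. Re (h k))" by (rule real_gens_weighted)
      show ?thesis by (simp only: h(2) conj[OF h(1)] cnj.simps)
    next
      case (2 m)
      show ?thesis by (simp only: 2(2) conj[OF weighted_complex_gens[OF 2(1)]] cnj.simps)
    next
      case 3
      then obtain m m' where m: "m \<in> set complex_gens" "m' \<in> set complex_gens"
        "f = (\<lambda>k. Im (m k) * Im (m' k))" by (rule product_gens_cases)
      show ?thesis
        by (simp only: m(3) conj[OF weighted_complex_gens[OF m(1)]] conj[OF weighted_complex_gens[OF m(2)]]
            cnj.simps minus_mult_minus)
    qed
  qed
  from assms(2) show ?thesis
  proof (cases rule: act_coords_decompose)
    case rotation
    then show ?thesis using SO2_gens_invariant[of f g k] assms(1) by simp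
  next
    case reflection
    have "f (act_coords g k) = f (act_coords (rotation (first_column g)) (act_coords reflection k))"
      by (simp only: reflection(2))
    also have "\<dots> = f (act_coords reflection k)"
      using SO2_gens_invariant[OF _ reflection(1)] assms(1) by simp
    finally show ?thesis by (simp add: refl)
  qed
qed

section \<open>No generator is redundant\<close>

text \<open>With the vector \<open>x\<close> of degree one and the harmonic tensors of degree two, \<open>z\<^sup>2\<close> scales like
  the other letters of order two. The scalars are fixed; they vanish at all points that separate
  the other generators.\<close>

definition dilate :: "real \<Rightarrow> coords \<Rightarrow> coords" where
  "dilate e k = (cl1 k, cl2 k, cm1 k, cm2 k, e\<^sup>2 *\<^sub>R ca k, e\<^sup>2 *\<^sub>R cb k, e\<^sup>2 *\<^sub>R cA k, e\<^sup>2 *\<^sub>R cB k, e *\<^sub>R cz k)"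

definition has_degree :: "nat \<Rightarrow> (coords \<Rightarrow> real) \<Rightarrow> bool" where
  "has_degree d f \<longleftrightarrow> (\<forall>e k. f (dilate e k) = e ^ d * f k)"

text \<open>Modulo higher order, the mixed difference \<open>\<Delta>\<close> over the four points is a derivation. If the
  values of \<open>f\<close> and \<open>g\<close> at the four points, moved towards the origin by the dilation, agree up to
  order \<open>n\<close>, then \<open>\<Delta> (f g)\<close> is \<open>f \<Delta> g + g \<Delta> f\<close> up to order \<open>2 n\<close>. Hence \<open>\<Delta>\<close> is of order \<open>2 n\<close> on
  the algebra generated by functions that it annihilates, whereas it has the smaller order \<open>d\<close>
  at \<open>b\<close>.\<close>

lemma not_generated_by_four_points:
  fixes b :: "coords \<Rightarrow> real"
  assumes gens: "\<And>g. g \<in> F \<Longrightarrow> \<exists>d. has_degree d g \<and> g p1 - g p2 - g p3 + g p4 = 0 \<and>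
      (n \<le> d \<or> g p2 = g p1 \<and> g p3 = g p1 \<and> g p4 = g p1)"
    and b: "has_degree d b" "d < 2 * n" "b p1 - b p2 - b p3 + b p4 \<noteq> 0"
  shows "b \<notin> alg F"
proof
  define \<Delta> where "\<Delta> f e = f (dilate e p1) - f (dilate e p2) - f (dilate e p3) + f (dilate e p4)"
    for f :: "coords \<Rightarrow> real" and e
  define good where "good f K \<longleftrightarrow> (\<forall>e. 0 < e \<and> e \<le> 1 \<longrightarrow> \<bar>f (dilate e p1)\<bar> \<le> K \<and>
     (\<forall>p\<in>{p2, p3, p4}. \<bar>f (dilate e p) - f (dilate e p1)\<bar> \<le> K * e ^ n) \<and> \<bar>\<Delta> f e\<bar> \<le> K * e ^ (2 * n))"
    for f K
  assume "b \<in> alg F"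
  then have "\<exists>K. good b K"
  proof (induction rule: alg_induct)
    case (const c)
    have "good (\<lambda>k. c) \<bar>c\<bar>" by (simp add: good_def \<Delta>_def)
    then show ?case by blast
  next
    case (base g)
    from gens[OF this] obtain d where d: "has_degree d g" and 0: "g p1 - g p2 - g p3 + g p4 = 0"
      and near: "n \<le> d \<or> g p2 = g p1 \<and> g p3 = g p1 \<and> g p4 = g p1" by blast
    have g: "g (dilate e p) = e ^ d * g p" for e p using d unfolding has_degree_def by blast
    define K where "K = \<bar>g p1\<bar> + \<bar>g p2 - g p1\<bar> + \<bar>g p3 - g p1\<bar> + \<bar>g p4 - g p1\<bar>"
    have "\<bar>g (dilate e p1)\<bar> \<le> K" if "0 < e" "e \<le> 1" for e
    proof -
      have "e ^ d * \<bar>g p1\<bar> \<le> 1 * \<bar>g p1\<bar>" using that by (intro mult_right_mono power_le_one) auto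
      then show ?thesis using that by (simp add: g K_def abs_mult)
    qed
    moreover have "\<bar>g (dilate e p) - g (dilate e p1)\<bar> \<le> K * e ^ n"
      if "0 < e" "e \<le> 1" "p \<in> {p2, p3, p4}" for e p
    proof -
      have K: "\<bar>g p - g p1\<bar> \<le> K" "0 \<le> K" using that(3) by (auto simp: K_def)
      have "\<bar>g (dilate e p) - g (dilate e p1)\<bar> = e ^ d * \<bar>g p - g p1\<bar>"
        using that by (simp add: g abs_mult flip: right_diff_distrib)
      also have "\<dots> \<le> e ^ n * K"
      proof (cases "n \<le> d")
        case True
        then show ?thesis using that K by (intro mult_mono power_decreasing) auto
      next
        case False
        then show ?thesis using near that K by auto
      qed
      finally show ?thesis by (simp add: mult.commute)
    qed
    moreover have "\<Delta> g e = 0" for e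
    proof -
      have "\<Delta> g e = e ^ d * (g p1 - g p2 - g p3 + g p4)" by (simp add: \<Delta>_def g algebra_simps)
      then show ?thesis by (simp add: 0)
    qed
    ultimately have "good g K" by (auto simp: good_def K_def)
    then show ?case by blast
  next
    case (add f g)
    then obtain K L where "good f K" "good g L" by blast
    have "good (\<lambda>k. f k + g k) (K + L)"
      unfolding good_def
    proof (intro allI impI conjI ballI)
      fix e :: real assume e: "0 < e \<and> e \<le> 1"
      note fg = \<open>good f K\<close>[unfolded good_def, rule_format, OF e] \<open>good g L\<close>[unfolded good_def, rule_format, OF e]
      show "\<bar>f (dilate e p1) + g (dilate e p1)\<bar> \<le> K + L" using fg by linarith
      show "\<bar>\<Delta> (\<lambda>k. f k + g k) e\<bar> \<le> (K + L) * e ^ (2 * n)"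
        using fg unfolding distrib_right \<Delta>_def by linarith
      fix p assume p: "p \<in> {p2, p3, p4}"
      have "\<bar>f (dilate e p) - f (dilate e p1)\<bar> \<le> K * e ^ n"
        "\<bar>g (dilate e p) - g (dilate e p1)\<bar> \<le> L * e ^ n" using fg p by blast+
      then show "\<bar>f (dilate e p) + g (dilate e p) - (f (dilate e p1) + g (dilate e p1))\<bar> \<le> (K + L) * e ^ n"
        unfolding distrib_right by linarith
    qed
    then show ?case by blast
  next
    case (mult f g)
    then obtain K L where "good f K" "good g L" by blast
    \<comment> \<open>With \<open>f = f1 + f'\<close> and \<open>g = g1 + g'\<close>, the difference of \<open>f g\<close> has the five terms
      \<open>f1 \<Delta> g\<close>, \<open>g1 \<Delta> f\<close> and \<open>f' g'\<close> at three points, each bounded by \<open>K L\<close>.\<close>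
    have "good (\<lambda>k. f k * g k) (5 * (K * L))"
      unfolding good_def
    proof (intro allI impI conjI ballI)
      fix e :: real assume e: "0 < e \<and> e \<le> 1"
      note f = \<open>good f K\<close>[unfolded good_def, rule_format, OF e]
        and g = \<open>good g L\<close>[unfolded good_def, rule_format, OF e]
      define f1 g1 where "f1 = f (dilate e p1)" and "g1 = g (dilate e p1)"
      define f' g' where "f' p = f (dilate e p) - f1" and "g' p = g (dilate e p) - g1" for p
      have f1: "\<bar>f1\<bar> \<le> K" and g1: "\<bar>g1\<bar> \<le> L" using f g by (simp_all add: f1_def g1_def)
      have KL: "0 \<le> K" "0 \<le> L" using f1 g1 by auto
      have f': "\<bar>f' p\<bar> \<le> K * e ^ n" and g': "\<bar>g' p\<bar> \<le> L * e ^ n" if "p \<in> {p2, p3, p4}" for p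
        using f g that by (auto simp: f'_def g'_def f1_def g1_def)
      have small: "\<bar>f' p * g' p\<bar> \<le> K * L * e ^ (2 * n)" if "p \<in> {p2, p3, p4}" for p
      proof -
        have "\<bar>f' p * g' p\<bar> \<le> (K * e ^ n) * (L * e ^ n)"
          unfolding abs_mult using f'[OF that] g'[OF that] KL e by (intro mult_mono) auto
        moreover have "e ^ (2 * n) = e ^ n * e ^ n" by (simp only: mult_2 power_add)
        ultimately show ?thesis by (simp only: mult_ac)
      qed
      have "\<bar>f1 * g1\<bar> \<le> K * L" unfolding abs_mult using f1 g1 KL by (intro mult_mono) auto
      then show "\<bar>f (dilate e p1) * g (dilate e p1)\<bar> \<le> 5 * (K * L)"
        using KL by (simp add: f1_def g1_def)
      have "\<bar>f1 * \<Delta> g e\<bar> \<le> K * (L * e ^ (2 * n))" "\<bar>g1 * \<Delta> f e\<bar> \<le> L * (K * e ^ (2 * n))"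
        unfolding abs_mult using f g f1 g1 KL by (intro mult_mono; auto)+
      moreover have "\<Delta> (\<lambda>k. f k * g k) e = f1 * \<Delta> g e + g1 * \<Delta> f e + f' p4 * g' p4 - f' p2 * g' p2 - f' p3 * g' p3"
        by (simp add: \<Delta>_def f'_def g'_def f1_def g1_def algebra_simps)
      ultimately show "\<bar>\<Delta> (\<lambda>k. f k * g k) e\<bar> \<le> 5 * (K * L) * e ^ (2 * n)"
        using small[of p2] small[of p3] small[of p4] by (simp add: mult_ac)
      fix p assume p: "p \<in> {p2, p3, p4}"
      have "\<bar>f1 * g' p\<bar> \<le> K * (L * e ^ n)" "\<bar>g1 * f' p\<bar> \<le> L * (K * e ^ n)"
        unfolding abs_mult using f'[OF p] g'[OF p] f1 g1 KL by (intro mult_mono; auto)+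
      moreover have "\<bar>f' p * g' p\<bar> \<le> K * L * e ^ n"
      proof -
        have "K * L * e ^ (2 * n) \<le> K * L * e ^ n"
          using KL e by (intro mult_left_mono power_decreasing) auto
        with small[OF p] show ?thesis by linarith
      qed
      moreover have "0 \<le> K * L * e ^ n" using KL e by simp
      moreover have "f (dilate e p) * g (dilate e p) - f (dilate e p1) * g (dilate e p1) =
          f1 * g' p + g1 * f' p + f' p * g' p"
        by (simp add: f'_def g'_def f1_def g1_def algebra_simps)
      ultimately show "\<bar>f (dilate e p) * g (dilate e p) - f (dilate e p1) * g (dilate e p1)\<bar> \<le>
          5 * (K * L) * e ^ n"
        by (simp add: mult_ac)
    qed
    then show ?case by blast
  qed
  then obtain K where K: "good b K" by blast
  define D where "D = \<bar>b p1 - b p2 - b p3 + b p4\<bar>"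
  have "D > 0" using b(3) by (simp add: D_def)
  have bound: "D \<le> K * e" if "0 < e" "e \<le> 1" for e
  proof -
    have "\<Delta> b e = e ^ d * (b p1 - b p2 - b p3 + b p4)"
      unfolding \<Delta>_def b(1)[unfolded has_degree_def, rule_format] by (simp only: right_diff_distrib distrib_left)
    then have "e ^ d * D = \<bar>\<Delta> b e\<bar>" using that by (simp add: D_def abs_mult)
    also have "\<dots> \<le> K * e ^ (2 * n)" using K that by (simp add: good_def)
    also have "\<dots> \<le> K * e ^ Suc d"
    proof (rule mult_left_mono)
      show "e ^ (2 * n) \<le> e ^ Suc d" using that b(2) by (intro power_decreasing) auto
      show "0 \<le> K" using K[unfolded good_def, rule_format, of 1] by auto
    qed
    finally show ?thesis using that by (simp add: mult_ac)
  qed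
  have "K > 0" using bound[of 1] \<open>D > 0\<close> by simp
  define e where "e = min 1 (D / (2 * K))"
  have "0 < e" "e \<le> 1" using \<open>K > 0\<close> \<open>D > 0\<close> by (simp_all add: e_def)
  have "K * e \<le> K * (D / (2 * K))" using \<open>K > 0\<close> by (intro mult_left_mono) (simp_all add: e_def)
  also have "\<dots> = D / 2" using \<open>K > 0\<close> by simp
  finally show False using bound[OF \<open>0 < e\<close> \<open>e \<le> 1\<close>] \<open>D > 0\<close> by linarith
qed

text \<open>Degrees with respect to the dilation, in the order of the lists of generators.\<close>

definition complex_degrees :: "nat list" where
  "complex_degrees = [4, 4, 6, 6, 6, 6, 6, 6, 4, 4, 6, 6, 6, 6, 6, 6]"

definition real_degrees :: "nat list" where
  "real_degrees = [0, 0, 0, 0, 4, 4, 4, 4, 2]"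

lemma coord_dilate:
  "cl1 (dilate e k) = cl1 k" "cl2 (dilate e k) = cl2 k" "cm1 (dilate e k) = cm1 k" "cm2 (dilate e k) = cm2 k"
  "ca (dilate e k) = of_real e ^ 2 * ca k" "cb (dilate e k) = of_real e ^ 2 * cb k"
  "cA (dilate e k) = of_real e ^ 2 * cA k" "cB (dilate e k) = of_real e ^ 2 * cB k"
  "cz (dilate e k) = of_real e * cz k"
  by (simp_all add: dilate_def scaleR_conv_of_real)

lemma complex_gens_degrees:
  "list_all2 (\<lambda>m d. \<forall>e k. m (dilate e k) = of_real (e ^ d) * m k) complex_gens complex_degrees"
  unfolding complex_gens_def complex_degrees_def coord_dilate list.rel_inject
  by (simp add: power_mult_distrib mult_ac flip: power_add power_mult power_Suc)

lemma has_degree_Re: "\<forall>e k. m (dilate e k) = of_real (e ^ d) * m k \<Longrightarrow> has_degree d (\<lambda>k. Re (m k))"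
  and has_degree_Im: "\<forall>e k. m (dilate e k) = of_real (e ^ d) * m k \<Longrightarrow> has_degree d (\<lambda>k. Im (m k))"
  unfolding has_degree_def by (simp_all only: Re_complex_of_real_mult Im_complex_of_real_mult simp_thms)

lemma has_degree_mult: "has_degree c f \<Longrightarrow> has_degree d g \<Longrightarrow> has_degree (c + d) (\<lambda>k. f k * g k)"
  unfolding has_degree_def by (simp only: power_add mult_ac simp_thms)

lemma real_gens_degrees: "list_all2 has_degree real_degrees real_gens"
proof -
  have mod: "has_degree c (\<lambda>k. Re (u k * cnj (u k)))"
    if u: "\<And>e k. u (dilate e k) = of_real e ^ d * u k" and c: "c = d + d" for u c d
    by (rule has_degree_Re)
      (simp only: u c complex_cnj_mult complex_cnj_power complex_cnj_complex_of_real power_add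
        of_real_mult of_real_power mult_ac simp_thms)
  have scalars: "has_degree 0 cl1" "has_degree 0 cm1" "has_degree 0 cl2" "has_degree 0 cm2"
    unfolding has_degree_def coord_dilate by simp_all
  have cz: "cz (dilate e k) = of_real e ^ 1 * cz k" for e k
    by (simp add: coord_dilate)
  have "has_degree 4 (\<lambda>k. Re (ca k * cnj (ca k)))" "has_degree 4 (\<lambda>k. Re (cb k * cnj (cb k)))"
    "has_degree 4 (\<lambda>k. Re (cA k * cnj (cA k)))" "has_degree 4 (\<lambda>k. Re (cB k * cnj (cB k)))"
    "has_degree 2 (\<lambda>k. Re (cz k * cnj (cz k)))"
    by (rule mod, rule coord_dilate cz, simp)+
  with scalars show ?thesis
    unfolding real_degrees_def real_gens_def list.rel_inject by (intro conjI list.rel_intros)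
qed

definition all_gens :: "(coords \<Rightarrow> real) list" where
  "all_gens = SO2_gens @ product_gens"

definition all_degrees :: "nat list" where
  "all_degrees = real_degrees @ complex_degrees @ complex_degrees @ [8, 8, 8]"

definition O2_degrees :: "nat list" where
  "O2_degrees = real_degrees @ complex_degrees @ [8, 8, 8]"

lemma gens_degrees:
  shows "list_all2 has_degree all_degrees all_gens" "list_all2 has_degree O2_degrees O2_gens"
proof -
  have re: "list_all2 has_degree complex_degrees (re_parts complex_gens)"
    and im: "list_all2 has_degree complex_degrees (im_parts complex_gens)"
    using complex_gens_degrees
    by (auto simp: list_all2_conv_all_nth re_parts_def im_parts_def intro!: has_degree_Re has_degree_Im)
  have "has_degree 8 (\<lambda>k. Im (m k) * Im (m' k))"
    if "has_degree 4 (\<lambda>k. Im (m k))" "has_degree 4 (\<lambda>k. Im (m' k))" for m m'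
    using has_degree_mult[OF that] by simp
  moreover have "has_degree 4 (\<lambda>k. Im (ca k * cnj (cb k)))" "has_degree 4 (\<lambda>k. Im (cA k * cnj (cB k)))"
    "has_degree 4 (\<lambda>k. Im (cnj (ca k) * (cz k)\<^sup>2))" "has_degree 4 (\<lambda>k. Im (cnj (cb k) * (cz k)\<^sup>2))"
    using im unfolding im_parts_def complex_gens_def complex_degrees_def list.map list.rel_inject by simp_all
  ultimately have "list_all2 has_degree [8, 8, 8] product_gens"
    unfolding product_gens_def list.rel_inject by (intro conjI list.rel_intros)
  note products = this
  show "list_all2 has_degree all_degrees all_gens" "list_all2 has_degree O2_degrees O2_gens"
    unfolding all_gens_def all_degrees_def O2_gens_def O2_degrees_def SO2_gens_def append_assoc
    by (intro list_all2_appendI real_gens_degrees re im products)+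
qed

lemma not_generated_by_others:
  assumes others: "list_all2 (\<lambda>d g. g = b \<and> d < 2 * n \<or>
      g p1 - g p2 - g p3 + g p4 = 0 \<and> (n \<le> d \<or> g p2 = g p1 \<and> g p3 = g p1 \<and> g p4 = g p1)) ds gs"
    and b: "b p1 - b p2 - b p3 + b p4 \<noteq> 0"
    and degrees: "list_all2 has_degree ds gs" and mem: "b \<in> set gs"
  shows "b \<notin> alg (set gs - {b})"
proof -
  have nth: "has_degree (ds ! i) (gs ! i) \<and> (gs ! i = b \<and> ds ! i < 2 * n \<or>
      (gs ! i) p1 - (gs ! i) p2 - (gs ! i) p3 + (gs ! i) p4 = 0 \<and> (n \<le> ds ! i \<or>
        (gs ! i) p2 = (gs ! i) p1 \<and> (gs ! i) p3 = (gs ! i) p1 \<and> (gs ! i) p4 = (gs ! i) p1))"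
    if "i < length gs" for i
    using list_all2_nthD2[OF others that] list_all2_nthD2[OF degrees that] by blast
  obtain i where "i < length gs" "gs ! i = b" using mem by (auto simp: in_set_conv_nth)
  with nth[of i] b have "has_degree (ds ! i) b" "ds ! i < 2 * n" by auto
  then show ?thesis
  proof (intro not_generated_by_four_points[OF _ _ _ b])
    fix g assume "g \<in> set gs - {b}"
    then obtain j where "j < length gs" "gs ! j = g" "g \<noteq> b" by (auto simp: in_set_conv_nth)
    with nth[of j] show "\<exists>d. has_degree d g \<and> g p1 - g p2 - g p3 + g p4 = 0 \<and>
        (n \<le> d \<or> g p2 = g p1 \<and> g p3 = g p1 \<and> g p4 = g p1)" by blast
  qed
qed

lemma not_generated_by_others_two_points:
  assumes "list_all (\<lambda>g. g = b \<or> g p = g q) gs" "b p \<noteq> b q"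
  shows "b \<notin> alg (set gs - {b})"
proof
  assume "b \<in> alg (set gs - {b})"
  then have "b p = b q"
    by (induction rule: alg_induct) (use assms(1) in \<open>auto simp: list_all_iff\<close>)
  with assms(2) show False by simp
qed

lemmas gens_defs = all_gens_def all_degrees_def SO2_gens_def O2_gens_def O2_degrees_def real_gens_def
  complex_gens_def product_gens_def re_parts_def im_parts_def real_degrees_def complex_degrees_def

text \<open>A scalar or a squared modulus is separated by switching on its coordinate alone.\<close>

lemma real_gens_irredundant:
  assumes "b \<in> set real_gens"
  shows "b \<notin> alg (set all_gens - {b})"
  using assms unfolding real_gens_def list.set
  apply (elim insertE emptyE)
  apply (hypsubst, rule not_generated_by_others_two_points[of _ "(1,0,0,0,0,0,0,0,0)" "(0,0,0,0,0,0,0,0,0)"]; simp add: gens_defs)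
  apply (hypsubst, rule not_generated_by_others_two_points[of _ "(0,0,1,0,0,0,0,0,0)" "(0,0,0,0,0,0,0,0,0)"]; simp add: gens_defs)
  apply (hypsubst, rule not_generated_by_others_two_points[of _ "(0,1,0,0,0,0,0,0,0)" "(0,0,0,0,0,0,0,0,0)"]; simp add: gens_defs)
  apply (hypsubst, rule not_generated_by_others_two_points[of _ "(0,0,0,1,0,0,0,0,0)" "(0,0,0,0,0,0,0,0,0)"]; simp add: gens_defs)
  apply (hypsubst, rule not_generated_by_others_two_points[of _ "(0,0,0,0,1,0,0,0,0)" "(0,0,0,0,0,0,0,0,0)"]; simp add: gens_defs)
  apply (hypsubst, rule not_generated_by_others_two_points[of _ "(0,0,0,0,0,1,0,0,0)" "(0,0,0,0,0,0,0,0,0)"]; simp add: gens_defs)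
  apply (hypsubst, rule not_generated_by_others_two_points[of _ "(0,0,0,0,0,0,1,0,0)" "(0,0,0,0,0,0,0,0,0)"]; simp add: gens_defs)
  apply (hypsubst, rule not_generated_by_others_two_points[of _ "(0,0,0,0,0,0,0,1,0)" "(0,0,0,0,0,0,0,0,0)"]; simp add: gens_defs)
  apply (hypsubst, rule not_generated_by_others_two_points[of _ "(0,0,0,0,0,0,0,0,1)" "(0,0,0,0,0,0,0,0,0)"]; simp add: gens_defs)
  done

text \<open>In the next two lemmas the two points, or four points, differ by changing the sign of one
  coordinate, or of two coordinates independently, while the coordinates that do not occur in the
  generator vanish. For \<open>u \<cdot> v \<cdot> cnj U\<close> the signs of \<open>u\<close> and \<open>U\<close> are changed: \<open>u \<cdot> cnj v\<close> changes with
  the first sign only, \<open>u \<cdot> u \<cdot> cnj U\<close> and \<open>v \<cdot> v \<cdot> cnj U\<close> with the second sign only, the squared moduli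
  with none, so \<open>\<Delta>\<close> annihilates them all. For real parts the coordinates are real, for imaginary
  parts one of them is imaginary.\<close>

lemma re_parts_irredundant:
  assumes "b \<in> set (re_parts complex_gens)"
  shows "b \<notin> alg (set all_gens - {b})"
  using assms unfolding re_parts_def complex_gens_def list.map list.set
  apply (elim insertE emptyE)
  apply (hypsubst, rule not_generated_by_others_two_points[of _ "(0,0,0,0,1,1,0,0,0)" "(0,0,0,0,1,-1,0,0,0)"]; simp add: gens_defs)
  apply (hypsubst, rule not_generated_by_others_two_points[of _ "(0,0,0,0,0,0,1,1,0)" "(0,0,0,0,0,0,1,-1,0)"]; simp add: gens_defs)
  apply (hypsubst, rule not_generated_by_others_two_points[of _ "(0,0,0,0,1,0,1,0,0)" "(0,0,0,0,1,0,-1,0,0)"]; simp add: gens_defs)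
  apply (hypsubst, rule not_generated_by_others_two_points[of _ "(0,0,0,0,0,1,1,0,0)" "(0,0,0,0,0,1,-1,0,0)"]; simp add: gens_defs)
  apply (hypsubst, rule not_generated_by_others_two_points[of _ "(0,0,0,0,1,0,0,1,0)" "(0,0,0,0,1,0,0,-1,0)"]; simp add: gens_defs)
  apply (hypsubst, rule not_generated_by_others_two_points[of _ "(0,0,0,0,0,1,0,1,0)" "(0,0,0,0,0,1,0,-1,0)"]; simp add: gens_defs)
  apply (hypsubst, rule not_generated_by_others[of _ 4 "(0,0,0,0,1,1,1,0,0)" "(0,0,0,0,-1,1,1,0,0)"
        "(0,0,0,0,1,1,-1,0,0)" "(0,0,0,0,-1,1,-1,0,0)", OF _ _ gens_degrees(1)]; simp add: gens_defs)
  apply (hypsubst, rule not_generated_by_others[of _ 4 "(0,0,0,0,1,1,0,1,0)" "(0,0,0,0,-1,1,0,1,0)"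
        "(0,0,0,0,1,1,0,-1,0)" "(0,0,0,0,-1,1,0,-1,0)", OF _ _ gens_degrees(1)]; simp add: gens_defs)
  apply (hypsubst, rule not_generated_by_others_two_points[of _ "(0,0,0,0,1,0,0,0,1)" "(0,0,0,0,-1,0,0,0,1)"]; simp add: gens_defs)
  apply (hypsubst, rule not_generated_by_others_two_points[of _ "(0,0,0,0,0,1,0,0,1)" "(0,0,0,0,0,-1,0,0,1)"]; simp add: gens_defs)
  apply (hypsubst, rule not_generated_by_others[of _ 4 "(0,0,0,0,1,0,1,0,1)" "(0,0,0,0,-1,0,1,0,1)"
        "(0,0,0,0,1,0,-1,0,1)" "(0,0,0,0,-1,0,-1,0,1)", OF _ _ gens_degrees(1)]; simp add: gens_defs)
  apply (hypsubst, rule not_generated_by_others[of _ 4 "(0,0,0,0,1,0,0,1,1)" "(0,0,0,0,-1,0,0,1,1)"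
        "(0,0,0,0,1,0,0,-1,1)" "(0,0,0,0,-1,0,0,-1,1)", OF _ _ gens_degrees(1)]; simp add: gens_defs)
  apply (hypsubst, rule not_generated_by_others[of _ 4 "(0,0,0,0,0,1,1,0,1)" "(0,0,0,0,0,-1,1,0,1)"
        "(0,0,0,0,0,1,-1,0,1)" "(0,0,0,0,0,-1,-1,0,1)", OF _ _ gens_degrees(1)]; simp add: gens_defs)
  apply (hypsubst, rule not_generated_by_others[of _ 4 "(0,0,0,0,0,1,0,1,1)" "(0,0,0,0,0,-1,0,1,1)"
        "(0,0,0,0,0,1,0,-1,1)" "(0,0,0,0,0,-1,0,-1,1)", OF _ _ gens_degrees(1)]; simp add: gens_defs)
  apply (hypsubst, rule not_generated_by_others_two_points[of _ "(0,0,0,0,0,0,1,0,1)" "(0,0,0,0,0,0,-1,0,1)"]; simp add: gens_defs)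
  apply (hypsubst, rule not_generated_by_others_two_points[of _ "(0,0,0,0,0,0,0,1,1)" "(0,0,0,0,0,0,0,-1,1)"]; simp add: gens_defs)
  done

lemma im_parts_irredundant:
  assumes "b \<in> set (im_parts complex_gens)"
  shows "b \<notin> alg (set all_gens - {b})"
  using assms unfolding im_parts_def complex_gens_def list.map list.set
  apply (elim insertE emptyE)
  apply (hypsubst, rule not_generated_by_others_two_points[of _ "(0,0,0,0,1,\<i>,0,0,0)" "(0,0,0,0,1,-\<i>,0,0,0)"]; simp add: gens_defs)
  apply (hypsubst, rule not_generated_by_others_two_points[of _ "(0,0,0,0,0,0,1,\<i>,0)" "(0,0,0,0,0,0,1,-\<i>,0)"]; simp add: gens_defs)
  apply (hypsubst, rule not_generated_by_others_two_points[of _ "(0,0,0,0,1,0,\<i>,0,0)" "(0,0,0,0,1,0,-\<i>,0,0)"]; simp add: gens_defs)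
  apply (hypsubst, rule not_generated_by_others_two_points[of _ "(0,0,0,0,0,1,\<i>,0,0)" "(0,0,0,0,0,1,-\<i>,0,0)"]; simp add: gens_defs)
  apply (hypsubst, rule not_generated_by_others_two_points[of _ "(0,0,0,0,1,0,0,\<i>,0)" "(0,0,0,0,1,0,0,-\<i>,0)"]; simp add: gens_defs)
  apply (hypsubst, rule not_generated_by_others_two_points[of _ "(0,0,0,0,0,1,0,\<i>,0)" "(0,0,0,0,0,1,0,-\<i>,0)"]; simp add: gens_defs)
  apply (hypsubst, rule not_generated_by_others[of _ 4 "(0,0,0,0,1,1,\<i>,0,0)" "(0,0,0,0,-1,1,\<i>,0,0)"
        "(0,0,0,0,1,1,-\<i>,0,0)" "(0,0,0,0,-1,1,-\<i>,0,0)", OF _ _ gens_degrees(1)]; simp add: gens_defs)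
  apply (hypsubst, rule not_generated_by_others[of _ 4 "(0,0,0,0,1,1,0,\<i>,0)" "(0,0,0,0,-1,1,0,\<i>,0)"
        "(0,0,0,0,1,1,0,-\<i>,0)" "(0,0,0,0,-1,1,0,-\<i>,0)", OF _ _ gens_degrees(1)]; simp add: gens_defs)
  apply (hypsubst, rule not_generated_by_others_two_points[of _ "(0,0,0,0,\<i>,0,0,0,1)" "(0,0,0,0,-\<i>,0,0,0,1)"]; simp add: gens_defs)
  apply (hypsubst, rule not_generated_by_others_two_points[of _ "(0,0,0,0,0,\<i>,0,0,1)" "(0,0,0,0,0,-\<i>,0,0,1)"]; simp add: gens_defs)
  apply (hypsubst, rule not_generated_by_others[of _ 4 "(0,0,0,0,1,0,\<i>,0,1)" "(0,0,0,0,-1,0,\<i>,0,1)"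
        "(0,0,0,0,1,0,-\<i>,0,1)" "(0,0,0,0,-1,0,-\<i>,0,1)", OF _ _ gens_degrees(1)]; simp add: gens_defs)
  apply (hypsubst, rule not_generated_by_others[of _ 4 "(0,0,0,0,1,0,0,\<i>,1)" "(0,0,0,0,-1,0,0,\<i>,1)"
        "(0,0,0,0,1,0,0,-\<i>,1)" "(0,0,0,0,-1,0,0,-\<i>,1)", OF _ _ gens_degrees(1)]; simp add: gens_defs)
  apply (hypsubst, rule not_generated_by_others[of _ 4 "(0,0,0,0,0,1,\<i>,0,1)" "(0,0,0,0,0,-1,\<i>,0,1)"
        "(0,0,0,0,0,1,-\<i>,0,1)" "(0,0,0,0,0,-1,-\<i>,0,1)", OF _ _ gens_degrees(1)]; simp add: gens_defs)
  apply (hypsubst, rule not_generated_by_others[of _ 4 "(0,0,0,0,0,1,0,\<i>,1)" "(0,0,0,0,0,-1,0,\<i>,1)"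
        "(0,0,0,0,0,1,0,-\<i>,1)" "(0,0,0,0,0,-1,0,-\<i>,1)", OF _ _ gens_degrees(1)]; simp add: gens_defs)
  apply (hypsubst, rule not_generated_by_others_two_points[of _ "(0,0,0,0,0,0,\<i>,0,1)" "(0,0,0,0,0,0,-\<i>,0,1)"]; simp add: gens_defs)
  apply (hypsubst, rule not_generated_by_others_two_points[of _ "(0,0,0,0,0,0,0,\<i>,1)" "(0,0,0,0,0,0,0,-\<i>,1)"]; simp add: gens_defs)
  done

text \<open>For \<open>Im (u \<cdot> cnj v) \<cdot> Im (U \<cdot> cnj V)\<close> the signs of \<open>U\<close> and \<open>V\<close> are changed. Phases are chosen
  such that \<open>u \<cdot> cnj v\<close> and \<open>U \<cdot> cnj V\<close> are imaginary, so that the product of their real parts, which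
  has the same degree, vanishes. The remaining varying generators are linear in one of \<open>U\<close>
  and \<open>V\<close>, hence annihilated by \<open>\<Delta>\<close>, and they have degree 6.\<close>

lemma product_gens_irredundant:
  assumes "b \<in> set product_gens"
  shows "b \<notin> alg (set O2_gens - {b})"
  using assms unfolding product_gens_def list.set
  apply (elim insertE emptyE)
  apply (hypsubst, rule not_generated_by_others[of _ 6 "(0,0,0,0,\<i>,1,1,\<i>,0)" "(0,0,0,0,\<i>,1,-1,\<i>,0)"
        "(0,0,0,0,\<i>,1,1,-\<i>,0)" "(0,0,0,0,\<i>,1,-1,-\<i>,0)", OF _ _ gens_degrees(2)]; simp add: gens_defs)
  apply (hypsubst, rule not_generated_by_others[of _ 6 "(0,0,0,0,\<i>,0,1,\<i>,1)" "(0,0,0,0,\<i>,0,-1,\<i>,1)"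
        "(0,0,0,0,\<i>,0,1,-\<i>,1)" "(0,0,0,0,\<i>,0,-1,-\<i>,1)", OF _ _ gens_degrees(2)]; simp add: gens_defs)
  apply (hypsubst, rule not_generated_by_others[of _ 6 "(0,0,0,0,0,\<i>,1,\<i>,1)" "(0,0,0,0,0,\<i>,-1,\<i>,1)"
        "(0,0,0,0,0,\<i>,1,-\<i>,1)" "(0,0,0,0,0,\<i>,-1,-\<i>,1)", OF _ _ gens_degrees(2)]; simp add: gens_defs)
  done

lemma distinct_all_gens: "distinct all_gens"
proof -
  \<comment> \<open>A point with small integral coordinates at which the 44 functions take different values.\<close>
  let ?p = "(2, 19, 3, 1, Complex (-2) 4, Complex (-3) (-4), Complex (-3) (-3), Complex (-4) 1, -4) :: coords"
  have "distinct (map (\<lambda>g. g ?p) all_gens)"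
    by (simp add: gens_defs power2_eq_square power4_eq_xxxx)
  then show ?thesis by (rule distinct_map[THEN iffD1, THEN conjunct1])
qed

lemma SO2_gens_irredundant:
  assumes "b \<in> set SO2_gens"
  shows "b \<notin> alg (set SO2_gens - {b})"
proof -
  have "b \<notin> alg (set all_gens - {b})"
    using assms real_gens_irredundant re_parts_irredundant im_parts_irredundant
    unfolding SO2_gens_def set_append by blast
  moreover have "set SO2_gens - {b} \<subseteq> set all_gens - {b}" by (auto simp: all_gens_def)
  ultimately show ?thesis using generated_algebra_mono by blast
qed

lemma O2_gens_irredundant:
  assumes "b \<in> set O2_gens"
  shows "b \<notin> alg (set O2_gens - {b})"
proof (cases "b \<in> set product_gens")
  case False
  have "b \<notin> alg (set all_gens - {b})"
    using assms False real_gens_irredundant re_parts_irredundant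
    unfolding O2_gens_def set_append by blast
  moreover have "set O2_gens - {b} \<subseteq> set all_gens - {b}"
    by (auto simp: all_gens_def SO2_gens_def O2_gens_def)
  ultimately show ?thesis using generated_algebra_mono by blast
qed (rule product_gens_irredundant)

section \<open>Minimal integrity bases in complex coordinates\<close>

lemma minimal_integrity_basisI:
  assumes "integrity_basis V A B" and irr: "\<And>b. b \<in> B \<Longrightarrow> b \<notin> generated_algebra V (B - {b})"
  shows "minimal_integrity_basis V A B"
  unfolding minimal_integrity_basis_def
proof (intro conjI allI impI assms(1) notI)
  fix B' assume "B' \<subset> B" and gen: "generated_algebra V B' = A"
  then obtain b where b: "b \<in> B" "B' \<subseteq> B - {b}" by blast
  have "b \<in> generated_algebra V B" using b(1) by (rule generated_algebra.base)
  then have "b \<in> generated_algebra V B'"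
    using assms(1) gen by (simp add: integrity_basis_def)
  with irr[OF b(1)] b(2) show False using generated_algebra_mono by blast
qed

lemma Inv_algebra_UNIV:
  "f \<in> Inv_algebra UNIV G act \<longleftrightarrow> real_polynomial_function f \<and> (\<forall>g\<in>G. \<forall>k. f (act g k) = f k)"
  by (simp add: Inv_algebra_def polynomials_on_def restrict_UNIV)

lemma alg_subset_Inv_algebra:
  assumes "\<And>f. f \<in> F \<Longrightarrow> real_polynomial_function f" "\<And>f g k. f \<in> F \<Longrightarrow> g \<in> G \<Longrightarrow> f (act g k) = f k"
    and "h \<in> alg F"
  shows "h \<in> Inv_algebra UNIV G act"
  unfolding Inv_algebra_UNIV
  using assms(3) by (induction rule: alg_induct) (use assms(1,2) in auto)

lemma integrity_basis_UNIV:
  assumes "\<And>f. f \<in> set gs \<Longrightarrow> real_polynomial_function f"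
    and "\<And>f g k. f \<in> set gs \<Longrightarrow> g \<in> G \<Longrightarrow> f (act g k) = f k"
    and "\<And>f. real_polynomial_function f \<Longrightarrow> (\<And>g k. g \<in> G \<Longrightarrow> f (act g k) = f k) \<Longrightarrow> f \<in> alg (set gs)"
    and "\<And>f. f \<in> set gs \<Longrightarrow> \<exists>d. \<forall>t k. f (t *\<^sub>R k) = t ^ d * f k"
  shows "integrity_basis UNIV (Inv_algebra UNIV G act) (set gs)"
  unfolding integrity_basis_def
proof (intro conjI ballI)
  show "homogeneous_on UNIV f" if "f \<in> set gs" for f
    using assms(4)[OF that] unfolding homogeneous_on_def by blast
  show "alg (set gs) = Inv_algebra UNIV G act"
  proof
    show "alg (set gs) \<subseteq> Inv_algebra UNIV G act"
      using alg_subset_Inv_algebra[of "set gs" G act] assms(1,2) by blast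
    show "Inv_algebra UNIV G act \<subseteq> alg (set gs)"
      using assms(3) unfolding Inv_algebra_UNIV subset_iff by blast
  qed
qed simp

lemma minimal_integrity_basis_SO2:
  "minimal_integrity_basis UNIV (Inv_algebra UNIV SO2 act_coords) (set SO2_gens)"
proof (rule minimal_integrity_basisI[OF integrity_basis_UNIV])
  show "real_polynomial_function f" if "f \<in> set SO2_gens" for f
    using that by (intro gens_polynomial) simp
  show "f (act_coords g k) = f k" if "f \<in> set SO2_gens" "g \<in> SO2" for f g k
    using that by (intro SO2_gens_invariant) simp_all
  show "\<exists>d. \<forall>t k. f (t *\<^sub>R k) = t ^ d * f k" if "f \<in> set SO2_gens" for f
    using that by (intro gens_homogeneous) simp
qed (fact SO2_gens_generate SO2_gens_irredundant)+

lemma minimal_integrity_basis_O2: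
  "minimal_integrity_basis UNIV (Inv_algebra UNIV O2 act_coords) (set O2_gens)"
proof (rule minimal_integrity_basisI[OF integrity_basis_UNIV])
  show "real_polynomial_function f" if "f \<in> set O2_gens" for f
    using that by (intro gens_polynomial) simp
  show "f (act_coords g k) = f k" if "f \<in> set O2_gens" "g \<in> O2" for f g k
    using that by (intro O2_gens_invariant) simp_all
  show "\<exists>d. \<forall>t k. f (t *\<^sub>R k) = t ^ d * f k" if "f \<in> set O2_gens" for f
    using that by (intro gens_homogeneous) simp
qed (fact O2_gens_generate O2_gens_irredundant)+

definition scale_x :: "real \<Rightarrow> coords \<Rightarrow> coords" where
  "scale_x t k = (cl1 k, cl2 k, cm1 k, cm2 k, ca k, cb k, cA k, cB k, of_real t * cz k)"

definition x_order :: "nat \<Rightarrow> (coords \<Rightarrow> real) \<Rightarrow> bool" where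
  "x_order n f \<longleftrightarrow> (\<forall>t k. f (scale_x t k) = t ^ n * f k)"

definition complex_orders :: "nat list" where
  "complex_orders = [0, 0, 0, 0, 0, 0, 0, 0, 2, 2, 2, 2, 2, 2, 4, 4]"

lemma coord_scale_x:
  "cl1 (scale_x t k) = cl1 k" "cl2 (scale_x t k) = cl2 k" "cm1 (scale_x t k) = cm1 k" "cm2 (scale_x t k) = cm2 k"
  "ca (scale_x t k) = ca k" "cb (scale_x t k) = cb k" "cA (scale_x t k) = cA k" "cB (scale_x t k) = cB k"
  "cz (scale_x t k) = of_real t * cz k"
  by (simp_all add: scale_x_def)

lemma complex_gens_orders:
  "list_all2 (\<lambda>n m. \<forall>t k. m (scale_x t k) = of_real (t ^ n) * m k) complex_orders complex_gens"
  unfolding complex_gens_def complex_orders_def coord_scale_x list.rel_inject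
  by (simp add: power_mult_distrib mult_ac)

lemma x_orderI_Re: "\<forall>t k. m (scale_x t k) = of_real (t ^ n) * m k \<Longrightarrow> x_order n (\<lambda>k. Re (m k))"
  and x_orderI_Im: "\<forall>t k. m (scale_x t k) = of_real (t ^ n) * m k \<Longrightarrow> x_order n (\<lambda>k. Im (m k))"
  unfolding x_order_def by (simp_all only: Re_complex_of_real_mult Im_complex_of_real_mult simp_thms)

lemma parts_orders:
  "list_all2 x_order complex_orders (re_parts complex_gens)"
  "list_all2 x_order complex_orders (im_parts complex_gens)"
  using complex_gens_orders
  by (auto simp: list_all2_conv_all_nth re_parts_def im_parts_def intro!: x_orderI_Re x_orderI_Im)

lemma real_gens_orders: "list_all2 x_order [0, 0, 0, 0, 0, 0, 0, 0, 2] real_gens"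
  unfolding real_gens_def list.rel_inject x_order_def coord_scale_x
  by (simp add: power2_eq_square algebra_simps)

lemma product_gens_orders: "list_all2 x_order [0, 2, 2] product_gens"
proof -
  have z2: "(of_real t * z)\<^sup>2 = of_real (t\<^sup>2) * z\<^sup>2" for t and z :: complex by (simp add: power_mult_distrib)
  have im: "Im (u * (of_real c * v)) = c * Im (u * v)" for u v c by (simp add: algebra_simps)
  show ?thesis
    unfolding product_gens_def list.rel_inject x_order_def coord_scale_x z2 im by (simp add: mult_ac)
qed

text \<open>A function of two different orders vanishes, and an irredundant generator is not zero.\<close>

lemma card_x_order_0:
  assumes orders: "list_all2 x_order ns gs" and "distinct gs"
    and irr: "\<And>g. g \<in> set gs \<Longrightarrow> g \<notin> alg (set gs - {g})"
  shows "card {g \<in> set gs. x_order 0 g} = length (filter (\<lambda>n. n = 0) ns)"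
proof -
  have "x_order 0 g \<longleftrightarrow> n = 0" if "x_order n g" "g \<in> set gs" for n g
  proof
    assume 0: "x_order 0 g"
    show "n = 0"
    proof (rule ccontr)
      assume "n \<noteq> 0"
      then have "g = (\<lambda>k. 0)"
        using 0 \<open>x_order n g\<close> unfolding x_order_def
        by (intro ext) (metis mult_cancel_right1 mult_zero_left power_0 zero_power not_gr_zero)
      then have "g \<in> alg (set gs - {g})" by (simp only: alg_const)
      with irr[OF that(2)] show False by blast
    qed
  qed (use that in simp)
  then have "list_all2 (\<lambda>n g. x_order 0 g \<longleftrightarrow> n = 0) ns gs"
    using orders by (simp add: list_all2_conv_all_nth)
  then have "length (filter (x_order 0) gs) = length (filter (\<lambda>n. n = 0) ns)"
    by (induction rule: list_all2_induct) auto
  moreover have "card {g \<in> set gs. x_order 0 g} = length (filter (x_order 0) gs)"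
    using \<open>distinct gs\<close> distinct_card[of "filter (x_order 0) gs"] by simp
  ultimately show ?thesis by simp
qed

lemma distinct_gens: "distinct SO2_gens" "distinct O2_gens"
  using distinct_all_gens by (auto simp: all_gens_def SO2_gens_def O2_gens_def)

lemma card_gens: "card (set SO2_gens) = 41" "card (set O2_gens) = 28"
  by (simp_all add: distinct_card distinct_gens)
    (simp_all add: SO2_gens_def O2_gens_def real_gens_def re_parts_def im_parts_def complex_gens_def product_gens_def)

lemma card_invariant_gens:
  "card {g \<in> set SO2_gens. x_order 0 g} = 24" "card {g \<in> set O2_gens. x_order 0 g} = 17"
proof -
  have "list_all2 x_order ([0, 0, 0, 0, 0, 0, 0, 0, 2] @ complex_orders @ complex_orders) SO2_gens"
    "list_all2 x_order ([0, 0, 0, 0, 0, 0, 0, 0, 2] @ complex_orders @ [0, 2, 2]) O2_gens"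
    unfolding SO2_gens_def O2_gens_def
    by (intro list_all2_appendI real_gens_orders parts_orders product_gens_orders)+
  from card_x_order_0[OF this(1) distinct_gens(1) SO2_gens_irredundant]
    card_x_order_0[OF this(2) distinct_gens(2) O2_gens_irredundant]
  show "card {g \<in> set SO2_gens. x_order 0 g} = 24" "card {g \<in> set O2_gens. x_order 0 g} = 17"
    by (simp_all add: complex_orders_def)
qed

section \<open>Transport along an equivariant linear isomorphism\<close>

text \<open>\<open>\<Theta>\<close> parametrizes the subspace \<open>V\<close> and \<open>\<Psi>\<close> inverts it on \<open>V\<close>; outside \<open>V\<close> the values of
  \<open>\<Psi>\<close> are arbitrary.\<close>

locale coordinates =
  fixes V :: "'v::euclidean_space set" and \<Psi> :: "'v \<Rightarrow> coords" and \<Theta> :: "coords \<Rightarrow> 'v"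
  assumes linear_\<Theta>: "linear \<Theta>" and range_\<Theta>: "range \<Theta> = V" and \<Psi>_\<Theta>: "\<Psi> (\<Theta> k) = k"
begin

definition pull :: "(coords \<Rightarrow> real) \<Rightarrow> 'v \<Rightarrow> real" where
  "pull f = restrict (\<lambda>v. f (\<Psi> v)) V"

lemma \<Theta>_mem: "\<Theta> k \<in> V" using range_\<Theta> by blast

lemma \<Theta>_\<Psi>: "v \<in> V \<Longrightarrow> \<Theta> (\<Psi> v) = v" using range_\<Theta> \<Psi>_\<Theta> by auto

lemma pull_\<Theta>: "pull f (\<Theta> k) = f k" by (simp add: pull_def \<Theta>_mem \<Psi>_\<Theta>)

lemma inj_pull: "inj pull"
proof (rule injI)
  fix f g assume "pull f = pull g"
  then have "pull f (\<Theta> k) = pull g (\<Theta> k)" for k by simp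
  then show "f = g" by (auto simp: pull_\<Theta>)
qed

lemma pull_add: "pull (\<lambda>k. f k + g k) = (\<lambda>v\<in>V. pull f v + pull g v)"
  and pull_mult: "pull (\<lambda>k. f k * g k) = (\<lambda>v\<in>V. pull f v * pull g v)"
  unfolding pull_def by (rule restrict_ext; simp)+

lemma pull_generated: "pull ` alg F = generated_algebra V (pull ` F)"
proof
  have "pull f \<in> generated_algebra V (pull ` F)" if "f \<in> alg F" for f
    using that
  proof (induction rule: alg_induct)
    case (const c)
    show ?case unfolding pull_def by (rule generated_algebra.const)
  next
    case (base f)
    then show ?case by (intro generated_algebra.base imageI)
  next
    case (add f g)
    from generated_algebra.add[OF add.IH] show ?case by (simp only: pull_add)
  next
    case (mult f g)
    from generated_algebra.mult[OF mult.IH] show ?case by (simp only: pull_mult)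
  qed
  then show "pull ` alg F \<subseteq> generated_algebra V (pull ` F)" by blast
  have "\<exists>f\<in>alg F. h = pull f" if "h \<in> generated_algebra V (pull ` F)" for h
    using that
  proof induction
    case (const c)
    show ?case by (intro bexI[of _ "\<lambda>k. c"] alg_const) (simp add: pull_def)
  next
    case (base h)
    then show ?case by (auto intro: alg_base)
  next
    case (add h h')
    then obtain f g where "f \<in> alg F" "h = pull f" "g \<in> alg F" "h' = pull g" by blast
    then show ?case
      by (intro bexI[of _ "\<lambda>k. f k + g k"] alg_add) (simp_all only: pull_add)
  next
    case (mult h h')
    then obtain f g where "f \<in> alg F" "h = pull f" "g \<in> alg F" "h' = pull g" by blast
    then show ?case
      by (intro bexI[of _ "\<lambda>k. f k * g k"] alg_mult) (simp_all only: pull_mult)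
  qed
  then show "generated_algebra V (pull ` F) \<subseteq> pull ` alg F" by blast
qed

text \<open>A linear left inverse of \<open>\<Theta>\<close> on the whole ambient space turns polynomials in the
  coordinates into restrictions of ambient polynomials.\<close>

lemma pull_Inv_algebra:
  assumes act: "\<And>g v. g \<in> G \<Longrightarrow> v \<in> V \<Longrightarrow> act g v \<in> V \<and> \<Psi> (act g v) = act_coords g (\<Psi> v)"
  shows "pull ` Inv_algebra UNIV G act_coords = Inv_algebra V G act"
proof
  have "inj \<Theta>" by (rule inj_on_inverseI[of _ \<Psi>]) (rule \<Psi>_\<Theta>)
  from linear_injective_left_inverse[OF linear_\<Theta> this] obtain L where
    L: "linear L" "L \<circ> \<Theta> = id" by blast
  have L_\<Psi>: "L v = \<Psi> v" if "v \<in> V" for v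
    using \<Theta>_\<Psi>[OF that] fun_cong[OF L(2), of "\<Psi> v"] by simp
  show "pull ` Inv_algebra UNIV G act_coords \<subseteq> Inv_algebra V G act"
  proof
    fix h assume "h \<in> pull ` Inv_algebra UNIV G act_coords"
    then obtain f where f: "real_polynomial_function f" "\<And>g k. g \<in> G \<Longrightarrow> f (act_coords g k) = f k"
      and h: "h = pull f" by (auto simp: Inv_algebra_UNIV)
    have "real_polynomial_function (f \<circ> L)"
      using L(1) f(1)
      by (intro real_polynomial_function_compose polynomial_function_bounded_linear)
        (simp add: linear_conv_bounded_linear)
    moreover have "h = restrict (f \<circ> L) V"
      unfolding h pull_def by (rule restrict_ext) (simp add: L_\<Psi>)
    ultimately have "h \<in> polynomials_on V" unfolding polynomials_on_def by blast
    moreover have "h (act g v) = h v" if "g \<in> G" "v \<in> V" for g v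
      using act[OF that] that f(2)[OF that(1)] by (simp add: h pull_def)
    ultimately show "h \<in> Inv_algebra V G act" by (simp add: Inv_algebra_def)
  qed
  show "Inv_algebra V G act \<subseteq> pull ` Inv_algebra UNIV G act_coords"
  proof
    fix h assume h: "h \<in> Inv_algebra V G act"
    then obtain h' where h': "real_polynomial_function h'" "h = restrict h' V"
      by (auto simp: Inv_algebra_def polynomials_on_def)
    have "real_polynomial_function (h' \<circ> \<Theta>)"
      using linear_\<Theta> h'(1)
      by (intro real_polynomial_function_compose polynomial_function_bounded_linear)
        (simp add: linear_conv_bounded_linear)
    moreover have "(h' \<circ> \<Theta>) (act_coords g k) = (h' \<circ> \<Theta>) k" if "g \<in> G" for g k
    proof -
      have "\<Theta> (act_coords g k) = act g (\<Theta> k)"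
        using act[OF that \<Theta>_mem[of k]] \<Theta>_\<Psi> \<Psi>_\<Theta> by metis
      moreover have "h (act g (\<Theta> k)) = h (\<Theta> k)"
        using h that \<Theta>_mem by (simp add: Inv_algebra_def)
      ultimately show ?thesis using act[OF that \<Theta>_mem[of k]] \<Theta>_mem[of k] by (simp add: h'(2))
    qed
    moreover have "h = pull (h' \<circ> \<Theta>)"
      unfolding h'(2) pull_def by (rule restrict_ext) (simp add: \<Theta>_\<Psi>)
    ultimately show "h \<in> pull ` Inv_algebra UNIV G act_coords" by (auto simp: Inv_algebra_UNIV)
  qed
qed

lemma \<Psi>_scale:
  assumes "v \<in> V"
  shows "t *\<^sub>R v \<in> V" "\<Psi> (t *\<^sub>R v) = t *\<^sub>R \<Psi> v"
proof -
  have "\<Theta> (t *\<^sub>R \<Psi> v) = t *\<^sub>R v"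
    by (simp only: linear_scale[OF linear_\<Theta>] \<Theta>_\<Psi>[OF assms])
  then show "t *\<^sub>R v \<in> V" "\<Psi> (t *\<^sub>R v) = t *\<^sub>R \<Psi> v"
    using \<Theta>_mem \<Psi>_\<Theta> by metis+
qed

lemma pull_minimal_integrity_basis:
  assumes B: "minimal_integrity_basis UNIV (Inv_algebra UNIV G act_coords) B"
    and act: "\<And>g v. g \<in> G \<Longrightarrow> v \<in> V \<Longrightarrow> act g v \<in> V \<and> \<Psi> (act g v) = act_coords g (\<Psi> v)"
  shows "minimal_integrity_basis V (Inv_algebra V G act) (pull ` B)"
  unfolding minimal_integrity_basis_def integrity_basis_def
proof (intro conjI ballI allI impI)
  note B' = B[unfolded minimal_integrity_basis_def integrity_basis_def]
  show "finite (pull ` B)" using B' by simp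
  have "alg B = Inv_algebra UNIV G act_coords" using B' by blast
  then show "generated_algebra V (pull ` B) = Inv_algebra V G act"
    by (simp only: pull_Inv_algebra[OF act] flip: pull_generated)
  show "homogeneous_on V h" if "h \<in> pull ` B" for h
  proof -
    from that obtain f where f: "f \<in> B" "h = pull f" by blast
    have "homogeneous_on UNIV f" using B' f(1) by blast
    then obtain d where d: "\<And>t k. f (t *\<^sub>R k) = t ^ d * f k"
      unfolding homogeneous_on_def by blast
    have "pull f (t *\<^sub>R v) = t ^ d * pull f v" if "v \<in> V" for v t
    proof -
      have "pull f (t *\<^sub>R v) = f (\<Psi> (t *\<^sub>R v))" using \<Psi>_scale[OF that] by (simp only: pull_def restrict_apply')
      also have "\<dots> = t ^ d * f (\<Psi> v)" using \<Psi>_scale[OF that] by (simp only: d)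
      also have "f (\<Psi> v) = pull f v" using that by (simp only: pull_def restrict_apply')
      finally show ?thesis .
    qed
    then show ?thesis unfolding homogeneous_on_def f(2) by blast
  qed
  fix C assume "C \<subset> pull ` B"
  then have "C \<subseteq> pull ` B" by blast
  then obtain D where D: "D \<subseteq> B" "C = pull ` D" by (rule subset_imageE)
  with \<open>C \<subset> pull ` B\<close> have "D \<subset> B" by blast
  then have "alg D \<noteq> Inv_algebra UNIV G act_coords" using B' by blast
  then have "pull ` alg D \<noteq> pull ` Inv_algebra UNIV G act_coords"
    using inj_image_eq_iff[OF inj_pull] by blast
  then show "generated_algebra V C \<noteq> Inv_algebra V G act"
    by (simp only: D(2) pull_Inv_algebra[OF act] pull_generated not_False_eq_True)
qed

end

section \<open>Harmonic tensors as powers of the isotropic vector\<close>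

text \<open>Harmonic tensors of order \<open>n\<close> are the real parts of the complex multiples of the \<open>n\<close>-th
  tensor power of the isotropic vector \<open>(1, - \<i>)\<close>, because \<open>x - \<i> y = cnj z\<close>. The exponent below
  counts the indices that are equal to 2.\<close>

definition is_second :: "2 \<Rightarrow> nat" where
  "is_second i = (if i = 1 then 0 else 1)"

definition tensor2_of :: "complex \<Rightarrow> tensor2" where
  "tensor2_of u = (\<chi> i j. Re (u * (- \<i>) ^ (is_second i + is_second j)))"

definition tensor4_of :: "complex \<Rightarrow> tensor4" where
  "tensor4_of u = (\<chi> i j k l. Re (u * (- \<i>) ^ (is_second i + is_second j + is_second k + is_second l)))"

definition coord2 :: "tensor2 \<Rightarrow> complex" where
  "coord2 h = Complex (h$1$1) (h$1$2)"

definition coord4 :: "tensor4 \<Rightarrow> complex" where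
  "coord4 H = Complex (H$1$1$1$1) (H$1$1$1$2)"

lemma is_second_simps [simp]: "is_second 1 = 0" "is_second 2 = 1"
  by (simp_all add: is_second_def)

lemma tensor2_components:
  "tensor2_of u$1$1 = Re u" "tensor2_of u$1$2 = Im u" "tensor2_of u$2$1 = Im u" "tensor2_of u$2$2 = - Re u"
  by (simp_all add: tensor2_of_def)

lemma tensor4_components:
  "tensor4_of u$1$1$1$1 = Re u" "tensor4_of u$1$1$1$2 = Im u" "tensor4_of u$1$1$2$1 = Im u"
  "tensor4_of u$1$1$2$2 = - Re u" "tensor4_of u$1$2$1$1 = Im u" "tensor4_of u$1$2$1$2 = - Re u"
  "tensor4_of u$1$2$2$1 = - Re u" "tensor4_of u$1$2$2$2 = - Im u" "tensor4_of u$2$1$1$1 = Im u"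
  "tensor4_of u$2$1$1$2 = - Re u" "tensor4_of u$2$1$2$1 = - Re u" "tensor4_of u$2$1$2$2 = - Im u"
  "tensor4_of u$2$2$1$1 = - Re u" "tensor4_of u$2$2$1$2 = - Im u" "tensor4_of u$2$2$2$1 = - Im u"
  "tensor4_of u$2$2$2$2 = Re u"
  by (simp_all add: tensor4_of_def numeral_eq_Suc)

lemma tensor2_eqI: "(S::tensor2) = T"
  if "S$1$1 = T$1$1" "S$1$2 = T$1$2" "S$2$1 = T$2$1" "S$2$2 = T$2$2"
  using that by (simp add: vec_eq_iff forall_2)

lemma Harm2_tensor2_of: "tensor2_of u \<in> Harm2"
  by (simp add: Harm2_def forall_2 trace_def sum_2 tensor2_components)

lemma Harm2_eq:
  assumes "h \<in> Harm2"
  shows "h = tensor2_of (coord2 h)"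
proof -
  have "h$2$1 = h$1$2" "trace h = 0" using assms unfolding Harm2_def mem_Collect_eq by blast+
  then show ?thesis
    by (intro tensor2_eqI) (simp_all add: trace_def sum_2 tensor2_components coord2_def)
qed

lemma Harm4_tensor4_of: "tensor4_of u \<in> Harm4"
  by (simp add: Harm4_def forall_2 sum_2 tensor4_components)

lemma Harm4_eq:
  assumes "H \<in> Harm4"
  shows "H = tensor4_of (coord4 H)"
proof -
  have s1: "H$i$j$k$l = H$j$i$k$l" and s2: "H$i$j$k$l = H$i$k$j$l" and s3: "H$i$j$k$l = H$i$j$l$k"
    and tr: "(\<Sum>i\<in>UNIV. H$i$i$k$l) = 0" for i j k l
    using assms unfolding Harm4_def mem_Collect_eq by blast+
  have one: "H$1$1$2$1 = H$1$1$1$2" "H$1$2$1$1 = H$1$1$2$1" "H$2$1$1$1 = H$1$2$1$1"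
    by (rule s3, rule s2, rule s1)
  have two: "H$1$2$1$2 = H$1$1$2$2" "H$1$2$2$1 = H$1$2$1$2" "H$2$1$1$2 = H$1$2$1$2"
    "H$2$1$2$1 = H$2$1$1$2" "H$2$2$1$1 = H$2$1$2$1"
    by (rule s2, rule s3, rule s1, rule s3, rule s2)
  have three: "H$2$1$2$2 = H$1$2$2$2" "H$2$2$1$2 = H$2$1$2$2" "H$2$2$2$1 = H$2$2$1$2"
    by (rule s1, rule s2, rule s3)
  have "H$1$1$2$2 = - H$1$1$1$1" "H$1$2$2$2 = - H$1$1$1$2" "H$2$2$2$2 = H$1$1$1$1"
    using tr[of 1 1] tr[of 1 2] tr[of 2 2] one two three unfolding sum_2 by linarith+
  with one two three show ?thesis
    by (simp add: vec_eq_iff forall_2 tensor4_components coord4_def)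
qed

lemma coord2_tensor2_of [simp]: "coord2 (tensor2_of u) = u"
  by (simp add: coord2_def tensor2_components)

lemma coord4_tensor4_of [simp]: "coord4 (tensor4_of u) = u"
  by (simp add: coord4_def tensor4_components)

lemma form2_tensor2_of: "form2 (tensor2_of u) x = Re (cnj u * zc x ^ 2)"
  by (simp add: form2_def sum_2 tensor2_components zc_def power2_eq_square algebra_simps)

lemma form4_tensor4_of: "form4 (tensor4_of u) x = Re (cnj u * zc x ^ 4)"
  by (simp add: form4_def sum_2 tensor4_components zc_def power4_eq_xxxx algebra_simps)

lemma coordinate_unique:
  assumes "\<And>x. Re (cnj u * zc x ^ n) = Re (cnj v * zc x ^ n)" "n = 2 \<or> n = 4"
  shows "u = v"
proof -
  have "Re u = Re v" using assms(1)[of "vector [1, 0]"] by (simp add: zc_def flip: one_complex.code)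
  \<comment> \<open>At \<open>2 + \<i>\<close> neither the second nor the fourth power is real.\<close>
  moreover have "zc (vector [2, 1]) ^ 2 = Complex 3 4" "zc (vector [2, 1]) ^ 4 = Complex (- 7) 24"
    by (simp_all add: zc_def complex_eq_iff power2_eq_square power4_eq_xxxx)
  ultimately have "Im u = Im v"
    using assms(1)[of "vector [2, 1]"] assms(2) by auto
  with \<open>Re u = Re v\<close> show ?thesis by (simp add: complex_eq_iff)
qed

lemma contr22_tensor2_of: "contr22 (tensor2_of u) (tensor2_of v) = 2 * Re (u * cnj v)"
  by (simp add: contr22_def sum_2 tensor2_components)

lemma contr44_tensor4_of: "contr44 (tensor4_of u) (tensor4_of v) = 8 * Re (u * cnj v)"
  by (simp add: contr44_def sum_2 tensor4_components)

lemma contr42_tensor4_of: "contr42 (tensor4_of U) (tensor2_of u) = tensor2_of (2 * U * cnj u)"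
  by (rule tensor2_eqI) (simp_all add: contr42_def sum_2 tensor4_components tensor2_components algebra_simps)

lemma contr242_tensor4_of:
  "contr242 (tensor2_of u) (tensor4_of U) (tensor2_of v) = 4 * Re (u * v * cnj U)"
  unfolding contr242_def contr42_tensor4_of contr22_tensor2_of by (simp add: algebra_simps)

lemma levi_civita_components:
  "levi_civita$1$1 = 0" "levi_civita$1$2 = 1" "levi_civita$2$1 = - 1" "levi_civita$2$2 = 0"
  by (simp_all add: levi_civita_def)

lemma cross22_tensor2_of: "cross22 (mat 1) (tensor2_of u) = tensor2_of (\<i> * u)"
  by (rule tensor2_eqI)
    (simp_all add: cross22_def sym2_def matrix_matrix_mult_def mat_def sum_2 levi_civita_components
      tensor2_components)

text \<open>A component of such a tensor depends on the number of indices equal to 2 only, which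
  permutations of the indices preserve.\<close>

lemma sym4_tensor4_of: "sym4 (tensor4_of u) = tensor4_of u"
proof -
  have "tensor4_of u $ ([i,j,k,l] ! \<pi> 0) $ ([i,j,k,l] ! \<pi> 1) $ ([i,j,k,l] ! \<pi> 2) $ ([i,j,k,l] ! \<pi> 3) =
      tensor4_of u $ i $ j $ k $ l" if "\<pi> permutes {..<4}" for \<pi> and i j k l :: 2
  proof -
    have "(\<Sum>m<4. is_second ([i,j,k,l] ! \<pi> m)) = (\<Sum>m<4. is_second ([i,j,k,l] ! m))"
      using sum.permute[OF that, of "\<lambda>m. is_second ([i,j,k,l] ! m)"] by (simp add: o_def)
    then show ?thesis by (simp add: tensor4_of_def eval_nat_numeral lessThan_Suc add_ac)
  qed
  then show ?thesis
    by (simp add: sym4_def vec_eq_iff card_permutations[of _ 4])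
qed

lemma cross24_tensor4_of: "cross24 (mat 1) (tensor4_of u) = tensor4_of (\<i> * u)"
proof -
  have "(\<chi> i j k l. \<Sum>a\<in>UNIV. \<Sum>b\<in>UNIV. mat 1$i$a * levi_civita$a$b * tensor4_of u$b$j$k$l) =
      tensor4_of (- \<i> * u)"
    by (simp add: vec_eq_iff forall_2 sum_2 mat_def levi_civita_components tensor4_components)
  then show ?thesis
    unfolding cross24_def by (simp only: sym4_tensor4_of) (simp add: vec_eq_iff forall_2 tensor4_components)
qed

section \<open>Equivariance of the coordinates\<close>

lemma zc_act:
  assumes "g \<in> O2"
  shows "zc (g *v x) = weight_act 1 g (zc x)"
  using assms
  by (cases rule: O2_cases)
    (simp_all add: zc_def weight_act_def first_column_def matrix_vector_mult_def sum_2 complex_eq_iff algebra_simps)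

lemma coord2_act:
  assumes "g \<in> O2"
  shows "coord2 (act2 g (tensor2_of u)) = weight_act 2 g u"
  using assms
  by (cases rule: O2_cases)
    (simp_all add: coord2_def act2_def weight_act_def first_column_def sum_2 tensor2_components complex_eq_iff
      power2_eq_square algebra_simps)

lemma coord4_act:
  assumes "g \<in> O2"
  shows "coord4 (act4 g (tensor4_of u)) = weight_act 4 g u"
  using assms
  by (cases rule: O2_cases)
    (simp_all add: coord4_def act4_def weight_act_def first_column_def sum_2 tensor4_components complex_eq_iff
      power4_eq_xxxx algebra_simps)

lemma sum4_swap:
  fixes F :: "2 \<Rightarrow> 2 \<Rightarrow> 2 \<Rightarrow> 2 \<Rightarrow> real"
  defines "S \<equiv> \<lambda>F. \<Sum>p\<in>UNIV. \<Sum>q\<in>UNIV. \<Sum>r\<in>UNIV. \<Sum>s\<in>UNIV. F p q r s"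
  shows "S F = S (\<lambda>p q r s. F q p r s)" "S F = S (\<lambda>p q r s. F p q s r)" "S F = S (\<lambda>p q r s. F r s p q)"
  unfolding S_def by (simp_all only: sum_2 add_ac)

lemma act4_Ela:
  assumes "C \<in> Ela"
  shows "act4 g C \<in> Ela"
proof -
  have s: "C$i$j$k$l = C$j$i$k$l" "C$i$j$k$l = C$i$j$l$k" "C$i$j$k$l = C$k$l$i$j" for i j k l
    using assms unfolding Ela_def mem_Collect_eq by blast+
  have "act4 g C$i$j$k$l = act4 g C$j$i$k$l" for i j k l
    unfolding act4_def vec_lambda_beta
    by (subst sum4_swap(1), intro sum.cong refl, subst s(1), simp only: mult_ac)
  moreover have "act4 g C$i$j$k$l = act4 g C$i$j$l$k" for i j k l
    unfolding act4_def vec_lambda_beta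
    by (subst sum4_swap(2), intro sum.cong refl, subst s(2), simp only: mult_ac)
  moreover have "act4 g C$i$j$k$l = act4 g C$k$l$i$j" for i j k l
    unfolding act4_def vec_lambda_beta
    by (subst sum4_swap(3), intro sum.cong refl, subst s(3), simp only: mult_ac)
  ultimately show ?thesis unfolding Ela_def mem_Collect_eq by blast
qed

lemma Ela_add: "C \<in> Ela \<Longrightarrow> D \<in> Ela \<Longrightarrow> C + D \<in> Ela"
  and Ela_scale: "C \<in> Ela \<Longrightarrow> t *\<^sub>R C \<in> Ela"
  unfolding Ela_def by auto

section \<open>Harmonic decompositions of pairs of elasticity tensors\<close>

locale harmonic_decomposition =
  fixes lam1 lam2 mu1 mu2 :: "tensor4 \<times> tensor4 \<Rightarrow> real"
    and h1 h2 :: "tensor4 \<times> tensor4 \<Rightarrow> tensor2"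
    and H1 H2 :: "tensor4 \<times> tensor4 \<Rightarrow> tensor4"
    and z2a z2b z4a z4b :: "tensor4 \<times> tensor4 \<Rightarrow> complex"
  assumes decomposition:
    "equivariant_linear_iso O2 Ela2 act_Ela2 Harm_sum act_Harm_sum
       (\<lambda>C. (lam1 C, lam2 C, mu1 C, mu2 C, h1 C, h2 C, H1 C, H2 C))"
    and z2a: "\<forall>C\<in>Ela2. \<forall>x. form2 (h1 C) x = Re (cnj (z2a C) * (zc x)^2)"
    and z2b: "\<forall>C\<in>Ela2. \<forall>x. form2 (h2 C) x = Re (cnj (z2b C) * (zc x)^2)"
    and z4a: "\<forall>C\<in>Ela2. \<forall>x. form4 (H1 C) x = Re (cnj (z4a C) * (zc x)^4)"
    and z4b: "\<forall>C\<in>Ela2. \<forall>x. form4 (H2 C) x = Re (cnj (z4b C) * (zc x)^4)"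
begin

abbreviation "\<Phi> \<equiv> \<lambda>C. (lam1 C, lam2 C, mu1 C, mu2 C, h1 C, h2 C, H1 C, H2 C)"

lemma \<Phi>_bij: "bij_betw \<Phi> Ela2 Harm_sum"
  using decomposition unfolding equivariant_linear_iso_def by blast

lemma \<Phi>_add: "C \<in> Ela2 \<Longrightarrow> D \<in> Ela2 \<Longrightarrow> \<Phi> (C + D) = \<Phi> C + \<Phi> D"
  using decomposition unfolding equivariant_linear_iso_def by blast

lemma \<Phi>_scale: "C \<in> Ela2 \<Longrightarrow> \<Phi> (t *\<^sub>R C) = t *\<^sub>R \<Phi> C"
  using decomposition unfolding equivariant_linear_iso_def by blast

lemma \<Phi>_act: "g \<in> O2 \<Longrightarrow> C \<in> Ela2 \<Longrightarrow> \<Phi> (act_Ela2 g C) = act_Harm_sum g (\<Phi> C)"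
  using decomposition unfolding equivariant_linear_iso_def by blast

text \<open>The polynomial of a harmonic tensor determines its complex coordinate, and the latter
  determines the tensor.\<close>

lemma harmonic_parts:
  assumes "C \<in> Ela2"
  shows "h1 C = tensor2_of (z2a C)" "h2 C = tensor2_of (z2b C)"
    "H1 C = tensor4_of (z4a C)" "H2 C = tensor4_of (z4b C)"
proof -
  have mem: "h1 C \<in> Harm2" "h2 C \<in> Harm2" "H1 C \<in> Harm4" "H2 C \<in> Harm4"
    using bij_betwE[OF \<Phi>_bij] assms by (auto simp: Harm_sum_def)
  have 2: "h = tensor2_of z" if "h \<in> Harm2" "\<forall>x. form2 h x = Re (cnj z * (zc x)^2)" for h z
  proof -
    have "coord2 h = z"
      using that(2) form2_tensor2_of[of "coord2 h"] unfolding Harm2_eq[OF that(1), symmetric]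
      by (intro coordinate_unique[of _ 2]) auto
    then show ?thesis using Harm2_eq[OF that(1)] by simp
  qed
  have 4: "h = tensor4_of z" if "h \<in> Harm4" "\<forall>x. form4 h x = Re (cnj z * (zc x)^4)" for h z
  proof -
    have "coord4 h = z"
      using that(2) form4_tensor4_of[of "coord4 h"] unfolding Harm4_eq[OF that(1), symmetric]
      by (intro coordinate_unique[of _ 4]) auto
    then show ?thesis using Harm4_eq[OF that(1)] by simp
  qed
  show "h1 C = tensor2_of (z2a C)" by (rule 2[OF mem(1)]) (use z2a assms in blast)
  show "h2 C = tensor2_of (z2b C)" by (rule 2[OF mem(2)]) (use z2b assms in blast)
  show "H1 C = tensor4_of (z4a C)" by (rule 4[OF mem(3)]) (use z4a assms in blast)
  show "H2 C = tensor4_of (z4b C)" by (rule 4[OF mem(4)]) (use z4b assms in blast)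
qed

definition coords_of :: "pair4 \<times> (real^2) \<Rightarrow> coords" where
  "coords_of = (\<lambda>(C, x). (lam1 C, lam2 C, mu1 C, mu2 C, z2a C, z2b C, z4a C, z4b C, zc x))"

definition tensors_of :: "coords \<Rightarrow> harm_sum" where
  "tensors_of k = (cl1 k, cl2 k, cm1 k, cm2 k, tensor2_of (ca k), tensor2_of (cb k),
     tensor4_of (cA k), tensor4_of (cB k))"

definition from_coords :: "coords \<Rightarrow> pair4 \<times> (real^2)" where
  "from_coords k = (inv_into Ela2 \<Phi> (tensors_of k), vector [Re (cz k), Im (cz k)])"

lemma \<Phi>_eq: "C \<in> Ela2 \<Longrightarrow> \<Phi> C = tensors_of (coords_of (C, x))"
  by (simp add: tensors_of_def coords_of_def harmonic_parts)

lemma tensors_of_mem: "tensors_of k \<in> Harm_sum"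
  by (simp add: tensors_of_def Harm_sum_def Harm2_tensor2_of Harm4_tensor4_of)

lemma from_coords_mem: "fst (from_coords k) \<in> Ela2"
  using inv_into_into[of "tensors_of k" \<Phi> Ela2] tensors_of_mem[of k] \<Phi>_bij
  by (simp add: from_coords_def bij_betw_def)

lemma \<Phi>_from_coords: "\<Phi> (fst (from_coords k)) = tensors_of k"
  using bij_betw_inv_into_right[OF \<Phi>_bij tensors_of_mem[of k]] by (simp only: from_coords_def fst_conv)

lemma tensors_of_inject: "tensors_of k = tensors_of k' \<Longrightarrow>
  (cl1 k, cl2 k, cm1 k, cm2 k, ca k, cb k, cA k, cB k) = (cl1 k', cl2 k', cm1 k', cm2 k', ca k', cb k', cA k', cB k')"
  unfolding tensors_of_def prod.inject by (metis coord2_tensor2_of coord4_tensor4_of)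

lemma Ela2_add: "C \<in> Ela2 \<Longrightarrow> D \<in> Ela2 \<Longrightarrow> C + D \<in> Ela2"
  and Ela2_scale: "C \<in> Ela2 \<Longrightarrow> t *\<^sub>R C \<in> Ela2"
  by (auto simp: Ela2_def Ela_add Ela_scale)

lemma tensors_of_add: "tensors_of (k + k') = tensors_of k + tensors_of k'"
  and tensors_of_scale: "tensors_of (t *\<^sub>R k) = t *\<^sub>R tensors_of k"
  by (simp_all add: tensors_of_def coord_defs tensor2_of_def tensor4_of_def vec_eq_iff algebra_simps)

lemma \<Phi>_inject: "C \<in> Ela2 \<Longrightarrow> D \<in> Ela2 \<Longrightarrow> \<Phi> C = \<Phi> D \<Longrightarrow> C = D"
  using \<Phi>_bij unfolding bij_betw_def by (blast dest: inj_onD)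

lemma linear_from_coords: "linear from_coords"
proof (rule linearI)
  fix k k' :: coords and t :: real
  have "fst (from_coords (k + k')) = fst (from_coords k) + fst (from_coords k')"
    by (rule \<Phi>_inject[OF from_coords_mem Ela2_add[OF from_coords_mem from_coords_mem]])
      (simp only: \<Phi>_add[OF from_coords_mem from_coords_mem] \<Phi>_from_coords tensors_of_add)
  moreover have "snd (from_coords (k + k')) = snd (from_coords k) + snd (from_coords k')"
    by (simp add: from_coords_def vec_eq_iff forall_2 coord_defs)
  ultimately show "from_coords (k + k') = from_coords k + from_coords k'"
    by (simp add: prod_eq_iff)
  have "fst (from_coords (t *\<^sub>R k)) = t *\<^sub>R fst (from_coords k)"
    by (rule \<Phi>_inject[OF from_coords_mem Ela2_scale[OF from_coords_mem]])
      (simp only: \<Phi>_scale[OF from_coords_mem] \<Phi>_from_coords tensors_of_scale)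
  moreover have "snd (from_coords (t *\<^sub>R k)) = t *\<^sub>R snd (from_coords k)"
    by (simp add: from_coords_def vec_eq_iff forall_2 coord_defs)
  ultimately show "from_coords (t *\<^sub>R k) = t *\<^sub>R from_coords k"
    by (simp add: prod_eq_iff)
qed

lemma coords_of_from_coords: "coords_of (from_coords k) = k"
proof -
  have "tensors_of (coords_of (from_coords k)) = tensors_of k"
    using \<Phi>_eq[OF from_coords_mem, of k "snd (from_coords k)"] \<Phi>_from_coords[of k]
    by (simp only: prod.collapse)
  from tensors_of_inject[OF this] have
    "(cl1 (coords_of (from_coords k)), cl2 (coords_of (from_coords k)), cm1 (coords_of (from_coords k)),
      cm2 (coords_of (from_coords k)), ca (coords_of (from_coords k)), cb (coords_of (from_coords k)),
      cA (coords_of (from_coords k)), cB (coords_of (from_coords k))) =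
     (cl1 k, cl2 k, cm1 k, cm2 k, ca k, cb k, cA k, cB k)" .
  moreover have "cz (coords_of (from_coords k)) = cz k"
    by (simp add: coords_of_def from_coords_def zc_def)
  ultimately show ?thesis
    unfolding prod.inject by (subst (1 2) coords_eta) (simp only: simp_thms)
qed

lemma from_coords_coords_of:
  assumes "C \<in> Ela2"
  shows "from_coords (coords_of (C, x)) = (C, x)"
proof -
  have "fst (from_coords (coords_of (C, x))) = C"
    by (rule \<Phi>_inject[OF from_coords_mem assms]) (simp only: \<Phi>_from_coords \<Phi>_eq[OF assms, of x])
  moreover have "snd (from_coords (coords_of (C, x))) = x"
    by (simp add: from_coords_def coords_of_def zc_def vec_eq_iff forall_2)
  ultimately show ?thesis by (simp add: prod_eq_iff)
qed

sublocale coordinates "Ela2 \<times> (UNIV :: (real^2) set)" coords_of from_coords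
proof (rule coordinates.intro)
  show "linear from_coords" by (rule linear_from_coords)
  show "range from_coords = Ela2 \<times> UNIV"
  proof
    have "from_coords k \<in> Ela2 \<times> UNIV" for k using from_coords_mem[of k] by (simp add: mem_Times_iff)
    then show "range from_coords \<subseteq> Ela2 \<times> UNIV" by blast
    show "Ela2 \<times> UNIV \<subseteq> range from_coords"
    proof
      fix v :: "pair4 \<times> (real^2)" assume "v \<in> Ela2 \<times> UNIV"
      then have "from_coords (coords_of v) = v"
        using from_coords_coords_of[of "fst v" "snd v"] by (simp add: mem_Times_iff)
      then show "v \<in> range from_coords" by (metis rangeI)
    qed
  qed
  show "coords_of (from_coords k) = k" for k by (rule coords_of_from_coords)
qed

lemma act_Ela2_mem: "C \<in> Ela2 \<Longrightarrow> act_Ela2 g C \<in> Ela2"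
  by (auto simp: Ela2_def act_Ela2_def act4_Ela)

lemma coords_of_act:
  assumes "g \<in> O2" "C \<in> Ela2"
  shows "coords_of (act_Ela2 g C, g *v x) = act_coords g (coords_of (C, x))"
proof -
  have "\<Phi> (act_Ela2 g C) = act_Harm_sum g (\<Phi> C)" by (rule \<Phi>_act[OF assms])
  then have *: "lam1 (act_Ela2 g C) = lam1 C" "lam2 (act_Ela2 g C) = lam2 C"
    "mu1 (act_Ela2 g C) = mu1 C" "mu2 (act_Ela2 g C) = mu2 C"
    "h1 (act_Ela2 g C) = act2 g (h1 C)" "h2 (act_Ela2 g C) = act2 g (h2 C)"
    "H1 (act_Ela2 g C) = act4 g (H1 C)" "H2 (act_Ela2 g C) = act4 g (H2 C)"
    unfolding act_Harm_sum_def by simp_all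
  note parts = harmonic_parts[OF assms(2)] and parts' = harmonic_parts[OF act_Ela2_mem[OF assms(2), of g]]
  have "z2a (act_Ela2 g C) = weight_act 2 g (z2a C)" "z2b (act_Ela2 g C) = weight_act 2 g (z2b C)"
    using arg_cong[OF *(5), of coord2] arg_cong[OF *(6), of coord2]
    by (simp_all only: parts parts' coord2_act[OF assms(1)] coord2_tensor2_of)
  moreover have "z4a (act_Ela2 g C) = weight_act 4 g (z4a C)" "z4b (act_Ela2 g C) = weight_act 4 g (z4b C)"
    using arg_cong[OF *(7), of coord4] arg_cong[OF *(8), of coord4]
    by (simp_all only: parts parts' coord4_act[OF assms(1)] coord4_tensor4_of)
  ultimately show ?thesis
    by (simp add: coords_of_def act_coords_def * zc_act[OF assms(1)])
qed

lemma Cov_minimal_integrity_basis: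
  assumes "minimal_integrity_basis UNIV (Inv_algebra UNIV G act_coords) B" "G \<subseteq> O2"
  shows "minimal_integrity_basis (Ela2 \<times> UNIV) (Cov_algebra Ela2 G act_Ela2) (pull ` B)"
  unfolding Cov_algebra_def
proof (rule pull_minimal_integrity_basis[OF assms(1)])
  fix g and v :: "pair4 \<times> (real^2)" assume "g \<in> G" "v \<in> Ela2 \<times> UNIV"
  moreover from this have "g \<in> O2" using assms(2) by blast
  ultimately show "(case v of (v, x) \<Rightarrow> (act_Ela2 g v, g *v x)) \<in> Ela2 \<times> UNIV \<and>
      coords_of (case v of (v, x) \<Rightarrow> (act_Ela2 g v, g *v x)) = act_coords g (coords_of v)"
    by (cases v) (simp add: act_Ela2_mem coords_of_act)
qed

lemma zc_scale: "zc (t *\<^sub>R x) = of_real t * zc x"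
  by (simp add: zc_def complex_eq_iff)

lemma has_order_pull: "has_order Ela2 n (pull f) \<longleftrightarrow> x_order n f"
proof -
  have step: "coords_of (C, t *\<^sub>R x) = scale_x t (coords_of (C, x))" for C t x
    by (simp add: coords_of_def scale_x_def zc_scale)
  have pull: "pull f (C, x) = f (coords_of (C, x))" if "C \<in> Ela2" for C x
    using that by (simp add: pull_def)
  show ?thesis
  proof
    assume "x_order n f"
    then have order: "f (scale_x t k) = t ^ n * f k" for t k unfolding x_order_def by blast
    show "has_order Ela2 n (pull f)"
      unfolding has_order_def by (intro ballI allI) (simp only: pull step order)
  next
    assume order: "has_order Ela2 n (pull f)"
    show "x_order n f"
      unfolding x_order_def
    proof (intro allI)
      fix t k
      obtain C x where C: "C \<in> Ela2" "coords_of (C, x) = k"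
        using from_coords_mem[of k] coords_of_from_coords[of k] by (metis prod.collapse)
      have "pull f (C, t *\<^sub>R x) = t ^ n * pull f (C, x)"
        using order C(1) unfolding has_order_def by blast
      then show "f (scale_x t k) = t ^ n * f k"
        by (simp only: pull[OF C(1)] step C(2))
    qed
  qed
qed

lemma card_pull: "card (pull ` B) = card B"
  by (rule card_image) (rule inj_on_subset[OF inj_pull subset_UNIV])

lemma card_pull_invariant: "card {h \<in> pull ` B. has_order Ela2 0 h} = card {f \<in> B. x_order 0 f}"
proof -
  have "{h \<in> pull ` B. has_order Ela2 0 h} = pull ` {f \<in> B. x_order 0 f}"
    using has_order_pull[of 0] by blast
  then show ?thesis by (simp only: card_pull)
qed

lemma restrict_all_pull: "restrict_all (Ela2 \<times> UNIV) (map (\<lambda>f v. f (coords_of v)) fs) = pull ` set fs"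
  by (simp add: restrict_all_def pull_def image_image)

lemma gens_coords_of:
  "scalars lam1 lam2 mu1 mu2 @ moduli z2a z2b z4a z4b = map (\<lambda>f v. f (coords_of v)) real_gens"
  "monomials z2a z2b z4a z4b = map (\<lambda>f v. f (coords_of v)) complex_gens"
  "im_products z2a z2b z4a z4b = map (\<lambda>f v. f (coords_of v)) product_gens"
  by (simp_all add: scalars_def moduli_def real_gens_def monomials_def monomials0_def monomials2_def
      monomials4_def complex_gens_def im_products_def product_gens_def coords_of_def fun_eq_iff)

lemma bases_pull:
  "restrict_all (Ela2 \<times> UNIV) (scalars lam1 lam2 mu1 mu2 @ moduli z2a z2b z4a z4b @
     re_parts (monomials z2a z2b z4a z4b) @ im_parts (monomials z2a z2b z4a z4b)) = pull ` set SO2_gens"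
  "restrict_all (Ela2 \<times> UNIV) (scalars lam1 lam2 mu1 mu2 @ moduli z2a z2b z4a z4b @
     re_parts (monomials z2a z2b z4a z4b) @ im_products z2a z2b z4a z4b) = pull ` set O2_gens"
proof -
  have "re_parts (map (\<lambda>f v. f (coords_of v)) ms) = map (\<lambda>f v. f (coords_of v)) (re_parts ms)"
    "im_parts (map (\<lambda>f v. f (coords_of v)) ms) = map (\<lambda>f v. f (coords_of v)) (im_parts ms)" for ms
    by (simp_all add: re_parts_def im_parts_def)
  then show "restrict_all (Ela2 \<times> UNIV) (scalars lam1 lam2 mu1 mu2 @ moduli z2a z2b z4a z4b @
     re_parts (monomials z2a z2b z4a z4b) @ im_parts (monomials z2a z2b z4a z4b)) = pull ` set SO2_gens"
    "restrict_all (Ela2 \<times> UNIV) (scalars lam1 lam2 mu1 mu2 @ moduli z2a z2b z4a z4b @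
     re_parts (monomials z2a z2b z4a z4b) @ im_products z2a z2b z4a z4b) = pull ` set O2_gens"
    unfolding append_assoc[symmetric, of "scalars _ _ _ _"] gens_coords_of SO2_gens_def O2_gens_def
    by (simp_all only: map_append[symmetric] restrict_all_pull)
qed

lemma monomials_order:
  "m \<in> set (monomials0 z2a z2b z4a z4b) \<Longrightarrow> has_order Ela2 0 (\<lambda>v. Re (m v)) \<and> has_order Ela2 0 (\<lambda>v. Im (m v))"
  "m \<in> set (monomials2 z2a z2b z4a z4b) \<Longrightarrow> has_order Ela2 2 (\<lambda>v. Re (m v)) \<and> has_order Ela2 2 (\<lambda>v. Im (m v))"
  "m \<in> set (monomials4 z4a z4b) \<Longrightarrow> has_order Ela2 4 (\<lambda>v. Re (m v)) \<and> has_order Ela2 4 (\<lambda>v. Im (m v))"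
proof -
  have order: "has_order Ela2 n (\<lambda>v. Re (m v)) \<and> has_order Ela2 n (\<lambda>v. Im (m v))"
    if "\<forall>C x t. m (C, t *\<^sub>R x) = of_real (t ^ n) * m (C, x)" for m n
    unfolding has_order_def that[rule_format] Re_complex_of_real_mult Im_complex_of_real_mult by blast
  show "m \<in> set (monomials0 z2a z2b z4a z4b) \<Longrightarrow> has_order Ela2 0 (\<lambda>v. Re (m v)) \<and> has_order Ela2 0 (\<lambda>v. Im (m v))"
    by (rule order) (auto simp: monomials0_def)
  show "m \<in> set (monomials2 z2a z2b z4a z4b) \<Longrightarrow> has_order Ela2 2 (\<lambda>v. Re (m v)) \<and> has_order Ela2 2 (\<lambda>v. Im (m v))"
    by (rule order) (auto simp: monomials2_def zc_scale power_mult_distrib)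
  show "m \<in> set (monomials4 z4a z4b) \<Longrightarrow> has_order Ela2 4 (\<lambda>v. Re (m v)) \<and> has_order Ela2 4 (\<lambda>v. Im (m v))"
    by (rule order) (auto simp: monomials4_def zc_scale power_mult_distrib)
qed

lemma proportional_onI:
  assumes "c \<noteq> 0" "\<And>C x. C \<in> Ela2 \<Longrightarrow> t (C, x) = c * f (C, x)"
  shows "proportional_on (Ela2 \<times> UNIV) f t"
  using assms unfolding proportional_on_def by (intro exI[of _ c]) auto

lemma form2_one: "form2 (mat 1) x = Re (zc x * cnj (zc x))"
  by (simp add: form2_def sum_2 mat_def zc_def)

lemmas tensor_simps = harmonic_parts contr22_tensor2_of contr44_tensor4_of contr242_tensor4_of
  contr42_tensor4_of cross22_tensor2_of cross24_tensor4_of form2_tensor2_of form4_tensor4_of form2_one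

lemma tensorial_forms:
  "list_all2 (proportional_on (Ela2 \<times> UNIV)) (moduli z2a z2b z4a z4b) (moduli_tensorial h1 h2 H1 H2)"
  "list_all2 (proportional_on (Ela2 \<times> UNIV)) (re_parts (monomials z2a z2b z4a z4b)) (re_tensorial h1 h2 H1 H2)"
  "list_all2 (proportional_on (Ela2 \<times> UNIV)) (im_parts (monomials z2a z2b z4a z4b)) (im_tensorial h1 h2 H1 H2)"
  "list_all2 (proportional_on (Ela2 \<times> UNIV)) (im_products z2a z2b z4a z4b) (im_products_tensorial h1 h2 H1 H2)"
proof -
  show "list_all2 (proportional_on (Ela2 \<times> UNIV)) (moduli z2a z2b z4a z4b) (moduli_tensorial h1 h2 H1 H2)"
    unfolding moduli_def moduli_tensorial_def
    by (intro list.rel_intros)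
      ((rule proportional_onI[of "2"], simp, simp add: tensor_simps power2_eq_square algebra_simps; fail)+,
      (rule proportional_onI[of "8"], simp, simp add: tensor_simps power2_eq_square algebra_simps; fail)+,
      (rule proportional_onI[of "1"], simp, simp add: tensor_simps power2_eq_square algebra_simps; fail)+)
  show "list_all2 (proportional_on (Ela2 \<times> UNIV)) (re_parts (monomials z2a z2b z4a z4b)) (re_tensorial h1 h2 H1 H2)"
    unfolding re_parts_def re_tensorial_def monomials_def monomials0_def monomials2_def monomials4_def append.simps list.map
    by (intro list.rel_intros)
      ((rule proportional_onI[of "2"], simp, simp add: tensor_simps power2_eq_square algebra_simps; fail)+,
      (rule proportional_onI[of "8"], simp, simp add: tensor_simps power2_eq_square algebra_simps; fail)+,
      (rule proportional_onI[of "4"], simp, simp add: tensor_simps power2_eq_square algebra_simps; fail)+,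
      (rule proportional_onI[of "1"], simp, simp add: tensor_simps power2_eq_square algebra_simps; fail)+,
      (rule proportional_onI[of "2"], simp, simp add: tensor_simps power2_eq_square algebra_simps; fail)+,
      (rule proportional_onI[of "1"], simp, simp add: tensor_simps power2_eq_square algebra_simps; fail)+)
  show "list_all2 (proportional_on (Ela2 \<times> UNIV)) (im_parts (monomials z2a z2b z4a z4b)) (im_tensorial h1 h2 H1 H2)"
    unfolding im_parts_def im_tensorial_def monomials_def monomials0_def monomials2_def monomials4_def append.simps list.map
    by (intro list.rel_intros)
      ((rule proportional_onI[of "2"], simp, simp add: tensor_simps power2_eq_square algebra_simps; fail)+,
      (rule proportional_onI[of "8"], simp, simp add: tensor_simps power2_eq_square algebra_simps; fail)+,
      (rule proportional_onI[of "- 4"], simp, simp add: tensor_simps power2_eq_square algebra_simps; fail)+,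
      (rule proportional_onI[of "1"], simp, simp add: tensor_simps power2_eq_square algebra_simps; fail)+,
      (rule proportional_onI[of "- 2"], simp, simp add: tensor_simps power2_eq_square algebra_simps; fail)+,
      (rule proportional_onI[of "1"], simp, simp add: tensor_simps power2_eq_square algebra_simps; fail)+)
  show "list_all2 (proportional_on (Ela2 \<times> UNIV)) (im_products z2a z2b z4a z4b) (im_products_tensorial h1 h2 H1 H2)"
    unfolding im_products_def im_products_tensorial_def
    by (intro list.rel_intros)
      ((rule proportional_onI[of "16"], simp, simp add: tensor_simps power2_eq_square algebra_simps; fail)+,
      (rule proportional_onI[of "8"], simp, simp add: tensor_simps power2_eq_square algebra_simps; fail)+)
qed

end

theorem theorem8p10:
  fixes lam1 lam2 mu1 mu2 :: "tensor4 \<times> tensor4 \<Rightarrow> real"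
    and h1 h2 :: "tensor4 \<times> tensor4 \<Rightarrow> tensor2"
    and H1 H2 :: "tensor4 \<times> tensor4 \<Rightarrow> tensor4"
    and z2a z2b z4a z4b :: "tensor4 \<times> tensor4 \<Rightarrow> complex"
  assumes decomposition:
    "equivariant_linear_iso O2 Ela2 act_Ela2 Harm_sum act_Harm_sum
       (\<lambda>C. (lam1 C, lam2 C, mu1 C, mu2 C, h1 C, h2 C, H1 C, H2 C))"
    and z2a: "\<forall>C\<in>Ela2. \<forall>x. form2 (h1 C) x = Re (cnj (z2a C) * (zc x)^2)"
    and z2b: "\<forall>C\<in>Ela2. \<forall>x. form2 (h2 C) x = Re (cnj (z2b C) * (zc x)^2)"
    and z4a: "\<forall>C\<in>Ela2. \<forall>x. form4 (H1 C) x = Re (cnj (z4a C) * (zc x)^4)"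
    and z4b: "\<forall>C\<in>Ela2. \<forall>x. form4 (H2 C) x = Re (cnj (z4b C) * (zc x)^4)"
  shows
    "let V = Ela2 \<times> (UNIV :: (real^2) set);
         L = monomials z2a z2b z4a z4b;
         S = scalars lam1 lam2 mu1 mu2;
         N = moduli z2a z2b z4a z4b;
         P = im_products z2a z2b z4a z4b;
         B_SO = restrict_all V (S @ N @ re_parts L @ im_parts L);
         B_O = restrict_all V (S @ N @ re_parts L @ P)
     in
       (minimal_integrity_basis V (Cov_algebra Ela2 SO2 act_Ela2) B_SO
        \<and> card B_SO = 41 \<and> card {f \<in> B_SO. has_order Ela2 0 f} = 24)
     \<and> (minimal_integrity_basis V (Cov_algebra Ela2 O2 act_Ela2) B_O
        \<and> card B_O = 28 \<and> card {f \<in> B_O. has_order Ela2 0 f} = 17)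
     \<and> (\<forall>m \<in> set (monomials0 z2a z2b z4a z4b).
          has_order Ela2 0 (\<lambda>v. Re (m v)) \<and> has_order Ela2 0 (\<lambda>v. Im (m v)))
     \<and> (\<forall>m \<in> set (monomials2 z2a z2b z4a z4b).
          has_order Ela2 2 (\<lambda>v. Re (m v)) \<and> has_order Ela2 2 (\<lambda>v. Im (m v)))
     \<and> (\<forall>m \<in> set (monomials4 z4a z4b).
          has_order Ela2 4 (\<lambda>v. Re (m v)) \<and> has_order Ela2 4 (\<lambda>v. Im (m v)))
     \<and> list_all2 (proportional_on V) N (moduli_tensorial h1 h2 H1 H2)
     \<and> list_all2 (proportional_on V) (re_parts L) (re_tensorial h1 h2 H1 H2)
     \<and> list_all2 (proportional_on V) (im_parts L) (im_tensorial h1 h2 H1 H2)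
     \<and> list_all2 (proportional_on V) P (im_products_tensorial h1 h2 H1 H2)"
proof -
  interpret harmonic_decomposition lam1 lam2 mu1 mu2 h1 h2 H1 H2 z2a z2b z4a z4b
    by unfold_locales (fact assms)+
  have "SO2 \<subseteq> O2" by (auto simp: SO2_def)
  show ?thesis
    unfolding Let_def bases_pull card_pull card_pull_invariant
    by (intro conjI ballI Cov_minimal_integrity_basis minimal_integrity_basis_SO2 minimal_integrity_basis_O2
        card_gens card_invariant_gens monomials_order tensorial_forms \<open>SO2 \<subseteq> O2\<close> subset_refl)
qed

end
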